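(* Let $\phi(s)=\sum_{n\ge1}a(n)\lambda_n^{-s}$ be a Dirichlet series belonging to the class $\mathcal A$ with parameter $r>0$ and dual series $\psi(s)=\sum_{n\ge1}b(n)\mu_n^{-s}$ (see context). Suppose that $b(n)=\overline{a(n)}$ and $\lambda_n=\mu_n$ for all $n$, and that the abscissa of absolute convergence $\sigma_a$ of $\phi$ satisfies $\sigma_a<\min\{1,r\}+\frac12\max\{1,r\}$. Assume also that $\arg a(n)$ is constant, i.e. there is $\vartheta\in\mathbb R$ with $a(n)=|a(n)|e^{i\vartheta}$ for all $n\in\mathbb N$. (i) If $r<1$, then $\phi(s)$ has infinitely many zeros on the critical line $\mathrm{Re}(s)=\frac r2$. (ii) If $r=1$ and $$|a(c)|>\sqrt{2\pi\lambda_c}\,|\rho|,$$ where $\rho$ denotes the residue of $\phi$ at $s=1$ and $c$ denotes the least positive integer for which $a(c)\ne0$, then $\phi(s)$ has infinitely many zeros on the critical line $\mathrm{Re}(s)=\frac12$.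
   Context: Hecke pair with parameter $r>0$: $(\lambda_n)_{n\ge1}$, $(\mu_n)_{n\ge1}$ are sequences of positive numbers strictly increasing to $\infty$; $(a(n))_{n\ge1}$, $(b(n))_{n\ge1}$ are complex sequences, not identically zero; $\phi(s)=\sum_{n\ge1}a(n)\lambda_n^{-s}$ and $\psi(s)=\sum_{n\ge1}b(n)\mu_n^{-s}$ have finite abscissas of absolute convergence $\sigma_a$, $\sigma_b$; and there is a meromorphic function $\chi$ on $\mathbb C$ such that (1) $\chi(s)=\Gamma(s)\phi(s)$ for $\mathrm{Re}(s)>\sigma_a$ and $\chi(s)=\Gamma(r-s)\psi(r-s)$ for $\mathrm{Re}(s)<r-\sigma_b$; (2) $\lim_{|\mathrm{Im}(s)|\to\infty}\chi(s)=0$ uniformly in every strip $\sigma_1\le\mathrm{Re}(s)\le\sigma_2$; (3) the singularities of $\chi$ are at most poles and are confined to some compact set. Class $\mathcal A$: $\phi$ belongs to $\mathcal A$ (with parameter $r$ and dual series $\psi$) if $(\phi,\psi)$ is a Hecke pair with parameter $r$; $\phi$ and $\psi$ have analytic continuations to $\mathbb C$, analytic except for possible simple poles at $s=r$ with residues $\rho$ and $\rho^\star$ respectively (residue $0$ if there is no pole); and the coefficients are extended to $n=0$ by $a(0):=-\phi(0)$, $b(0):=-\psi(0)$. *)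

theory Defs
  imports "HOL-Complex_Analysis.Complex_Analysis"
begin

text \<open>
  Coefficient and exponent sequences are functions on \<open>nat\<close>; a series uses only the indices
  \<open>n \<ge> 1\<close>, hence the shift by \<open>Suc\<close>. The value at index \<open>0\<close> of a coefficient sequence is
  reserved for the extension \<open>a(0) = -\<phi>(0)\<close>; exponents at index \<open>0\<close> are irrelevant.
\<close>

definition gen_dirichlet_series :: "(nat \<Rightarrow> complex) \<Rightarrow> (nat \<Rightarrow> real) \<Rightarrow> complex \<Rightarrow> complex" where
  "gen_dirichlet_series a lam s = (\<Sum>n. a (Suc n) * complex_of_real (lam (Suc n)) powr (- s))"

definition abs_conv_abscissa :: "(nat \<Rightarrow> complex) \<Rightarrow> (nat \<Rightarrow> real) \<Rightarrow> ereal" where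
  "abs_conv_abscissa a lam =
     Inf {ereal \<sigma> |\<sigma>. summable (\<lambda>n. norm (a (Suc n)) * lam (Suc n) powr (- \<sigma>))}"

definition exponent_seq :: "(nat \<Rightarrow> real) \<Rightarrow> bool" where
  "exponent_seq lam \<longleftrightarrow>
     (\<forall>n\<ge>1. 0 < lam n) \<and> strict_mono_on {1..} lam \<and> filterlim lam at_top sequentially"

text \<open>
  The two formulas for \<open>\<chi>\<close> are identities of meromorphic functions. They are required away from
  the poles of the Gamma factor, where \<^const>\<open>Gamma\<close> takes the value \<open>0\<close> by convention.
\<close>

definition hecke_pair ::
  "real \<Rightarrow> (nat \<Rightarrow> complex) \<Rightarrow> (nat \<Rightarrow> real) \<Rightarrow> (nat \<Rightarrow> complex) \<Rightarrow> (nat \<Rightarrow> real) \<Rightarrow> bool" where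
  "hecke_pair r a lam b mu \<longleftrightarrow>
     0 < r \<and> exponent_seq lam \<and> exponent_seq mu \<and>
     (\<exists>n\<ge>1. a n \<noteq> 0) \<and> (\<exists>n\<ge>1. b n \<noteq> 0) \<and>
     \<bar>abs_conv_abscissa a lam\<bar> \<noteq> \<infinity> \<and> \<bar>abs_conv_abscissa b mu\<bar> \<noteq> \<infinity> \<and>
     (\<exists>chi :: complex \<Rightarrow> complex.
        chi meromorphic_on UNIV \<and>
        (\<forall>s. abs_conv_abscissa a lam < ereal (Re s) \<longrightarrow> s \<notin> \<int>\<^sub>\<le>\<^sub>0 \<longrightarrow>
             chi s = Gamma s * gen_dirichlet_series a lam s) \<and>
        (\<forall>s. ereal (Re s) < ereal r - abs_conv_abscissa b mu \<longrightarrow> of_real r - s \<notin> \<int>\<^sub>\<le>\<^sub>0 \<longrightarrow>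
             chi s = Gamma (of_real r - s) * gen_dirichlet_series b mu (of_real r - s)) \<and>
        (\<forall>\<sigma>\<^sub>1 \<sigma>\<^sub>2. \<forall>\<epsilon>>0. \<exists>T. \<forall>s. \<sigma>\<^sub>1 \<le> Re s \<longrightarrow> Re s \<le> \<sigma>\<^sub>2 \<longrightarrow> T \<le> \<bar>Im s\<bar> \<longrightarrow> norm (chi s) < \<epsilon>) \<and>
        (\<exists>K. compact K \<and> chi analytic_on (- K)))"

definition analytic_upto_simple_pole :: "(complex \<Rightarrow> complex) \<Rightarrow> complex \<Rightarrow> bool" where
  "analytic_upto_simple_pole f z \<longleftrightarrow>
     f analytic_on (UNIV - {z}) \<and> (f analytic_on {z} \<or> is_pole f z \<and> zorder f z = -1)"

text \<open>
  The functions \<open>phi\<close> and \<open>psi\<close> are the continuations of the two Dirichlet series. The residue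
  \<open>\<rho>\<close> is \<open>residue phi (of_real r)\<close>, which is \<open>0\<close> if \<open>phi\<close> is analytic at \<open>r\<close>.
\<close>

definition class_A ::
  "real \<Rightarrow> (nat \<Rightarrow> complex) \<Rightarrow> (nat \<Rightarrow> real) \<Rightarrow> (nat \<Rightarrow> complex) \<Rightarrow> (nat \<Rightarrow> real) \<Rightarrow>
   (complex \<Rightarrow> complex) \<Rightarrow> (complex \<Rightarrow> complex) \<Rightarrow> bool" where
  "class_A r a lam b mu phi psi \<longleftrightarrow>
     hecke_pair r a lam b mu \<and>
     (\<forall>s. abs_conv_abscissa a lam < ereal (Re s) \<longrightarrow> phi s = gen_dirichlet_series a lam s) \<and>
     (\<forall>s. abs_conv_abscissa b mu < ereal (Re s) \<longrightarrow> psi s = gen_dirichlet_series b mu s) \<and>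
     analytic_upto_simple_pole phi (of_real r) \<and>
     analytic_upto_simple_pole psi (of_real r) \<and>
     a 0 = - phi 0 \<and> b 0 = - psi 0"

end

theory Submission
  imports Defs "HOL-Probability.Probability" "HOL-Real_Asymp.Real_Asymp"
begin

text \<open>
  On the critical line \<open>X(s) = \<Gamma>(s) \<phi>(s)\<close> is real, because \<open>b(n)\<close> is the conjugate of \<open>a(n)\<close>; write
  \<open>F(t) = X(r/2 + it)\<close>. If \<open>\<phi>\<close> has only finitely many zeros there, \<open>F\<close> has constant sign for large \<open>t\<close>,
  so \<open>\<integral> |F(t)| e\<^sup>\<alpha>\<^sup>t dt\<close> and \<open>|\<integral> F(t) e\<^sup>\<alpha>\<^sup>t dt|\<close> differ by a bounded amount as \<open>\<alpha> \<rightarrow> \<pi>/2\<close>. Let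
  \<open>q = cos \<alpha>\<close> and \<open>\<Theta>(z) = \<Sum> a(n) exp(- \<lambda>\<^sub>n z)\<close>. By Mellin inversion and a shift of the contour across
  the pole at \<open>r\<close>, the second integral is \<open>2\<pi>\<close> times the value at \<open>z = e\<^sup>i\<^sup>\<alpha>\<close> of
  \<open>z\<^sup>r\<^sup>/\<^sup>2 \<Theta>(z) - \<Gamma>(r) \<rho> z\<^sup>-\<^sup>r\<^sup>/\<^sup>2\<close>. As \<open>arg a(n)\<close> is constant, \<open>|\<Theta>(e\<^sup>i\<^sup>\<alpha>)| \<le> |\<Theta>(q)|\<close>, and the same formula on the
  real axis gives \<open>|\<Theta>(q)| \<le> \<Gamma>(r) |\<rho>| q\<^sup>-\<^sup>r + O(q\<^sup>-\<^sup>r\<^sup>/\<^sup>2)\<close>.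

  In the other direction, integrate \<open>F(t) e\<^sup>\<alpha>\<^sup>t\<close> against the Mellin transform of \<open>y\<^sup>1\<^sup>/\<^sup>2 e\<^sup>-\<^sup>\<beta>\<^sup>y\<close> with \<open>\<beta>\<close> close to
  \<open>-i \<lambda>\<^sub>c\<close>. By the reflection formula \<open>|\<Gamma>(1/2 + it)|\<^sup>2 = \<pi> / cosh(\<pi> t)\<close> this weight is at most
  \<open>(2\<pi>/\<lambda>\<^sub>c)\<^sup>1\<^sup>/\<^sup>2 (1 + o(1))\<close>, while the term with index \<open>c\<close> of \<open>\<Theta>\<close> is resonant and contributes
  \<open>2\<pi> |a(c)| \<Gamma>(p) (\<lambda>\<^sub>c q)\<^sup>-\<^sup>p\<close>, \<open>p = (1 + r)/2\<close>, everything else being of smaller order.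
  Since \<open>p > r\<close> for \<open>r < 1\<close>, the two bounds are incompatible; for \<open>r = 1\<close> they force
  \<open>|a(c)| \<le> (2\<pi>\<lambda>\<^sub>c)\<^sup>1\<^sup>/\<^sup>2 |\<rho>|\<close>.
\<close>

section \<open>Fourier inversion, contour shifts and growth in strips\<close>

text \<open>A non-integrable \<open>f\<close> has integral 0 by convention, and the integral of
  \<open>g\<close> is nonnegative because \<open>g\<close> dominates a norm, so the bound persists
  in that case. This makes the lemma convenient for integrands that contain an inner
  integral.\<close>

lemma norm_integral_le_dominating:
  fixes f :: "'a \<Rightarrow> 'b :: {banach, second_countable_topology}"
  assumes g: "integrable M g" and le: "\<And>x. norm (f x) \<le> g x"
  shows "norm (integral\<^sup>L M f) \<le> integral\<^sup>L M g"
proof (cases "integrable M f")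
  case True
  then show ?thesis
    by (intro order.trans[OF integral_norm_bound integral_mono] integrable_norm g le)
next
  case False
  have "0 \<le> integral\<^sup>L M g"
    using le by (intro integral_nonneg_AE AE_I2) (metis norm_ge_zero order_trans)
  then show ?thesis using False by (simp add: not_integrable_integral_eq)
qed

text \<open>\<open>ln y \<le> y - 1\<close> at \<open>y = x / \<sigma>\<close>, with a factor
  \<open>exp (- \<sigma>)\<close> given away. It serves to compare exponential series with Dirichlet
  series term by term.\<close>

lemma exp_minus_le_powr:
  fixes x \<sigma> :: real
  assumes "x > 0" "\<sigma> > 0"
  shows "exp (- x) \<le> (\<sigma> / x) powr \<sigma>"
proof -
  have "\<sigma> * ln (x / \<sigma>) \<le> \<sigma> * (x / \<sigma> - 1)"
    using assms by (intro mult_left_mono ln_le_minus_one) auto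
  then have "- x \<le> \<sigma> * ln (\<sigma> / x)"
    using assms by (simp add: ln_div algebra_simps)
  then show ?thesis using assms by (simp add: powr_def)
qed

lemma powr_tendsto_0_at_right:
  fixes c :: real
  assumes "c > 0"
  shows "((\<lambda>q. q powr c) \<longlongrightarrow> 0) (at_right 0)"
  using assms by real_asymp

text \<open>Scaling by \<epsilon> reduces the transform to the characteristic function of the
  standard normal law, which is again Gaussian.\<close>

lemma fourier_gaussian:
  fixes u \<epsilon> :: real
  assumes "\<epsilon> > 0"
  shows "integrable lborel (\<lambda>t. exp (- (\<epsilon> * t)\<^sup>2 / 2) :: real)" (is ?int)
    and "(CLINT t|lborel. iexp (u * t) * of_real (exp (- (\<epsilon> * t)\<^sup>2 / 2)))
           = of_real (2 * pi / \<epsilon> * std_normal_density (u / \<epsilon>))" (is ?eq)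
proof -
  have n: "integrable lborel std_normal_density"
    using integrable_std_normal_moment[of 0] by simp
  have n2: "integrable lborel (\<lambda>t. std_normal_density (0 + \<epsilon> * t))"
    by (rule lborel_integrable_real_affine[OF n]) (use assms in auto)
  have eq: "exp (- (\<epsilon> * t)\<^sup>2 / 2) = sqrt (2 * pi) * std_normal_density (0 + \<epsilon> * t)" for t
    by (simp add: std_normal_density_def)
  show ?int
    unfolding eq using n2 by (intro integrable_mult_right) auto
  have "(CLINT t|lborel. iexp (u * t) * of_real (exp (- (\<epsilon> * t)\<^sup>2 / 2)))
      = (1 / \<epsilon>) *\<^sub>R (CLINT t|lborel. iexp (u / \<epsilon> * t) * of_real (sqrt (2 * pi) * std_normal_density t))"
    by (subst lborel_integral_real_affine[of "1 / \<epsilon>" _ 0])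
       (use assms in \<open>auto simp: std_normal_density_def\<close>)
  also have "(CLINT t|lborel. iexp (u / \<epsilon> * t) * of_real (sqrt (2 * pi) * std_normal_density t))
      = sqrt (2 * pi) * (CLINT t|lborel. std_normal_density t *\<^sub>R iexp (u / \<epsilon> * t))"
    by (subst integral_mult_right_zero [symmetric], intro Bochner_Integration.integral_cong)
       (auto simp: scaleR_conv_of_real mult_ac)
  also have "(CLINT t|lborel. std_normal_density t *\<^sub>R iexp (u / \<epsilon> * t)) = char std_normal_distribution (u / \<epsilon>)"
    unfolding char_def by (subst integral_density) (auto simp: normal_density_nonneg)
  also have "\<dots> = exp (- ((u / \<epsilon>)\<^sup>2) / 2)"
    by (simp add: char_std_normal_distribution)
  also have "(1 / \<epsilon>) *\<^sub>R (of_real (sqrt (2 * pi)) * complex_of_real (exp (- ((u / \<epsilon>)\<^sup>2) / 2))) =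
       of_real (2 * pi / \<epsilon> * std_normal_density (u / \<epsilon>))"
  proof -
    have "2 * pi / sqrt (2 * pi) = sqrt (2 * pi)"
      using real_div_sqrt[of "2 * pi"] by simp
    then have "1 / \<epsilon> * (sqrt (2 * pi) * exp (- ((u / \<epsilon>)\<^sup>2) / 2)) =
        2 * pi / \<epsilon> * std_normal_density (u / \<epsilon>)"
    proof -
      have "2 * pi / \<epsilon> * std_normal_density (u / \<epsilon>) =
          (2 * pi / sqrt (2 * pi)) * (1 / \<epsilon> * exp (- ((u / \<epsilon>)\<^sup>2) / 2))"
        unfolding std_normal_density_def by (simp only: divide_inverse mult_ac mult_1)
      also note \<open>2 * pi / sqrt (2 * pi) = sqrt (2 * pi)\<close>
      finally show ?thesis by (simp only: mult.left_commute)
    qed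
    then show ?thesis
      unfolding scaleR_conv_of_real of_real_mult [symmetric] by (rule arg_cong)
  qed
  finally show ?eq .
qed

text \<open>A Gaussian factor makes the double integral absolutely convergent. After Fubini the
  inner integral is a normal density of width \<open>e n\<close>, an approximate identity, and
  dominated convergence on both sides removes the regularization. Only the value at 0 is recovered,
  which suffices since parameters can be put into \<open>G\<close>.\<close>

lemma fourier_inversion_at_0:
  fixes G :: "real \<Rightarrow> complex"
  assumes G: "integrable lborel G" "continuous_on UNIV G" "\<And>u. norm (G u) \<le> B"
    and int: "integrable lborel (\<lambda>t. CLINT u|lborel. G u * iexp (u * t))"
  shows "(CLINT t|lborel. CLINT u|lborel. G u * iexp (u * t)) = 2 * pi * G 0"
proof -
  define H where "H = (\<lambda>t. CLINT u|lborel. G u * iexp (u * t))"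
  define e where "e n = 1 / (real n + 1)" for n
  have e: "e n > 0" for n by (simp add: e_def)
  have e0: "e \<longlonglongrightarrow> 0" unfolding e_def by real_asymp
  have [measurable]: "G \<in> borel_measurable borel"
    using G(2) borel_measurable_continuous_onI by blast
  have intH: "integrable lborel H" using int by (simp only: H_def)
  have [measurable]: "H \<in> borel_measurable borel"
    using borel_measurable_integrable[OF int] by (simp add: H_def)
  have n: "integrable lborel std_normal_density"
    using integrable_std_normal_moment[of 0] by simp
  \<comment> \<open>Fubini, the Gaussian transform, then the substitution
    \<open>u = e n * w\<close>, which moves the width of the density into the argument of
    \<open>G\<close>.\<close>
  have main: "(CLINT t|lborel. H t * exp (- (e n * t)\<^sup>2 / 2)) =
      (CLINT w|lborel. 2 * pi * (std_normal_density w *\<^sub>R G (e n * w)))" for n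
  proof -
    have "(CLINT t|lborel. H t * exp (- (e n * t)\<^sup>2 / 2))
       = (CLINT t|lborel. CLINT u|lborel. G u * iexp (u * t) * exp (- (e n * t)\<^sup>2 / 2))"
      unfolding H_def by (subst integral_mult_left_zero) auto
    also have "\<dots> = (CLINT u|lborel. CLINT t|lborel. G u * iexp (u * t) * exp (- (e n * t)\<^sup>2 / 2))"
    proof (rule lborel_pair.Fubini_integral)
      have "integrable (lborel \<Otimes>\<^sub>M lborel) (\<lambda>(u, t). G u * complex_of_real (exp (- (e n * t)\<^sup>2 / 2)))"
      proof (rule lborel_pair.Fubini_integrable)
        show "integrable lborel (\<lambda>x. LINT y|lborel. norm (case (x, y) of (u, t) \<Rightarrow> G u * complex_of_real (exp (- (e n * t)\<^sup>2 / 2))))"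
          using G(1) by (simp add: norm_mult)
        show "AE x in lborel. integrable lborel (\<lambda>y. case (x, y) of (u, t) \<Rightarrow> G u * complex_of_real (exp (- (e n * t)\<^sup>2 / 2)))"
          using fourier_gaussian(1)[OF e[of n]] by (auto intro!: integrable_mult_right)
      qed measurable
      then show "integrable (lborel \<Otimes>\<^sub>M lborel)
             (\<lambda>(u, t). G u * iexp (u * t) * complex_of_real (exp (- (e n * t)\<^sup>2 / 2)))"
        by (rule Bochner_Integration.integrable_bound) (auto simp: norm_mult split: prod.splits)
    qed
    also have "\<dots> = (CLINT u|lborel. G u * of_real (2 * pi / e n * std_normal_density (u / e n)))"
      by (subst fourier_gaussian(2)[OF e, symmetric], subst integral_mult_right_zero [symmetric])
         (simp add: mult_ac)
    also have "\<dots> = e n *\<^sub>R (CLINT w|lborel. G (0 + e n * w) * of_real (2 * pi / e n * std_normal_density ((0 + e n * w) / e n)))"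
      by (subst lborel_integral_real_affine[of "e n" _ 0]) (use e[of n] in auto)
    also have "\<dots> = (CLINT w|lborel. e n *\<^sub>R (G (0 + e n * w) * of_real (2 * pi / e n * std_normal_density ((0 + e n * w) / e n))))"
      by (rule integral_scaleR_right [symmetric])
    also have "\<dots> = (CLINT w|lborel. 2 * pi * (std_normal_density w *\<^sub>R G (e n * w)))"
      using e[of n] by (intro Bochner_Integration.integral_cong) (auto simp: scaleR_conv_of_real)
    finally show ?thesis .
  qed
  have "(\<lambda>n. CLINT t|lborel. H t * exp (- (e n * t)\<^sup>2 / 2)) \<longlonglongrightarrow> (CLINT t|lborel. H t)"
  proof (rule integral_dominated_convergence[where w = "\<lambda>t. norm (H t)"])
    show "AE x in lborel. (\<lambda>i. H x * exp (- (e i * x)\<^sup>2 / 2)) \<longlonglongrightarrow> H x"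
    proof (intro AE_I2)
      fix x
      have "(\<lambda>i. H x * exp (- (e i * x)\<^sup>2 / 2)) \<longlonglongrightarrow> H x * complex_of_real (exp (- (0 * x)\<^sup>2 / 2))"
        by (intro tendsto_intros e0) auto
      then show "(\<lambda>i. H x * exp (- (e i * x)\<^sup>2 / 2)) \<longlonglongrightarrow> H x" by simp
    qed
  qed (use integrable_norm[OF intH] in \<open>auto simp: norm_mult mult_left_le intro!: AE_I2\<close>)
  moreover have "(\<lambda>n. CLINT w|lborel. 2 * pi * (std_normal_density w *\<^sub>R G (e n * w))) \<longlonglongrightarrow>
      (CLINT w|lborel. 2 * pi * (std_normal_density w *\<^sub>R G 0))"
  proof (rule integral_dominated_convergence[where w = "\<lambda>w. 2 * pi * B * std_normal_density w"])
    show "AE x in lborel. (\<lambda>i. 2 * pi * (std_normal_density x *\<^sub>R G (e i * x))) \<longlonglongrightarrow> 2 * pi * (std_normal_density x *\<^sub>R G 0)"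
    proof (intro AE_I2 tendsto_intros)
      fix x
      have "(\<lambda>i. e i * x) \<longlonglongrightarrow> 0 * x" by (intro tendsto_intros e0)
      with G(2) show "(\<lambda>i. G (e i * x)) \<longlonglongrightarrow> G 0"
        by (intro continuous_on_tendsto_compose[OF G(2)]) auto
    qed
    show "AE x in lborel. norm (2 * pi * (std_normal_density x *\<^sub>R G (e i * x))) \<le> 2 * pi * B * std_normal_density x" for i
    proof (intro AE_I2)
      fix x
      have "2 * pi * std_normal_density x * norm (G (e i * x)) \<le> 2 * pi * std_normal_density x * B"
        by (intro mult_left_mono G(3)) auto
      then show "norm (2 * pi * (std_normal_density x *\<^sub>R G (e i * x))) \<le> 2 * pi * B * std_normal_density x"
        by (simp add: norm_mult mult_ac)
    qed
  qed (use n in auto)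
  moreover have "(CLINT w|lborel. 2 * pi * (std_normal_density w *\<^sub>R G 0)) = 2 * pi * G 0"
  proof -
    have "(LINT w|lborel. std_normal_density w) = 1"
      using integral_std_normal_moment_even[of 0] by simp
    then show ?thesis
      using n by simp
  qed
  ultimately show ?thesis
    unfolding main H_def[symmetric] using LIMSEQ_unique by fastforce
qed

text \<open>The residue theorem on rectangles whose height tends to infinity: the horizontal sides
  vanish by \<open>small\<close>, and \<open>ds = \<i> dt\<close> on the vertical sides cancels the
  \<i> in \<open>2 * pi * \<i>\<close>. A point \<open>p\<close> at which \<open>f\<close> is
  regular has residue 0, so shifts without a pole are covered as well.\<close>

lemma vertical_line_shift:
  fixes f :: "complex \<Rightarrow> complex"
  assumes S: "open S" "connected S" "{s. \<sigma>\<^sub>1 \<le> Re s \<and> Re s \<le> \<sigma>\<^sub>2} \<subseteq> S"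
    and hol: "f holomorphic_on S - {p}"
    and p: "\<sigma>\<^sub>1 < Re p" "Re p < \<sigma>\<^sub>2"
    and int1: "integrable lborel (\<lambda>t. f (Complex \<sigma>\<^sub>1 t))"
    and int2: "integrable lborel (\<lambda>t. f (Complex \<sigma>\<^sub>2 t))"
    and small: "\<And>\<epsilon>. \<epsilon> > 0 \<Longrightarrow> \<exists>T. \<forall>s. \<sigma>\<^sub>1 \<le> Re s \<longrightarrow> Re s \<le> \<sigma>\<^sub>2 \<longrightarrow> T \<le> \<bar>Im s\<bar> \<longrightarrow> norm (f s) \<le> \<epsilon>"
  shows "(CLINT t|lborel. f (Complex \<sigma>\<^sub>2 t)) - (CLINT t|lborel. f (Complex \<sigma>\<^sub>1 t)) = 2 * pi * residue f p"
proof -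
  define I where "I \<sigma> T = integral {-T..T} (\<lambda>t. f (Complex \<sigma> t))" for \<sigma> T :: real
  have cont: "continuous_on (S - {p}) f"
    using hol holomorphic_on_imp_continuous_on by blast
  have est: "\<exists>T0. \<forall>T\<ge>T0. norm (I \<sigma>\<^sub>2 T - I \<sigma>\<^sub>1 T - 2 * pi * residue f p) \<le> \<epsilon>" if "\<epsilon> > 0" for \<epsilon>
  proof -
    \<comment> \<open>Both horizontal sides have length
      \<open>\<sigma>\<^sub>2 - \<sigma>\<^sub>1\<close>, so a bound \<open>d\<close> for
      \<open>f\<close> makes each contribute at most \<open>\<epsilon> / 2\<close>.\<close>
    define d where "d = \<epsilon> / 2 / (\<sigma>\<^sub>2 - \<sigma>\<^sub>1)"
    have d: "d > 0" using that p by (auto simp: d_def)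
    obtain T0 where T0: "\<And>s. \<sigma>\<^sub>1 \<le> Re s \<Longrightarrow> Re s \<le> \<sigma>\<^sub>2 \<Longrightarrow> T0 \<le> \<bar>Im s\<bar> \<Longrightarrow> norm (f s) \<le> d"
      using small[OF d] by blast
    have "norm (I \<sigma>\<^sub>2 T - I \<sigma>\<^sub>1 T - 2 * pi * residue f p) \<le> \<epsilon>" if T: "T \<ge> max T0 (\<bar>Im p\<bar> + 1)" for T
    proof -
      define a1 a2 a3 a4 where "a1 = Complex \<sigma>\<^sub>1 (-T)" and "a2 = Complex \<sigma>\<^sub>2 (-T)"
        and "a3 = Complex \<sigma>\<^sub>2 T" and "a4 = Complex \<sigma>\<^sub>1 T"
      have T1: "T > \<bar>Im p\<bar>" "T \<ge> T0" "T > 0" using T by auto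
      have sub: "closed_segment a1 a2 \<subseteq> S - {p}" "closed_segment a2 a3 \<subseteq> S - {p}"
                "closed_segment a3 a4 \<subseteq> S - {p}" "closed_segment a4 a1 \<subseteq> S - {p}"
        using S(3) p T1
        by (auto simp: a1_def a2_def a3_def a4_def closed_segment_same_Re closed_segment_same_Im
              closed_segment_eq_real_ivl subset_iff)
      have ci: "f contour_integrable_on linepath a1 a2" "f contour_integrable_on linepath a2 a3"
               "f contour_integrable_on linepath a3 a4" "f contour_integrable_on linepath a4 a1"
        using sub by (auto intro!: contour_integrable_continuous_linepath continuous_on_subset[OF cont])
      have rp: "rectpath a1 a3 = linepath a1 a2 +++ linepath a2 a3 +++ linepath a3 a4 +++ linepath a4 a1"
        by (simp add: rectpath_def Let_def a1_def a2_def a3_def a4_def)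
      have "contour_integral (rectpath a1 a3) f = 2 * pi * \<i> * (\<Sum>q\<in>{p}. winding_number (rectpath a1 a3) q * residue f q)"
      proof (rule Residue_theorem[OF S(1,2) _ hol])
        show "path_image (rectpath a1 a3) \<subseteq> S - {p}"
          unfolding rp using sub by (auto simp: path_image_join)
        show "\<forall>z. z \<notin> S \<longrightarrow> winding_number (rectpath a1 a3) z = 0"
          using S(3) p T1 by (auto intro!: winding_number_rectpath_outside simp: a1_def a3_def in_cbox_complex_iff)
      qed auto
      also have "\<dots> = 2 * pi * \<i> * residue f p"
      proof -
        have "winding_number (rectpath a1 a3) p = 1"
          by (rule winding_number_rectpath) (use p T1 in \<open>auto simp: in_box_complex_iff a1_def a3_def\<close>)
        then show ?thesis by simp
      qed
      finally have 1: "contour_integral (rectpath a1 a3) f = 2 * pi * \<i> * residue f p" .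
      have 2: "contour_integral (rectpath a1 a3) f = contour_integral (linepath a1 a2) f +
         (contour_integral (linepath a2 a3) f + (contour_integral (linepath a3 a4) f + contour_integral (linepath a4 a1) f))"
        unfolding rp using ci by (simp add: contour_integral_join)
      have 3: "contour_integral (linepath a2 a3) f = \<i> * I \<sigma>\<^sub>2 T"
        unfolding I_def by (rule contour_integral_linepath_same_Re) (use T1 in \<open>auto simp: a2_def a3_def\<close>)
      have "contour_integral (linepath a1 a4) f = \<i> * I \<sigma>\<^sub>1 T"
        unfolding I_def by (rule contour_integral_linepath_same_Re) (use T1 in \<open>auto simp: a1_def a4_def\<close>)
      then have 4: "contour_integral (linepath a4 a1) f = - (\<i> * I \<sigma>\<^sub>1 T)"
        by (metis contour_integral_reversepath reversepath_linepath valid_path_linepath)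
      have b: "norm (contour_integral (linepath a1 a2) f) \<le> d * norm (a2 - a1)"
        by (rule contour_integral_bound_linepath[OF ci(1)])
           (use d T1 p in \<open>auto intro!: T0 simp: a1_def a2_def closed_segment_same_Im closed_segment_eq_real_ivl\<close>)
      have b': "norm (contour_integral (linepath a3 a4) f) \<le> d * norm (a4 - a3)"
        by (rule contour_integral_bound_linepath[OF ci(3)])
           (use d T1 p in \<open>auto intro!: T0 simp: a3_def a4_def closed_segment_same_Im closed_segment_eq_real_ivl\<close>)
      have l: "norm (a2 - a1) = \<sigma>\<^sub>2 - \<sigma>\<^sub>1" "norm (a4 - a3) = \<sigma>\<^sub>2 - \<sigma>\<^sub>1"
        using p by (auto simp: a1_def a2_def a3_def a4_def cmod_def)
      have "\<i> * (I \<sigma>\<^sub>2 T - I \<sigma>\<^sub>1 T - 2 * pi * residue f p) =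
          - contour_integral (linepath a1 a2) f - contour_integral (linepath a3 a4) f"
        using 1 2 3 4 by (simp add: algebra_simps)
      then have "norm (I \<sigma>\<^sub>2 T - I \<sigma>\<^sub>1 T - 2 * pi * residue f p) =
          norm (- contour_integral (linepath a1 a2) f - contour_integral (linepath a3 a4) f)"
        by (metis norm_mult norm_ii mult_1)
      also have "\<dots> \<le> norm (contour_integral (linepath a1 a2) f) + norm (contour_integral (linepath a3 a4) f)"
        by (metis norm_minus_cancel norm_triangle_ineq4)
      also have "\<dots> \<le> d * (\<sigma>\<^sub>2 - \<sigma>\<^sub>1) + d * (\<sigma>\<^sub>2 - \<sigma>\<^sub>1)"
        using b b' l by (intro add_mono) auto
      also have "\<dots> = \<epsilon>"
      proof -
        have "\<sigma>\<^sub>2 - \<sigma>\<^sub>1 \<noteq> 0" using p by simp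
        from iffD1[OF nonzero_eq_divide_eq[OF this] d_def]
        have "d * (\<sigma>\<^sub>2 - \<sigma>\<^sub>1) = \<epsilon> / 2" .
        then show ?thesis by simp
      qed
      finally show ?thesis .
    qed
    then show ?thesis by blast
  qed
  have lim: "((\<lambda>n. I \<sigma> (real n)) \<longlonglongrightarrow> (CLINT t|lborel. f (Complex \<sigma> t)))"
    if int: "integrable lborel (\<lambda>t. f (Complex \<sigma> t))" for \<sigma>
  proof -
    have eq: "I \<sigma> (real n) = (CLINT t|lborel. indicator {- real n..real n} t *\<^sub>R f (Complex \<sigma> t))" for n
    proof -
      have "set_integrable lborel {- real n..real n} (\<lambda>t. f (Complex \<sigma> t))"
        using int unfolding set_integrable_def by (intro integrable_mult_indicator) auto
      from set_borel_integral_eq_integral(2)[OF this] show ?thesis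
        by (simp add: I_def set_lebesgue_integral_def)
    qed
    show ?thesis unfolding eq
    proof (rule integral_dominated_convergence[where w = "\<lambda>t. norm (f (Complex \<sigma> t))"])
      show "AE t in lborel. (\<lambda>n. indicator {- real n..real n} t *\<^sub>R f (Complex \<sigma> t)) \<longlonglongrightarrow> f (Complex \<sigma> t)"
      proof (intro AE_I2 tendsto_eventually)
        fix t :: real
        have "eventually (\<lambda>n. real n \<ge> \<bar>t\<bar>) sequentially" by real_asymp
        then show "eventually (\<lambda>n. indicator {- real n..real n} t *\<^sub>R f (Complex \<sigma> t) = f (Complex \<sigma> t)) sequentially"
          by eventually_elim (auto simp: indicator_def)
      qed
    qed (use int in \<open>auto simp: indicator_def\<close>)
  qed
  have "(\<lambda>n. I \<sigma>\<^sub>2 (real n) - I \<sigma>\<^sub>1 (real n)) \<longlonglongrightarrow> 2 * pi * residue f p"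
  proof (rule LIMSEQ_I)
    fix \<epsilon> :: real assume "\<epsilon> > 0"
    then obtain T0 where "\<And>T. T \<ge> T0 \<Longrightarrow> norm (I \<sigma>\<^sub>2 T - I \<sigma>\<^sub>1 T - 2 * pi * residue f p) \<le> \<epsilon> / 2"
      using est[of "\<epsilon> / 2"] by auto
    then have "norm (I \<sigma>\<^sub>2 (real n) - I \<sigma>\<^sub>1 (real n) - 2 * pi * residue f p) < \<epsilon>" if "n \<ge> nat \<lceil>T0\<rceil>" for n
      using that \<open>\<epsilon> > 0\<close> by (smt (verit) field_sum_of_halves le_nat_iff nat_ceiling_le_eq)
    then show "\<exists>no. \<forall>n\<ge>no. norm (I \<sigma>\<^sub>2 (real n) - I \<sigma>\<^sub>1 (real n) - 2 * pi * residue f p) < \<epsilon>" by blast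
  qed
  moreover have "(\<lambda>n. I \<sigma>\<^sub>2 (real n) - I \<sigma>\<^sub>1 (real n)) \<longlonglongrightarrow>
      (CLINT t|lborel. f (Complex \<sigma>\<^sub>2 t)) - (CLINT t|lborel. f (Complex \<sigma>\<^sub>1 t))"
    by (intro tendsto_diff lim int1 int2)
  ultimately show ?thesis using LIMSEQ_unique by blast
qed

text \<open>\<open>f\<close> is bounded, and exponential decay on the vertical edges is to be
  carried inside. The maximum modulus principle is applied to \<open>f\<close> times
  \<open>exp (- \<i> * \<alpha> * s)\<close>, of modulus \<open>exp (\<alpha> * Im s)\<close>, and
  times \<open>exp (\<epsilon> * s\<^sup>2)\<close>, which controls the top edge; then \<epsilon>
  tends to 0.\<close>

lemma phragmen_lindelof_half_strip:
  fixes f :: "complex \<Rightarrow> complex" and \<sigma>\<^sub>1 \<sigma>\<^sub>2 T B C \<alpha> :: real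
  defines "Q \<equiv> {s. \<sigma>\<^sub>1 \<le> Re s \<and> Re s \<le> \<sigma>\<^sub>2 \<and> T \<le> Im s}"
  assumes S: "open S" "f holomorphic_on S" "Q \<subseteq> S"
    and T: "0 \<le> T" and \<alpha>: "0 \<le> \<alpha>" and B: "0 \<le> B" and C: "0 \<le> C"
    and bd: "\<And>s. s \<in> Q \<Longrightarrow> norm (f s) \<le> B"
    and edge: "\<And>s. s \<in> Q \<Longrightarrow> Re s = \<sigma>\<^sub>1 \<or> Re s = \<sigma>\<^sub>2 \<Longrightarrow> norm (f s) \<le> C * exp (- \<alpha> * Im s)"
    and s: "s \<in> Q"
  shows "norm (f s) \<le> (C + B * exp (\<alpha> * T)) * exp (- \<alpha> * Im s)"
proof -
  define M where "M = max \<bar>\<sigma>\<^sub>1\<bar> \<bar>\<sigma>\<^sub>2\<bar>"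
  define D where "D = C + B * exp (\<alpha> * T)"
  have D: "D \<ge> C" "D \<ge> B * exp (\<alpha> * T)" using B C by (auto simp: D_def)
  have "exp (\<alpha> * T) \<ge> 1" using T \<alpha> by simp
  with D(2) B have DB: "D \<ge> B" by (metis mult_left_mono mult.right_neutral order_trans)
  have sq: "(Re w)\<^sup>2 \<le> M\<^sup>2" if "w \<in> Q" for w
    using that by (intro power2_le_iff_abs_le[THEN iffD2]) (auto simp: Q_def M_def)
  have "norm (f s) * exp (\<alpha> * Im s) * exp (\<epsilon> * ((Re s)\<^sup>2 - (Im s)\<^sup>2)) \<le> D * exp (\<epsilon> * M\<^sup>2)" if \<epsilon>: "\<epsilon> > 0" for \<epsilon>
  proof -
    define g where "g w = f w * exp (- \<i> * of_real \<alpha> * w) * exp (of_real \<epsilon> * w\<^sup>2)" for w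
    have ng: "norm (g w) = norm (f w) * exp (\<alpha> * Im w) * exp (\<epsilon> * ((Re w)\<^sup>2 - (Im w)\<^sup>2))" for w
      by (simp add: g_def norm_mult norm_exp_eq_Re Re_power2)
    \<comment> \<open>The rectangle must contain \<open>s\<close>, and
      \<open>Y \<ge> \<alpha> / \<epsilon>\<close> gives
      \<open>\<alpha> * Y \<le> \<epsilon> * Y\<^sup>2\<close>, so that the quadratic factor absorbs
      \<open>exp (\<alpha> * Y)\<close> on the top edge.\<close>
    define Y where "Y = Max {T, Im s, \<alpha> / \<epsilon>} + 1"
    have Y: "Y > T" "Y > Im s" "Y \<ge> \<alpha> / \<epsilon>" "Y > 0"
      using T by (auto simp: Y_def less_Suc_eq_le le_max_iff_disj)
    have YY: "\<alpha> * Y \<le> \<epsilon> * Y\<^sup>2"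
      using Y \<epsilon> by (simp add: power2_eq_square divide_le_eq mult.commute)
    define R where "R = cbox (Complex \<sigma>\<^sub>1 T) (Complex \<sigma>\<^sub>2 Y)"
    have RQ: "R \<subseteq> Q" by (auto simp: R_def Q_def in_cbox_complex_iff)
    have hol: "g holomorphic_on S" unfolding g_def by (intro holomorphic_intros S)
    have "norm (g s) \<le> D * exp (\<epsilon> * M\<^sup>2)"
    proof (rule maximum_modulus_frontier[of g R])
      show "g holomorphic_on interior R"
        using hol RQ S(3) interior_subset by (meson holomorphic_on_subset order_trans)
      show "continuous_on (closure R) g"
        using holomorphic_on_imp_continuous_on[OF hol] RQ S(3) by (auto simp: R_def intro: continuous_on_subset)
      show "bounded R" by (auto simp: R_def)
      show "s \<in> R" using s Y by (auto simp: R_def Q_def in_cbox_complex_iff)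
      fix w assume "w \<in> frontier R"
      then have wR: "w \<in> R" and w: "Re w = \<sigma>\<^sub>1 \<or> Re w = \<sigma>\<^sub>2 \<or> Im w = T \<or> Im w = Y"
        unfolding R_def frontier_cbox by (auto simp: in_cbox_complex_iff in_box_complex_iff)
      then have wQ: "w \<in> Q" using RQ by auto
      have Imw: "Im w \<ge> 0" using wQ T by (auto simp: Q_def)
      have le: "\<epsilon> * ((Re w)\<^sup>2 - (Im w)\<^sup>2) \<le> \<epsilon> * M\<^sup>2"
        using sq[OF wQ] \<epsilon> by (intro mult_left_mono) (auto intro: order_trans[of _ "(Re w)\<^sup>2"])
      consider "Re w = \<sigma>\<^sub>1 \<or> Re w = \<sigma>\<^sub>2" | "Im w = T" | "Im w = Y" using w by blast
      then show "norm (g w) \<le> D * exp (\<epsilon> * M\<^sup>2)"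
      proof cases
        case 1
        have "norm (f w) * exp (\<alpha> * Im w) \<le> C"
          using edge[OF wQ 1] by (simp add: exp_minus field_simps)
        then show ?thesis
          unfolding ng using le D C by (intro mult_mono) auto
      next
        case 2
        have "norm (f w) * exp (\<alpha> * Im w) \<le> B * exp (\<alpha> * T)"
          unfolding 2 using bd[OF wQ] by (intro mult_right_mono) auto
        then show ?thesis
          unfolding ng using le D DB B by (intro mult_mono) auto
      next
        case 3
        have "\<alpha> * Y + \<epsilon> * ((Re w)\<^sup>2 - Y\<^sup>2) \<le> \<epsilon> * (Re w)\<^sup>2" using YY by (simp add: algebra_simps)
        also have "\<dots> \<le> \<epsilon> * M\<^sup>2" using sq[OF wQ] \<epsilon> by simp
        finally have "exp (\<alpha> * Im w) * exp (\<epsilon> * ((Re w)\<^sup>2 - (Im w)\<^sup>2)) \<le> exp (\<epsilon> * M\<^sup>2)"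
          unfolding 3 by (simp flip: exp_add)
        moreover have "norm (f w) \<le> D" using bd[OF wQ] DB by simp
        ultimately show ?thesis
          unfolding ng mult.assoc using DB B by (intro mult_mono) auto
      qed
    qed
    then show ?thesis by (simp add: ng)
  qed
  then have ev: "eventually (\<lambda>\<epsilon>. norm (f s) * exp (\<alpha> * Im s) * exp (\<epsilon> * ((Re s)\<^sup>2 - (Im s)\<^sup>2)) \<le> D * exp (\<epsilon> * M\<^sup>2)) (at_right 0)"
    by (intro eventually_at_rightI[of 0 1]) auto
  have "((\<lambda>\<epsilon>. norm (f s) * exp (\<alpha> * Im s) * exp (\<epsilon> * ((Re s)\<^sup>2 - (Im s)\<^sup>2))) \<longlongrightarrow>
      norm (f s) * exp (\<alpha> * Im s) * exp (0 * ((Re s)\<^sup>2 - (Im s)\<^sup>2))) (at_right 0)"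
    by (intro tendsto_intros)
  moreover have "((\<lambda>\<epsilon>. D * exp (\<epsilon> * M\<^sup>2)) \<longlongrightarrow> D * exp (0 * M\<^sup>2)) (at_right 0)"
    by (intro tendsto_intros)
  ultimately have "norm (f s) * exp (\<alpha> * Im s) * exp (0 * ((Re s)\<^sup>2 - (Im s)\<^sup>2)) \<le> D * exp (0 * M\<^sup>2)"
    using ev by (intro tendsto_le[of "at_right (0::real)"]) auto
  then show ?thesis
    by (simp add: D_def exp_minus field_simps)
qed

text \<open>At a simple pole \<open>f = h / (s - p)\<close> near \<open>p\<close> with
  \<open>h\<close> holomorphic, so both residues are values at \<open>p\<close>; a pole of higher
  order would bring in derivatives of \<open>g\<close>. At a regular point both sides are 0.\<close>

lemma residue_mult_upto_simple_pole:
  assumes S: "open S" "p \<in> S" "g holomorphic_on S"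
    and f: "analytic_upto_simple_pole f p"
  shows "residue (\<lambda>s. g s * f s) p = g p * residue f p"
proof (cases "f analytic_on {p}")
  case True
  then obtain U where U: "open U" "p \<in> U" "f holomorphic_on U"
    by (auto simp: analytic_on_holomorphic)
  have "residue f p = 0" by (rule residue_holo[OF U(1,2,3)])
  moreover have "residue (\<lambda>s. g s * f s) p = 0"
    by (rule residue_holo[of "S \<inter> U"])
       (use S U in \<open>auto intro!: holomorphic_intros intro: holomorphic_on_subset\<close>)
  ultimately show ?thesis by simp
next
  case False
  then have f1: "is_pole f p" "zorder f p = -1" and f2: "f holomorphic_on UNIV - {p}"
    using f by (auto simp: analytic_upto_simple_pole_def intro: analytic_imp_holomorphic)
  define h where "h = zor_poly f p"
  have "f holomorphic_on S - {p}" by (rule holomorphic_on_subset[OF f2]) auto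
  then obtain e where e: "e > 0" "cball p e \<subseteq> S" "h holomorphic_on cball p e"
      "\<And>w. w \<in> cball p e - {p} \<Longrightarrow> f w = h w / (w - p)"
    using zorder_exist_pole[of f S p] S f1 by (auto simp: h_def)
  have hol: "h holomorphic_on ball p e" "g holomorphic_on ball p e"
    using holomorphic_on_subset[OF e(3) ball_subset_cball]
      holomorphic_on_subset[OF S(3) order.trans[OF ball_subset_cball e(2)]] by auto
  have ev: "eventually (\<lambda>w. w \<in> ball p e \<and> w \<noteq> p) (at p)"
    using eventually_at_ball'[OF e(1), of p UNIV] by simp
  have "residue f p = residue (\<lambda>w. h w / (w - p)) p"
    by (rule residue_cong) (use ev in \<open>auto elim!: eventually_mono intro!: e(4)\<close>)
  also have "\<dots> = h p"
    by (rule residue_simple[of "ball p e"]) (use e hol in auto)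
  finally have "residue f p = h p" .
  moreover have "residue (\<lambda>s. g s * f s) p = residue (\<lambda>w. (g w * h w) / (w - p)) p"
    by (rule residue_cong) (use ev in \<open>auto elim!: eventually_mono simp: e(4)\<close>)
  moreover have "\<dots> = g p * h p"
    by (rule residue_simple[of "ball p e"]) (use e hol in \<open>auto intro!: holomorphic_intros\<close>)
  ultimately show ?thesis by simp
qed

section \<open>Gamma integrals along rotated rays\<close>

text \<open>Euler's integral under \<open>t = exp u\<close>. On the whole line the Mellin transform
  becomes a Fourier transform, and rotating the ray of integration becomes shifting a line.\<close>

lemma Gamma_exp_integral:
  fixes s :: complex
  assumes s: "Re s > 0"
  shows "integrable lborel (\<lambda>u. exp (s * of_real u - of_real (exp u)))" (is ?int)
    and "(CLINT u|lborel. exp (s * of_real u - of_real (exp u))) = Gamma s" (is ?eq)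
proof -
  define f :: "real \<Rightarrow> complex" where "f = (\<lambda>t. of_real t powr (s - 1) / of_real (exp t))"
  have im: "range exp = {0::real<..}"
  proof (intro equalityI subsetI)
    fix x :: real assume "x \<in> {0<..}"
    then have "x = exp (ln x)" by simp
    then show "x \<in> range exp" by blast
  qed auto
  have eq: "\<bar>exp u\<bar> *\<^sub>R f (exp u) = exp (s * of_real u - of_real (exp u))" for u :: real
  proof -
    have "f (exp u) = exp ((s - 1) * of_real u - of_real (exp u))"
      by (simp add: f_def powr_def Ln_of_real exp_of_real exp_diff)
    then have "\<bar>exp u\<bar> *\<^sub>R f (exp u) = exp (of_real u) * exp ((s - 1) * of_real u - of_real (exp u))"
      by (simp add: scaleR_conv_of_real exp_of_real)
    also have "\<dots> = exp (s * of_real u - of_real (exp u))"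
      by (simp add: exp_add [symmetric] algebra_simps)
    finally show ?thesis .
  qed
  have "f absolutely_integrable_on {0<..} \<and> integral {0<..} f = Gamma s"
    using absolutely_integrable_Gamma_integral'[OF s] Gamma_integral_complex'[OF s]
    by (auto simp: f_def integral_unique)
  then have "(\<lambda>u. \<bar>exp u\<bar> *\<^sub>R f (exp u)) absolutely_integrable_on UNIV \<and>
      integral UNIV (\<lambda>u. \<bar>exp u\<bar> *\<^sub>R f (exp u)) = Gamma s"
    by (subst has_absolute_integral_change_of_variables_real[where g = exp and S = UNIV and f = f])
       (auto intro!: derivative_eq_intros simp: im inj_on_def)
  then have *: "(\<lambda>u. exp (s * of_real u - of_real (exp u))) absolutely_integrable_on UNIV"
      "integral UNIV (\<lambda>u. exp (s * of_real u - of_real (exp u))) = Gamma s"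
    unfolding eq by auto
  then have "integrable lebesgue (\<lambda>u::real. exp (s * of_real u - of_real (exp u)))"
    by (simp add: set_integrable_def)
  then show int: ?int
    by (subst (asm) integrable_completion) auto
  have "((\<lambda>u. exp (s * of_real u - of_real (exp u))) has_integral (CLINT u|lborel. exp (s * of_real u - of_real (exp u)))) UNIV"
    by (rule has_integral_integral_lborel[OF int])
  then show ?eq using *(2) by (simp add: integral_unique)
qed

text \<open>Turning Euler's ray by the angle \<alpha> means shifting the line of \<open>u\<close> to
  height \<alpha>. The integrand is entire and decays at both ends: because of
  \<open>Re s > 0\<close> at minus infinity, and because of \<open>cos \<alpha> > 0\<close> at plus
  infinity.\<close>

lemma Gamma_exp_integral_rotated:
  fixes s :: complex and \<alpha> :: real
  assumes s: "Re s > 0" and \<alpha>: "\<bar>\<alpha>\<bar> < pi / 2"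
  shows "integrable lborel (\<lambda>u::real. exp (s * Complex u \<alpha> - exp (Complex u \<alpha>)))" (is ?int)
    and "(CLINT u|lborel. exp (s * Complex u \<alpha> - exp (Complex u \<alpha>))) = Gamma s" (is ?eq)
proof -
  define g where "g u = exp (\<bar>Im s\<bar> * \<bar>\<alpha>\<bar>) * exp (Re s * u - cos \<alpha> * exp u)" for u
  \<comment> \<open>The factor \<open>- \<i>\<close> turns horizontal lines into vertical ones:
    height \<open>v\<close> corresponds to real part \<open>- v\<close>.\<close>
  define f where "f = (\<lambda>w. exp (s * (- \<i> * w) - exp (- \<i> * w)))"
  have c: "cos \<alpha> > 0" using \<alpha> by (intro cos_gt_zero_pi) auto
  have fC: "f (Complex (-v) u) = exp (s * Complex u v - exp (Complex u v))" for u v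
  proof -
    have "- \<i> * Complex (-v) u = Complex u v" by (simp add: complex_eq_iff)
    then show ?thesis by (simp only: f_def)
  qed
  have bd: "norm (exp (s * Complex u v - exp (Complex u v))) \<le> g u" if "\<bar>v\<bar> \<le> \<bar>\<alpha>\<bar>" for u v
  proof -
    have "cos \<bar>\<alpha>\<bar> \<le> cos \<bar>v\<bar>" using that \<alpha> by (subst cos_mono_le_eq) auto
    then have "exp u * cos v \<ge> cos \<alpha> * exp u" by (simp add: mult.commute)
    moreover have "- (Im s * v) \<le> \<bar>Im s\<bar> * \<bar>\<alpha>\<bar>"
      using mult_left_mono[OF that abs_ge_zero[of "Im s"]] abs_ge_minus_self[of "Im s * v"]
      by (simp add: abs_mult)
    ultimately have "Re s * u - Im s * v - exp u * cos v \<le> \<bar>Im s\<bar> * \<bar>\<alpha>\<bar> + (Re s * u - cos \<alpha> * exp u)"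
      by linarith
    then show ?thesis by (simp add: g_def Re_exp flip: exp_add)
  qed
  have intg: "integrable lborel g"
  proof -
    have "integrable lborel (\<lambda>u::real. exp (of_real (Re s) * of_real u - of_real (exp u)) :: complex)"
      by (rule Gamma_exp_integral(1)) (use s in auto)
    then have "integrable lborel (\<lambda>u. norm (exp (of_real (Re s) * of_real u - of_real (exp u)) :: complex))"
      by (rule integrable_norm)
    then have "integrable lborel (\<lambda>u. exp (Re s * u - exp u))" by simp
    from lborel_integrable_real_affine[OF this, of 1 "ln (cos \<alpha>)"]
    have "integrable lborel (\<lambda>u. exp (- (Re s * ln (cos \<alpha>))) * exp (Re s * (ln (cos \<alpha>) + 1 * u) - exp (ln (cos \<alpha>) + 1 * u)))"
      by (intro integrable_mult_right) auto
    also have "(\<lambda>u. exp (- (Re s * ln (cos \<alpha>))) * exp (Re s * (ln (cos \<alpha>) + 1 * u) - exp (ln (cos \<alpha>) + 1 * u)))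
       = (\<lambda>u. exp (Re s * u - cos \<alpha> * exp u))"
      using c by (auto simp: exp_add [symmetric] algebra_simps) (subst exp_add, simp add: mult.commute)
    finally show ?thesis unfolding g_def by (intro integrable_mult_right) auto
  qed
  have int: "integrable lborel (\<lambda>u::real. exp (s * Complex u v - exp (Complex u v)))" if "\<bar>v\<bar> \<le> \<bar>\<alpha>\<bar>" for v
  proof (rule Bochner_Integration.integrable_bound[OF intg])
    show "(\<lambda>u. exp (s * Complex u v - exp (Complex u v))) \<in> borel_measurable lborel"
      unfolding Complex_eq by measurable
    show "AE x in lborel. norm (exp (s * Complex x v - exp (Complex x v))) \<le> norm (g x)"
      using bd[OF that] by (intro AE_I2) (metis abs_ge_self order_trans real_norm_def)
  qed
  show ?int by (rule int) simp
  have "(g \<longlongrightarrow> 0) at_top" "(g \<longlongrightarrow> 0) at_bot"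
    unfolding g_def using c s by real_asymp+
  then have small: "\<exists>T. \<forall>u v. \<bar>v\<bar> \<le> \<bar>\<alpha>\<bar> \<longrightarrow> T \<le> \<bar>u\<bar> \<longrightarrow> norm (f (Complex (-v) u)) \<le> \<epsilon>" if "\<epsilon> > 0" for \<epsilon>
  proof -
    have "eventually (\<lambda>u. dist (g u) 0 < \<epsilon>) at_top" "eventually (\<lambda>u. dist (g u) 0 < \<epsilon>) at_bot"
      using \<open>(g \<longlongrightarrow> 0) at_top\<close> \<open>(g \<longlongrightarrow> 0) at_bot\<close> that by (auto dest: tendstoD)
    then obtain T1 T2 where T: "\<And>u. u \<ge> T1 \<Longrightarrow> dist (g u) 0 < \<epsilon>" "\<And>u. u \<le> T2 \<Longrightarrow> dist (g u) 0 < \<epsilon>"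
      by (auto simp: eventually_at_top_linorder eventually_at_bot_linorder)
    have "norm (f (Complex (-v) u)) \<le> \<epsilon>" if "\<bar>v\<bar> \<le> \<bar>\<alpha>\<bar>" "max \<bar>T1\<bar> \<bar>T2\<bar> \<le> \<bar>u\<bar>" for u v
    proof -
      have "u \<ge> T1 \<or> u \<le> T2" using that(2) by linarith
      then have "g u < \<epsilon>" using T[of u] by auto
      then show ?thesis using bd[OF that(1), of u] by (simp only: fC)
    qed
    then show ?thesis by blast
  qed
  have hol: "f holomorphic_on A" for A unfolding f_def by (intro holomorphic_intros)
  have res: "residue f p = 0" for p
    by (rule residue_holo[of UNIV]) (auto intro: hol)
  have shift: "(CLINT t|lborel. f (Complex \<sigma>\<^sub>2 t)) = (CLINT t|lborel. f (Complex \<sigma>\<^sub>1 t))"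
    if "\<sigma>\<^sub>1 < \<sigma>\<^sub>2" "\<bar>\<sigma>\<^sub>1\<bar> \<le> \<bar>\<alpha>\<bar>" "\<bar>\<sigma>\<^sub>2\<bar> \<le> \<bar>\<alpha>\<bar>" for \<sigma>\<^sub>1 \<sigma>\<^sub>2
  proof -
    \<comment> \<open>The midpoint is an arbitrary point between the two lines; its residue is 0
      since \<open>f\<close> is entire.\<close>
    have "(CLINT t|lborel. f (Complex \<sigma>\<^sub>2 t)) - (CLINT t|lborel. f (Complex \<sigma>\<^sub>1 t)) =
        2 * pi * residue f (of_real ((\<sigma>\<^sub>1 + \<sigma>\<^sub>2) / 2))"
    proof (rule vertical_line_shift[where S = UNIV])
      show "integrable lborel (\<lambda>t. f (Complex \<sigma>\<^sub>1 t))" "integrable lborel (\<lambda>t. f (Complex \<sigma>\<^sub>2 t))"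
        using int[of "-\<sigma>\<^sub>1"] int[of "-\<sigma>\<^sub>2"] that fC[of "-\<sigma>\<^sub>1"] fC[of "-\<sigma>\<^sub>2"] by auto
      fix \<epsilon> :: real assume "\<epsilon> > 0"
      then obtain T where T: "\<And>u v. \<bar>v\<bar> \<le> \<bar>\<alpha>\<bar> \<Longrightarrow> T \<le> \<bar>u\<bar> \<Longrightarrow> norm (f (Complex (-v) u)) \<le> \<epsilon>"
        using small by blast
      show "\<exists>T. \<forall>z. \<sigma>\<^sub>1 \<le> Re z \<longrightarrow> Re z \<le> \<sigma>\<^sub>2 \<longrightarrow> T \<le> \<bar>Im z\<bar> \<longrightarrow> norm (f z) \<le> \<epsilon>"
      proof (intro exI[of _ T] allI impI)
        fix z assume "\<sigma>\<^sub>1 \<le> Re z" "Re z \<le> \<sigma>\<^sub>2" "T \<le> \<bar>Im z\<bar>"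
        then show "norm (f z) \<le> \<epsilon>"
          using T[of "- Re z" "Im z"] that by auto
      qed
    qed (use that in \<open>auto intro: hol simp: field_simps\<close>)
    then show ?thesis by (simp add: res)
  qed
  have "(CLINT t|lborel. f (Complex (-\<alpha>) t)) = (CLINT t|lborel. f (Complex (-0) t))"
  proof (cases "\<alpha> = 0")
    case False
    then consider "0 < - \<alpha>" | "- \<alpha> < 0" by linarith
    then show ?thesis
    proof cases
      case 1
      from shift[OF this] show ?thesis by simp
    next
      case 2
      from shift[OF this] show ?thesis by simp
    qed
  qed simp
  also have "(CLINT t|lborel. f (Complex (-0) t)) = (CLINT u|lborel. exp (s * of_real u - of_real (exp u)))"
    unfolding fC by (simp add: Complex_eq exp_of_real)
  also have "\<dots> = Gamma s" by (rule Gamma_exp_integral(2)[OF s])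
  finally show ?eq unfolding fC .
qed

text \<open>Translating \<open>u\<close> by \<open>Re (Ln z)\<close>, the logarithm of
  \<open>norm z\<close>, leaves the rotated integral with angle \<open>Im (Ln z)\<close>, which lies
  below \<open>pi / 2\<close> in absolute value because \<open>Re z > 0\<close>.\<close>

lemma Gamma_exp_integral_scaled:
  fixes s z :: complex
  assumes s: "Re s > 0" and z: "Re z > 0"
  shows "integrable lborel (\<lambda>u. exp (s * of_real u - z * of_real (exp u)))" (is ?int)
    and "(CLINT u|lborel. exp (s * of_real u - z * of_real (exp u))) = Gamma s * z powr (- s)" (is ?eq)
proof -
  have z0: "z \<noteq> 0" using z by auto
  have \<alpha>: "\<bar>Im (Ln z)\<bar> < pi / 2" using z Re_Ln_pos_lt z0 by blast
  have eq: "exp (s * of_real u - z * of_real (exp u)) =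
      z powr (- s) * exp (s * Complex (Re (Ln z) + 1 * u) (Im (Ln z)) - exp (Complex (Re (Ln z) + 1 * u) (Im (Ln z))))" for u :: real
  proof -
    have C: "Complex (Re (Ln z) + 1 * u) (Im (Ln z)) = Ln z + of_real u"
      by (simp add: complex_eq_iff)
    show ?thesis
      unfolding C using z0 by (simp add: exp_add powr_def exp_of_real algebra_simps flip: exp_add)
        (simp add: exp_add exp_of_real mult.commute)
  qed
  show ?int
    unfolding eq
    by (intro integrable_mult_right lborel_integrable_real_affine Gamma_exp_integral_rotated s \<alpha>) simp
  show ?eq
    unfolding eq
    by (subst integral_mult_right_zero)
       (use Gamma_exp_integral_rotated(2)[OF s \<alpha>]
          lborel_integral_real_affine[of 1 "\<lambda>u. exp (s * Complex u (Im (Ln z)) - exp (Complex u (Im (Ln z))))" "Re (Ln z)"]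
        in simp)
qed

lemma norm_powr_vertical:
  fixes z :: complex
  assumes "z \<noteq> 0"
  shows "norm (z powr (- Complex \<sigma> t)) = norm z powr (-\<sigma>) * exp (t * Im (Ln z))"
proof -
  have "Re (- Complex \<sigma> t * Ln z) = - \<sigma> * ln (norm z) + t * Im (Ln z)"
    using assms by simp
  then show ?thesis
    using assms by (simp add: powr_def norm_exp_eq_Re exp_add [symmetric])
qed

lemma continuous_on_Gamma_vertical:
  assumes "c > 0"
  shows "continuous_on UNIV (\<lambda>t. Gamma (Complex c t))"
proof -
  have "continuous_on ((\<lambda>t. of_real c + \<i> * of_real t) ` UNIV) (Gamma :: complex \<Rightarrow> complex)"
    by (rule continuous_on_Gamma) (use assms in \<open>auto elim!: nonpos_Ints_cases simp: complex_eq_iff\<close>)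
  then show ?thesis
    unfolding Complex_eq by (rule continuous_on_compose2) (auto intro!: continuous_intros)
qed

lemma continuous_on_powr_vertical:
  "continuous_on UNIV (\<lambda>t. z powr (- Complex c t))"
  unfolding Complex_eq powr_def by (cases "z = 0") (auto intro!: continuous_intros)

text \<open>The integral along the ray of angle \<beta>, equal to plus or minus \<alpha>, is bounded
  in modulus independently of \<open>t\<close>, while it equals \<open>Gamma\<close> times a factor
  of modulus \<open>exp (\<beta> * t)\<close>. The sign of \<beta> is taken to be that of
  \<open>t\<close>.\<close>

lemma Gamma_vertical_decay:
  assumes \<sigma>: "\<sigma> > 0" and \<alpha>: "0 \<le> \<alpha>" "\<alpha> < pi / 2"
  obtains C where "C > 0" "\<And>t. norm (Gamma (Complex \<sigma> t)) \<le> C * exp (- \<alpha> * \<bar>t\<bar>)"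
proof -
  define C where "C = (LINT u|lborel. exp (\<sigma> * u - cos \<alpha> * exp u))"
  have c: "cos \<alpha> > 0" using \<alpha> by (intro cos_gt_zero_pi) auto
  have bd: "norm (Gamma (Complex \<sigma> t)) \<le> C * exp (- \<beta> * t)" if \<beta>: "\<bar>\<beta>\<bar> = \<alpha>" for \<beta> t :: real
  proof -
    have z: "Re (cis \<beta>) > 0" using c \<beta> by (metis cis.sel(1) cos_abs_real)
    have L: "Ln (cis \<beta>) = \<i> * \<beta>" using \<beta> \<alpha> by (simp add: cis_conv_exp Ln_exp)
    have "norm (Gamma (Complex \<sigma> t) * cis \<beta> powr (- Complex \<sigma> t)) \<le> C"
      unfolding C_def
      by (subst Gamma_exp_integral_scaled(2)[symmetric])
         (use \<sigma> z \<beta> in \<open>auto intro!: order.trans[OF integral_norm_bound] simp: abs_if split: if_splits\<close>)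
    moreover have "norm (cis \<beta> powr (- Complex \<sigma> t)) = exp (\<beta> * t)"
      by (subst norm_powr_vertical) (auto simp: L mult.commute)
    ultimately show ?thesis
      by (simp add: norm_mult exp_minus field_simps)
  qed
  have "norm (Gamma (Complex \<sigma> t)) \<le> C * exp (- \<alpha> * \<bar>t\<bar>)" for t
    using bd[of \<alpha> t] bd[of "-\<alpha>" t] \<alpha> by (auto simp: abs_if)
  then have "norm (Gamma (Complex \<sigma> t)) \<le> max C 1 * exp (- \<alpha> * \<bar>t\<bar>)" for t
    by (rule order.trans) (intro mult_right_mono; simp)
  then show ?thesis by (intro that[of "max C 1"]) auto
qed

lemma exp_neg_abs_integrable:
  fixes c :: real
  assumes "c > 0"
  shows "integrable lborel (\<lambda>t. exp (- c * \<bar>t\<bar>))"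
proof -
  have 1: "set_integrable lborel {0..} (\<lambda>t. exp (- c * t))"
  proof -
    have "(\<lambda>t. exp (- c * t)) absolutely_integrable_on {0..}"
      by (rule nonnegative_absolutely_integrable_1) (use integrable_on_exp_minus_to_infinity[OF assms] in auto)
    then show ?thesis
      by (simp add: set_integrable_def integrable_completion)
  qed
  then have i1: "integrable lborel (\<lambda>t. indicator {0..} t * exp (- c * t))"
    by (simp add: set_integrable_def)
  from lborel_integrable_real_affine[OF this, of "-1" 0]
  have i2: "integrable lborel (\<lambda>t. indicator {0..} (- t) * exp (- c * (-t)))" by simp
  show ?thesis
    by (rule Bochner_Integration.integrable_bound[OF Bochner_Integration.integrable_add[OF i1 i2]])
       (auto intro!: AE_I2 simp: indicator_def)
qed

text \<open>Fourier inversion at 0 for \<open>G u = exp (c * u - z * exp u)\<close>: its transform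
  is the scaled Gamma integral, and \<open>G 0 = exp (- z)\<close>.\<close>

lemma exp_mellin_inversion:
  fixes z :: complex and c :: real
  assumes c: "c > 0" and z: "Re z > 0"
  shows "integrable lborel (\<lambda>t. Gamma (Complex c t) * z powr (- Complex c t))" (is ?int)
    and "(CLINT t|lborel. Gamma (Complex c t) * z powr (- Complex c t)) = 2 * pi * exp (- z)" (is ?eq)
proof -
  have z0: "z \<noteq> 0" using z by auto
  \<comment> \<open>A rate strictly between the argument of \<open>z\<close> and
    \<open>pi / 2\<close>, so that the decay of \<open>Gamma\<close> beats the growth of
    \<open>z powr (- Complex c t)\<close>.\<close>
  define \<alpha> where "\<alpha> = (\<bar>Im (Ln z)\<bar> + pi / 2) / 2"
  have L: "\<bar>Im (Ln z)\<bar> < pi / 2" using z Re_Ln_pos_lt z0 by blast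
  then have \<alpha>: "0 \<le> \<alpha>" "\<alpha> < pi / 2" "\<bar>Im (Ln z)\<bar> < \<alpha>" by (auto simp: \<alpha>_def)
  obtain C where C: "C > 0" "\<And>t. norm (Gamma (Complex c t)) \<le> C * exp (- \<alpha> * \<bar>t\<bar>)"
    using Gamma_vertical_decay[OF c \<alpha>(1,2)] by blast
  show int: ?int
  proof (rule Bochner_Integration.integrable_bound)
    show "integrable lborel (\<lambda>t. C * norm z powr (-c) * exp (- (\<alpha> - \<bar>Im (Ln z)\<bar>) * \<bar>t\<bar>))"
      by (intro integrable_mult_right exp_neg_abs_integrable) (use \<alpha> in auto)
    have "continuous_on UNIV (\<lambda>t. Gamma (Complex c t) * z powr (- Complex c t))"
      by (intro continuous_intros continuous_on_Gamma_vertical continuous_on_powr_vertical c)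
    then show "(\<lambda>t. Gamma (Complex c t) * z powr (- Complex c t)) \<in> borel_measurable lborel"
      using borel_measurable_continuous_onI by simp
    show "AE t in lborel. norm (Gamma (Complex c t) * z powr (- Complex c t))
        \<le> norm (C * norm z powr (-c) * exp (- (\<alpha> - \<bar>Im (Ln z)\<bar>) * \<bar>t\<bar>))"
    proof (intro AE_I2)
      fix t
      have "t * Im (Ln z) \<le> \<bar>Im (Ln z)\<bar> * \<bar>t\<bar>" by (metis abs_ge_self abs_mult mult.commute)
      then have e: "exp (t * Im (Ln z)) \<le> exp (\<bar>Im (Ln z)\<bar> * \<bar>t\<bar>)" by simp
      have "norm (Gamma (Complex c t) * z powr (- Complex c t)) \<le>
          (C * exp (- \<alpha> * \<bar>t\<bar>)) * (norm z powr (-c) * exp (\<bar>Im (Ln z)\<bar> * \<bar>t\<bar>))"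
        unfolding norm_mult norm_powr_vertical[OF z0]
        by (intro mult_mono C(2) order.refl e) (use C in auto)
      also have "\<dots> = C * norm z powr (-c) * exp (- (\<alpha> - \<bar>Im (Ln z)\<bar>) * \<bar>t\<bar>)"
        by (simp add: algebra_simps flip: exp_add)
      also have "\<dots> = norm \<dots>" using C by simp
      finally show "norm (Gamma (Complex c t) * z powr (- Complex c t))
        \<le> norm (C * norm z powr (-c) * exp (- (\<alpha> - \<bar>Im (Ln z)\<bar>) * \<bar>t\<bar>))" .
    qed
  qed
  define G where "G u = exp (of_real (c * u) - z * of_real (exp u))" for u :: real
  have hat: "(CLINT u|lborel. G u * iexp (u * t)) = Gamma (Complex c t) * z powr (- Complex c t)" for t
  proof -
    have "G u * iexp (u * t) = exp (Complex c t * of_real u - z * of_real (exp u))" for u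
      by (simp add: G_def Complex_eq algebra_simps flip: exp_add)
    then show ?thesis
      using Gamma_exp_integral_scaled(2)[of "Complex c t" z] c z by simp
  qed
  have intG: "integrable lborel G"
    using Gamma_exp_integral_scaled(1)[of "of_real c" z] c z by (simp add: G_def[abs_def])
  have bG: "norm (G u) \<le> max 1 ((c / Re z) powr c)" for u
  proof -
    have "c * u - Re z * exp u \<le> c * ln (c / Re z)"
    proof -
      have "ln (Re z / c * exp u) \<le> Re z / c * exp u - 1"
        using c z by (intro ln_le_minus_one) auto
      moreover have "ln (Re z / c * exp u) = - ln (c / Re z) + u"
        using c z by (simp add: ln_mult ln_div)
      ultimately have "c * (- ln (c / Re z) + u) \<le> c * (Re z / c * exp u - 1)"
        using c by (intro mult_left_mono) auto
      then show ?thesis using c by (simp add: algebra_simps)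
    qed
    then have "norm (G u) \<le> (c / Re z) powr c"
      using c z by (simp add: G_def norm_exp_eq_Re powr_def)
    then show ?thesis by simp
  qed
  have "(CLINT t|lborel. CLINT u|lborel. G u * iexp (u * t)) = 2 * pi * G 0"
  proof (rule fourier_inversion_at_0[OF intG _ bG])
    show "continuous_on UNIV G" unfolding G_def by (intro continuous_intros)
    show "integrable lborel (\<lambda>t. CLINT u|lborel. G u * iexp (u * t))"
      unfolding hat by (rule int)
  qed
  then show ?eq unfolding hat by (simp add: G_def)
qed

lemma powr_of_real_mult:
  assumes "l > 0" "z \<noteq> 0"
  shows "(complex_of_real l * z) powr s = complex_of_real l powr s * z powr s"
  using assms by (simp add: powr_def Ln_times_of_real Ln_of_real ring_distribs exp_add)

lemma real_Gamma_exp_integral: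
  fixes x \<eta> :: real
  assumes "x > 0" "\<eta> > 0"
  shows "integrable lborel (\<lambda>u. exp (x * u - \<eta> * exp u))"
    and "(LINT u|lborel. exp (x * u - \<eta> * exp u)) = Gamma x * \<eta> powr (- x)"
proof -
  have eq: "exp (of_real x * of_real u - of_real \<eta> * of_real (exp u)) = complex_of_real (exp (x * u - \<eta> * exp u))" for u
    by (simp add: exp_of_real [symmetric])
  have i: "integrable lborel (\<lambda>u. complex_of_real (exp (x * u - \<eta> * exp u)))"
    using Gamma_exp_integral_scaled(1)[of "of_real x" "of_real \<eta>"] assms by (simp only: eq Re_complex_of_real)
  then show "integrable lborel (\<lambda>u. exp (x * u - \<eta> * exp u))"
    by (simp only: complex_of_real_integrable_eq)
  have "complex_of_real (LINT u|lborel. exp (x * u - \<eta> * exp u)) = (CLINT u|lborel. complex_of_real (exp (x * u - \<eta> * exp u)))"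
    by (rule integral_complex_of_real [symmetric])
  also have "\<dots> = Gamma (of_real x) * of_real \<eta> powr (- of_real x)"
    using Gamma_exp_integral_scaled(2)[of "of_real x" "of_real \<eta>"] assms by (simp only: eq Re_complex_of_real)
  also have "\<dots> = complex_of_real (Gamma x * \<eta> powr (- x))"
    using assms powr_of_real[of \<eta> "- x"] by (simp add: Gamma_complex_of_real)
  finally show "(LINT u|lborel. exp (x * u - \<eta> * exp u)) = Gamma x * \<eta> powr (- x)"
    by (simp only: of_real_eq_iff)
qed

section \<open>Sharp bounds on the line Re s = 1/2 and the subtracted kernel\<close>

text \<open>On this line \<open>1 - s\<close> is the conjugate of \<open>s\<close>, so the
  reflection formula yields \<open>(norm (Gamma s))\<^sup>2 = pi / cosh (pi * t)\<close>. The full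
  rate \<open>pi / 2\<close> is reached, where \<open>Gamma_vertical_decay\<close> only gives
  smaller ones, and \<open>sqrt (2 * pi)\<close> is the constant that finally appears in the
  theorem.\<close>

lemma norm_Gamma_half_bound:
  "norm (Gamma (Complex (1/2) t)) \<le> sqrt (2 * pi) * exp (- (pi / 2) * \<bar>t\<bar>)"
proof -
  have c1: "1 - Complex (1/2) t = cnj (Complex (1/2) t)" by (simp add: complex_eq_iff)
  have c2: "complex_of_real pi * Complex (1/2) t = of_real (pi / 2) + \<i> * of_real (pi * t)"
    by (simp add: complex_eq_iff)
  have "sin (complex_of_real pi * Complex (1/2) t) = cos (\<i> * of_real (pi * t))"
    unfolding c2 sin_add by (simp add: sin_of_real cos_of_real)
  also have "\<dots> = of_real (cosh (pi * t))"
    by (simp add: cos_i_times cosh_field_def exp_minus flip: exp_of_real of_real_mult)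
  finally have "Gamma (Complex (1/2) t) * Gamma (1 - Complex (1/2) t) = of_real pi / of_real (cosh (pi * t))"
    using Gamma_reflection_complex[of "Complex (1/2) t"] by simp
  then have "Gamma (Complex (1/2) t) * cnj (Gamma (Complex (1/2) t)) = of_real (pi / cosh (pi * t))"
    by (simp only: c1 cnj_Gamma of_real_divide)
  then have "complex_of_real ((norm (Gamma (Complex (1/2) t)))\<^sup>2) = of_real (pi / cosh (pi * t))"
    by (simp only: complex_norm_square)
  then have "(norm (Gamma (Complex (1/2) t)))\<^sup>2 = pi / cosh (pi * t)"
    by (simp only: of_real_eq_iff)
  also have "\<dots> \<le> pi / (exp (pi * \<bar>t\<bar>) / 2)"
  proof (intro divide_left_mono)
    show "exp (pi * \<bar>t\<bar>) / 2 \<le> cosh (pi * t)"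
      by (cases "t \<ge> 0") (simp_all add: cosh_field_def)
  qed auto
  also have "\<dots> = (sqrt (2 * pi) * exp (- (pi / 2) * \<bar>t\<bar>))\<^sup>2"
    by (simp add: power_mult_distrib exp_double [symmetric] exp_minus field_simps)
  finally show ?thesis by (rule power2_le_imp_le) simp
qed

text \<open>Mean value bound on the segment from \<open>A\<close> to \<open>A + 1\<close>, where the
  modulus is at least \<open>norm A\<close>. The difference gains one power of decay over its first
  term.\<close>

lemma norm_powr_diff_le:
  fixes A :: complex and p :: real
  assumes A: "Re A > 0" and p: "p > 0"
  shows "norm (A powr (- of_real p) - (A + 1) powr (- of_real p)) \<le> p * norm A powr (- p - 1)"
proof -
  have "norm ((A + 1) powr (- of_real p) - A powr (- of_real p)) \<le> (p * norm A powr (- p - 1)) * norm ((A + 1) - A)"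
  proof (rule field_differentiable_bound[where S = "closed_segment A (A + 1)"
        and f' = "\<lambda>z. (- of_real p) * z powr (- of_real p - 1)"])
    fix z assume z: "z \<in> closed_segment A (A + 1)"
    then have z': "Re A \<le> Re z" "Im z = Im A"
      by (auto simp: closed_segment_same_Im closed_segment_eq_real_ivl)
    then have "Re z > 0" using A by simp
    then have zR: "z \<notin> \<real>\<^sub>\<le>\<^sub>0" "z \<noteq> 0" by (auto simp: complex_nonpos_Reals_iff)
    show "((\<lambda>z. z powr (- of_real p)) has_field_derivative (- of_real p) * z powr (- of_real p - 1)) (at z within closed_segment A (A + 1))"
      by (rule has_field_derivative_at_within, rule has_field_derivative_powr) (rule zR)
    have "norm A \<le> norm z"
      unfolding cmod_def z'(2) using z'(1) A by (intro real_sqrt_le_mono add_right_mono power_mono) auto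
    moreover have "norm A > 0" using A by auto
    moreover have "norm (z powr (- of_real p - 1)) = norm z powr (- p - 1)"
      using norm_powr_real_powr'[of "- p - 1" z] norm_powr_vertical[OF zR(2), of "p + 1" 0]
      by (simp add: complex_eq_iff Complex_eq)
    ultimately show "norm ((- of_real p) * z powr (- of_real p - 1)) \<le> p * norm A powr (- p - 1)"
      using p by (auto simp: norm_mult intro!: mult_left_mono powr_mono2')
  qed auto
  then show ?thesis by (simp add: norm_minus_commute)
qed

text \<open>Subtracting the same function with parameter \<open>A + 1\<close> produces an additional zero at \<open>exp u = 0\<close>, without
  which the sums over \<open>n\<close> below would diverge for \<open>r = 1\<close>.\<close>

definition kernel :: "complex \<Rightarrow> real \<Rightarrow> real \<Rightarrow> complex" where
  "kernel A p u = exp (of_real p * of_real u - A * of_real (exp u)) -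
     exp (of_real p * of_real u - (A + 1) * of_real (exp u))"

lemma kernel_integral:
  assumes "Re A > 0" "p > 0"
  shows "integrable lborel (kernel A p)"
    and "(CLINT u|lborel. kernel A p u) = of_real (Gamma p) * (A powr (- of_real p) - (A + 1) powr (- of_real p))"
proof -
  note G = Gamma_exp_integral_scaled[of "of_real p"]
  show "integrable lborel (kernel A p)"
    unfolding kernel_def[abs_def] using assms by (intro Bochner_Integration.integrable_diff G) auto
  show "(CLINT u|lborel. kernel A p u) = of_real (Gamma p) * (A powr (- of_real p) - (A + 1) powr (- of_real p))"
    unfolding kernel_def using assms
    by (subst Bochner_Integration.integral_diff) (auto intro!: G simp: G(2) Gamma_complex_of_real right_diff_distrib)
qed

lemma norm_kernel:
  "norm (kernel A p u) = exp (p * u - Re A * exp u) * (1 - exp (- exp u))"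
proof -
  have "kernel A p u = exp (of_real p * of_real u - A * of_real (exp u)) * of_real (1 - exp (- exp u))"
    unfolding kernel_def by (simp add: algebra_simps exp_diff exp_add exp_minus exp_of_real)
       (simp add: exp_of_real [symmetric] field_simps)
  then show ?thesis by (simp add: norm_mult norm_exp_eq_Re del: of_real_diff)
qed

text \<open>With \<open>y = exp u\<close>,
  \<open>1 - exp (- y) \<le> min 1 y \<le> y powr x\<close>. The choice \<open>x = 1\<close> serves
  the sum over \<open>n\<close>, and \<open>x = r / 2\<close> the residue term.\<close>

lemma norm_kernel_le:
  assumes "0 \<le> x" "x \<le> 1"
  shows "norm (kernel A p u) \<le> exp ((p + x) * u - Re A * exp u)"
proof -
  have "1 - exp (- exp u) \<le> exp (x * u)"
  proof (cases "u \<ge> 0")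
    case True
    then have "1 \<le> exp (x * u)" using assms by simp
    then show ?thesis by (smt (verit) exp_gt_zero)
  next
    case False
    have "1 - exp (- exp u) \<le> exp u" using exp_ge_add_one_self[of "- exp u"] by simp
    also have "\<dots> \<le> exp (x * u)"
    proof -
      have "(1 - x) * u \<le> 0" using False assms by (intro mult_nonneg_nonpos) auto
      then show ?thesis by (simp add: algebra_simps)
    qed
    finally show ?thesis .
  qed
  then have "norm (kernel A p u) \<le> exp (p * u - Re A * exp u) * exp (x * u)"
    unfolding norm_kernel by (intro mult_left_mono) auto
  also have "\<dots> = exp ((p + x) * u - Re A * exp u)"
    by (simp add: algebra_simps flip: exp_add)
  finally show ?thesis .
qed

lemma kernel_measurable [measurable]: "kernel A p \<in> borel_measurable borel"
  unfolding kernel_def[abs_def] by measurable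

lemma kernel_fourier:
  assumes \<beta>: "Re \<beta> > 0"
  shows "(CLINT u|lborel. kernel \<beta> (1/2) u * iexp (- (u * t))) =
    Gamma (Complex (1/2) (- t)) * (\<beta> powr (- Complex (1/2) (- t)) - (\<beta> + 1) powr (- Complex (1/2) (- t)))"
proof -
  have eq: "kernel \<beta> (1/2) u * iexp (- (u * t)) =
      exp (Complex (1/2) (- t) * of_real u - \<beta> * of_real (exp u)) - exp (Complex (1/2) (- t) * of_real u - (\<beta> + 1) * of_real (exp u))" for u
  proof -
    have 1: "Complex (1/2) (- t) * of_real u - A * of_real (exp u) = (of_real (1/2) * of_real u - A * of_real (exp u)) + \<i> * of_real (- (u * t))" for A
      by (simp add: complex_eq_iff)
    show ?thesis unfolding kernel_def 1 exp_add by (simp add: ring_distribs)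
  qed
  note G = Gamma_exp_integral_scaled[of "Complex (1/2) (- t)"]
  show ?thesis
    unfolding eq using \<beta>
    by (subst Bochner_Integration.integral_diff) (auto intro!: G simp: G(2) right_diff_distrib)
qed

text \<open>The factor \<open>exp (pi/2 |t|)\<close> coming from \<open>\<beta>\<close> close to the negative imaginary axis cancels the
  decay of the Gamma function exactly, so that the first summand has the sharp constant.\<close>

lemma norm_kernel_fourier_le:
  assumes \<beta>: "Re \<beta> > 0" and L: "\<bar>Im \<beta>\<bar> \<le> L"
  shows "norm (CLINT u|lborel. kernel \<beta> (1/2) u * iexp (- (u * t))) \<le>
    sqrt (2 * pi) * (norm \<beta> powr (- (1/2)) + exp (- (pi / 2 - arctan L) * \<bar>t\<bar>))"
proof -
  have nz: "\<beta> \<noteq> 0" "\<beta> + 1 \<noteq> 0" using \<beta> by (auto simp: complex_eq_iff)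
  have n: "norm (z powr (- Complex (1/2) (- t))) \<le> norm z powr (- (1/2)) * exp (x * \<bar>t\<bar>)"
    if "z \<noteq> 0" "\<bar>Im (Ln z)\<bar> \<le> x" for z x
  proof -
    have "- t * Im (Ln z) \<le> \<bar>t\<bar> * \<bar>Im (Ln z)\<bar>" by (metis abs_ge_self abs_minus_cancel abs_mult)
    also have "\<dots> \<le> x * \<bar>t\<bar>" using mult_right_mono[OF that(2), of "\<bar>t\<bar>"] by (simp add: mult.commute[of "\<bar>t\<bar>"])
    finally show ?thesis
      using that(1) by (subst norm_powr_vertical) (auto intro!: mult_left_mono)
  qed
  have "\<bar>Im (Ln \<beta>)\<bar> < pi / 2" using Re_Ln_pos_lt[OF nz(1)] \<beta> by simp
  then have b1: "norm (\<beta> powr (- Complex (1/2) (- t))) \<le> norm \<beta> powr (- (1/2)) * exp (pi / 2 * \<bar>t\<bar>)"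
    by (intro n nz) simp
  \<comment> \<open>The real part of \<open>\<beta> + 1\<close> exceeds 1, so its argument is at
    most \<open>arctan L\<close> however close \<beta> is to the imaginary axis, and the second
    summand keeps exponential decay.\<close>
  have "\<bar>Im (Ln (\<beta> + 1))\<bar> \<le> arctan L"
  proof -
    have "Im (Ln (\<beta> + 1)) = arctan (Im \<beta> / (Re \<beta> + 1))"
      using \<beta> nz(2) arg_conv_arctan[of "\<beta> + 1"] by (simp add: Arg_eq_Im_Ln)
    moreover have "\<bar>Im \<beta> / (Re \<beta> + 1)\<bar> \<le> L"
    proof -
      have "\<bar>Im \<beta> / (Re \<beta> + 1)\<bar> \<le> \<bar>Im \<beta>\<bar> / 1"
        unfolding abs_divide using \<beta> by (intro divide_left_mono) auto
      then show ?thesis using L by simp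
    qed
    then have "arctan (Im \<beta> / (Re \<beta> + 1)) \<le> arctan L" "arctan (- L) \<le> arctan (Im \<beta> / (Re \<beta> + 1))"
      by (intro arctan_monotone'; linarith)+
    ultimately show ?thesis by (simp add: arctan_minus)
  qed
  then have "norm ((\<beta> + 1) powr (- Complex (1/2) (- t))) \<le> norm (\<beta> + 1) powr (- (1/2)) * exp (arctan L * \<bar>t\<bar>)"
    by (intro n nz)
  also have "\<dots> \<le> 1 * exp (arctan L * \<bar>t\<bar>)"
  proof (intro mult_right_mono)
    have "norm (\<beta> + 1) \<ge> 1" using complex_Re_le_cmod[of "\<beta> + 1"] \<beta> by simp
    then show "norm (\<beta> + 1) powr (- (1/2)) \<le> 1"
      using powr_mono[of "- (1/2)" 0 "norm (\<beta> + 1)"] nz(2) by (auto split: if_splits)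
  qed simp
  finally have b2: "norm ((\<beta> + 1) powr (- Complex (1/2) (- t))) \<le> exp (arctan L * \<bar>t\<bar>)" by simp
  have "norm (CLINT u|lborel. kernel \<beta> (1/2) u * iexp (- (u * t))) \<le>
      (sqrt (2 * pi) * exp (- (pi / 2) * \<bar>- t\<bar>)) * (norm \<beta> powr (- (1/2)) * exp (pi / 2 * \<bar>t\<bar>) + exp (arctan L * \<bar>t\<bar>))"
    unfolding kernel_fourier[OF \<beta>] norm_mult
    by (intro mult_mono norm_Gamma_half_bound order.trans[OF norm_triangle_ineq4] add_mono b1 b2) auto
  also have "\<dots> = sqrt (2 * pi) * (norm \<beta> powr (- (1/2)) * (exp (- (pi / 2) * \<bar>t\<bar>) * exp (pi / 2 * \<bar>t\<bar>))
      + exp (- (pi / 2) * \<bar>t\<bar>) * exp (arctan L * \<bar>t\<bar>))"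
    by (simp add: algebra_simps)
  also have "exp (- (pi / 2) * \<bar>t\<bar>) * exp (pi / 2 * \<bar>t\<bar>) = 1"
    by (simp flip: exp_add)
  also have "exp (- (pi / 2) * \<bar>t\<bar>) * exp (arctan L * \<bar>t\<bar>) = exp (- (pi / 2 - arctan L) * \<bar>t\<bar>)"
    by (simp add: algebra_simps flip: exp_add)
  finally show ?thesis by simp
qed

section \<open>Generalized Dirichlet series\<close>

text \<open>The terms at some convergent \<open>\<sigma> < x\<close> are multiplied by
  \<open>lam (Suc n) powr (\<sigma> - x)\<close>. Exponents may lie below 1, so this factor is
  bounded by its value at the least one, \<open>lam 1\<close>.\<close>

lemma summable_above_abscissa:
  assumes lam: "exponent_seq lam" and x: "abs_conv_abscissa a lam < ereal x"
  shows "summable (\<lambda>n. norm (a (Suc n)) * lam (Suc n) powr (- x))"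
proof -
  have pos: "0 < lam n" if "n \<ge> 1" for n using lam that by (auto simp: exponent_seq_def)
  have mono: "lam 1 \<le> lam n" if "n \<ge> 1" for n
    using lam that by (cases "n = 1") (auto simp: exponent_seq_def strict_mono_on_def intro: less_imp_le)
  obtain \<sigma> where \<sigma>: "summable (\<lambda>n. norm (a (Suc n)) * lam (Suc n) powr (- \<sigma>))" "\<sigma> < x"
    using x unfolding abs_conv_abscissa_def Inf_less_iff by auto
  have "summable (\<lambda>n. lam 1 powr (\<sigma> - x) * (norm (a (Suc n)) * lam (Suc n) powr (- \<sigma>)))"
    by (intro summable_mult \<sigma>(1))
  then show ?thesis
  proof (rule summable_comparison_test')
    fix n
    have "lam (Suc n) powr (- x) = lam (Suc n) powr (\<sigma> - x) * lam (Suc n) powr (- \<sigma>)"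
      by (simp flip: powr_add)
    also have "\<dots> \<le> lam 1 powr (\<sigma> - x) * lam (Suc n) powr (- \<sigma>)"
      using \<sigma>(2) pos[of 1] mono[of "Suc n"] by (intro mult_right_mono powr_mono2') auto
    finally show "norm (norm (a (Suc n)) * lam (Suc n) powr (- x)) \<le> lam 1 powr (\<sigma> - x) * (norm (a (Suc n)) * lam (Suc n) powr (- \<sigma>))"
      by (simp add: mult_left_mono mult.left_commute)
  qed
qed

lemma abs_conv_abscissa_cong:
  assumes "\<And>n. n \<ge> 1 \<Longrightarrow> norm (a n) = norm (b n)" "\<And>n. n \<ge> 1 \<Longrightarrow> lam n = mu n"
  shows "abs_conv_abscissa a lam = abs_conv_abscissa b mu"
  unfolding abs_conv_abscissa_def using assms by simp

lemma norm_dirichlet_term: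
  assumes "l > 0"
  shows "norm (complex_of_real l powr (- s)) = l powr (- Re s)"
  using assms by (simp add: norm_powr_real_powr)

lemma gen_dirichlet_series_sums:
  assumes lam: "exponent_seq lam" and s: "abs_conv_abscissa a lam < ereal (Re s)"
  shows "(\<lambda>n. a (Suc n) * complex_of_real (lam (Suc n)) powr (- s)) sums gen_dirichlet_series a lam s"
  unfolding gen_dirichlet_series_def
proof (rule summable_sums, rule summable_norm_cancel)
  have "norm (a (Suc n) * complex_of_real (lam (Suc n)) powr (- s)) = norm (a (Suc n)) * lam (Suc n) powr (- Re s)" for n
  proof -
    have "0 < lam (Suc n)" using lam by (simp add: exponent_seq_def)
    then show ?thesis by (simp only: norm_mult norm_dirichlet_term uminus_complex.sel)
  qed
  then show "summable (\<lambda>n. norm (a (Suc n) * complex_of_real (lam (Suc n)) powr (- s)))"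
    using summable_above_abscissa[OF lam s] by simp
qed

lemma gen_dirichlet_series_cnj:
  assumes lam: "exponent_seq lam" and s: "abs_conv_abscissa a lam < ereal (Re s)"
    and b: "\<forall>n\<ge>1. b n = cnj (a n)" and mu: "\<forall>n\<ge>1. lam n = mu n"
  shows "gen_dirichlet_series b mu s = cnj (gen_dirichlet_series a lam (cnj s))"
proof -
  have "(\<lambda>n. cnj (a (Suc n) * complex_of_real (lam (Suc n)) powr (- cnj s))) sums cnj (gen_dirichlet_series a lam (cnj s))"
    unfolding sums_cnj by (rule gen_dirichlet_series_sums[OF lam]) (use s in auto)
  moreover have "cnj (a (Suc n) * complex_of_real (lam (Suc n)) powr (- cnj s)) = b (Suc n) * complex_of_real (mu (Suc n)) powr (- s)" for n
  proof -
    have "0 < lam (Suc n)" using lam by (simp add: exponent_seq_def)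
    then have "cnj (complex_of_real (lam (Suc n)) powr (- cnj s)) = complex_of_real (lam (Suc n)) powr (- s)"
      by (subst cnj_powr) auto
    then show ?thesis using b mu by simp
  qed
  ultimately show ?thesis
    unfolding gen_dirichlet_series_def[of b] by (metis (no_types, lifting) sums_cong sums_unique)
qed

lemma Gamma_holomorphic_right: "Gamma holomorphic_on {s. Re s > 0}"
  by (rule holomorphic_Gamma) (auto elim!: nonpos_Ints_cases)

lemma Im_nonzero_not_nonpos_Int: "Im s \<noteq> 0 \<Longrightarrow> s \<notin> \<int>\<^sub>\<le>\<^sub>0"
  by (auto elim!: nonpos_Ints_cases)

text \<open>Two conjugations cancel: the function is \<open>cnj \<circ> X \<circ> cnj\<close> after
  the map \<open>s \<mapsto> r - s\<close>.\<close>

lemma reflected_holomorphic: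
  fixes X :: "complex \<Rightarrow> complex"
  assumes "X holomorphic_on A" "open A" "(\<lambda>s. of_real r - cnj s) ` B \<subseteq> A" "open B"
  shows "(\<lambda>s. cnj (X (of_real r - cnj s))) holomorphic_on B"
proof -
  have "cnj \<circ> X \<circ> cnj holomorphic_on cnj ` A"
  proof (rule holomorphic_on_compose_cnj_cnj)
    show "X holomorphic_on cnj ` cnj ` A" using assms(1) by (simp add: image_image)
    show "open (cnj ` A)"
      unfolding image_cnj_conv_vimage_cnj using assms(2) by (intro open_vimage) auto
  qed
  moreover have "(\<lambda>s. of_real r - s) ` B \<subseteq> cnj ` A"
  proof safe
    fix s assume "s \<in> B"
    then have "of_real r - cnj s \<in> A" using assms(3) by blast
    then have "cnj (of_real r - cnj s) \<in> cnj ` A" by (rule imageI)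
    then show "of_real r - s \<in> cnj ` A" by simp
  qed
  ultimately have "(cnj \<circ> X \<circ> cnj) \<circ> (\<lambda>s. of_real r - s) holomorphic_on B"
    by (intro holomorphic_on_compose_gen[of _ B "cnj \<circ> X \<circ> cnj" "cnj ` A"])
      (auto simp del: comp_apply intro!: holomorphic_intros)
  then show ?thesis by (simp add: o_def)
qed

text \<open>This is the \<Theta> of the opening description; its Mellin transform is
  \<open>Gamma\<close> times the Dirichlet series.\<close>

definition exp_series :: "(nat \<Rightarrow> complex) \<Rightarrow> (nat \<Rightarrow> real) \<Rightarrow> complex \<Rightarrow> complex" where
  "exp_series a lam z = (\<Sum>n. a (Suc n) * exp (- complex_of_real (lam (Suc n)) * z))"

section \<open>Dirichlet series whose dual has conjugate coefficients\<close>

locale self_dual_series =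
  fixes r :: real and a b :: "nat \<Rightarrow> complex" and lam mu :: "nat \<Rightarrow> real"
    and phi psi :: "complex \<Rightarrow> complex"
  assumes A: "class_A r a lam b mu phi psi"
    and b_eq: "\<forall>n\<ge>1. b n = cnj (a n)"
    and mu_eq: "\<forall>n\<ge>1. lam n = mu n"
begin

section \<open>The completed function and its functional equation\<close>

definition "X s = Gamma s * phi s"

lemma r_pos: "0 < r" and lam: "exponent_seq lam"
  using A by (auto simp: class_A_def hecke_pair_def)

lemma phi_eq: "abs_conv_abscissa a lam < ereal (Re s) \<Longrightarrow> phi s = gen_dirichlet_series a lam s"
  using A by (auto simp: class_A_def)

lemma abscissa_eq: "abs_conv_abscissa b mu = abs_conv_abscissa a lam"
  by (rule abs_conv_abscissa_cong) (use b_eq mu_eq in auto)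

lemma phi_holomorphic: "phi holomorphic_on UNIV - {of_real r}"
  using A by (auto simp: class_A_def analytic_upto_simple_pole_def intro: analytic_imp_holomorphic)

lemma obtain_abscissa:
  obtains \<sigma> where "abs_conv_abscissa a lam < ereal \<sigma>" "\<sigma> > r"
proof -
  have "\<bar>abs_conv_abscissa a lam\<bar> \<noteq> \<infinity>" using A by (auto simp: class_A_def hecke_pair_def)
  then obtain y where "abs_conv_abscissa a lam = ereal y" by auto
  then show ?thesis by (intro that[of "max y r + 1"]) auto
qed

lemma X_holomorphic_right: "X holomorphic_on {s. Re s > 0} - {of_real r}"
  unfolding X_def[abs_def]
  by (intro holomorphic_intros holomorphic_on_subset[OF phi_holomorphic] holomorphic_on_subset[OF Gamma_holomorphic_right])
    auto

lemma X_holomorphic_half_plane: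
  assumes "B \<ge> 0" and "sg = 1 \<or> sg = -1"
  shows "X holomorphic_on {s. sg * Im s > B}"
  unfolding X_def[abs_def]
  by (intro holomorphic_intros holomorphic_on_subset[OF phi_holomorphic] holomorphic_Gamma)
    (use assms in \<open>auto elim!: nonpos_Ints_cases\<close>)

text \<open>Beyond a height \<open>B\<close> that bounds the compact set, \<open>chi\<close> has no
  singularities, so the identity theorem spreads both of its formulas over each half-plane. The one
  for large real parts becomes \<open>chi = X\<close>; the one for small real parts, with conjugate
  coefficients, becomes the reflection of \<open>X\<close>.\<close>

lemma X_half_plane:
  obtains chi B where "B \<ge> 0" "\<And>s. B < \<bar>Im s\<bar> \<Longrightarrow> chi s = X s"
    "\<And>s. B < \<bar>Im s\<bar> \<Longrightarrow> X s = cnj (X (of_real r - cnj s))"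
    "\<And>\<sigma>\<^sub>1 \<sigma>\<^sub>2 \<epsilon>. \<epsilon> > 0 \<Longrightarrow> \<exists>T. \<forall>s. \<sigma>\<^sub>1 \<le> Re s \<longrightarrow> Re s \<le> \<sigma>\<^sub>2 \<longrightarrow> T \<le> \<bar>Im s\<bar> \<longrightarrow> norm (chi s) < \<epsilon>"
proof -
  obtain chi where
    chi1: "\<And>s. abs_conv_abscissa a lam < ereal (Re s) \<Longrightarrow> s \<notin> \<int>\<^sub>\<le>\<^sub>0 \<Longrightarrow>
        chi s = Gamma s * gen_dirichlet_series a lam s" and
    chi2: "\<And>s. ereal (Re s) < ereal r - abs_conv_abscissa b mu \<Longrightarrow> of_real r - s \<notin> \<int>\<^sub>\<le>\<^sub>0 \<Longrightarrow>
        chi s = Gamma (of_real r - s) * gen_dirichlet_series b mu (of_real r - s)" and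
    chi3: "\<And>\<sigma>\<^sub>1 \<sigma>\<^sub>2 \<epsilon>. \<epsilon> > 0 \<Longrightarrow> \<exists>T. \<forall>s. \<sigma>\<^sub>1 \<le> Re s \<longrightarrow> Re s \<le> \<sigma>\<^sub>2 \<longrightarrow> T \<le> \<bar>Im s\<bar> \<longrightarrow> norm (chi s) < \<epsilon>" and
    chi4: "\<exists>K. compact K \<and> chi analytic_on (- K)"
    using A unfolding class_A_def hecke_pair_def by blast
  obtain K where K: "compact K" "chi analytic_on (- K)" using chi4 by blast
  obtain B0 where B0: "\<And>s. s \<in> K \<Longrightarrow> norm s \<le> B0" using compact_imp_bounded[OF K(1)] bounded_iff by blast
  define B where "B = max B0 0"
  obtain \<sigma> where \<sigma>: "abs_conv_abscissa a lam < ereal \<sigma>" "\<sigma> > r"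
    by (rule obtain_abscissa)
  define H where "H sg = {s. sg * Im s > B}" for sg :: real
  have HK: "H sg \<subseteq> - K" if "sg = 1 \<or> sg = -1" for sg
  proof safe
    fix s assume "s \<in> H sg" "s \<in> K"
    then show False using B0[of s] abs_Im_le_cmod[of s] that by (auto simp: H_def B_def)
  qed
  have chihol: "chi holomorphic_on H sg" if "sg = 1 \<or> sg = -1" for sg
    using K(2) HK[OF that] by (meson analytic_imp_holomorphic analytic_on_subset)
  have opH: "open (H sg)" for sg
    unfolding H_def by (intro open_Collect_less continuous_intros)
  have conH: "connected (H sg)" if "sg = 1 \<or> sg = -1" for sg
  proof -
    have "{s. B < - Im s} = {s. Im s < - B}" by auto
    then show ?thesis
      using that convex_halfspace_Im_gt[of B] convex_halfspace_Im_lt[of "-B"]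
      by (auto simp: H_def intro!: convex_connected)
  qed
  have X1: "chi s = X s" if sg: "sg = 1 \<or> sg = -1" and s: "s \<in> H sg" for sg s
  proof (rule analytic_continuation_open[where s = "H sg \<inter> {s. Re s > \<sigma>}" and s' = "H sg" and f = chi and g = X])
    show "open (H sg \<inter> {s. \<sigma> < Re s})" by (intro open_Int opH open_halfspace_Re_gt)
    have "Complex (\<sigma> + 1) (sg * (B + 1)) \<in> H sg \<inter> {s. \<sigma> < Re s}" using sg by (auto simp: H_def)
    then show "H sg \<inter> {s. \<sigma> < Re s} \<noteq> {}" by blast
    show "X holomorphic_on H sg" unfolding H_def by (rule X_holomorphic_half_plane) (use sg in \<open>auto simp: B_def\<close>)
    fix s assume "s \<in> H sg \<inter> {s. \<sigma> < Re s}"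
    then have s: "\<sigma> < Re s" "Im s \<noteq> 0" by (auto simp: H_def B_def)
    have "abs_conv_abscissa a lam < ereal (Re s)"
      using \<sigma>(1) s(1) by (auto elim!: order_less_trans)
    then show "chi s = X s"
      using chi1[OF _ Im_nonzero_not_nonpos_Int[OF s(2)]] by (simp add: X_def phi_eq)
  qed (use sg s opH conH chihol in auto)
  have X2: "X s = cnj (X (of_real r - cnj s))" if sg: "sg = 1 \<or> sg = -1" and s: "s \<in> H sg" for sg s
  proof (rule analytic_continuation_open[where s = "H sg \<inter> {s. Re s < r - \<sigma>}" and s' = "H sg" and f = X
        and g = "\<lambda>s. cnj (X (of_real r - cnj s))"])
    show "open (H sg \<inter> {s. Re s < r - \<sigma>})" by (intro open_Int opH open_halfspace_Re_lt)
    have "Complex (r - \<sigma> - 1) (sg * (B + 1)) \<in> H sg \<inter> {s. Re s < r - \<sigma>}" using sg by (auto simp: H_def)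
    then show "H sg \<inter> {s. Re s < r - \<sigma>} \<noteq> {}" by blast
    show hX: "X holomorphic_on H sg" unfolding H_def by (rule X_holomorphic_half_plane) (use sg in \<open>auto simp: B_def\<close>)
    show "(\<lambda>s. cnj (X (of_real r - cnj s))) holomorphic_on H sg"
      by (rule reflected_holomorphic[OF hX opH _ opH]) (auto simp: H_def)
    fix s assume s: "s \<in> H sg \<inter> {s. Re s < r - \<sigma>}"
    then have Im: "Im s \<noteq> 0" by (auto simp: H_def B_def)
    have lt: "abs_conv_abscissa a lam < ereal (r - Re s)"
      using \<sigma>(1) s by (auto elim!: order_less_trans)
    have ni: "of_real r - s \<notin> \<int>\<^sub>\<le>\<^sub>0" using Im by (intro Im_nonzero_not_nonpos_Int) auto
    have "ereal (Re s) < ereal r - abs_conv_abscissa b mu"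
      unfolding abscissa_eq using lt by (cases "abs_conv_abscissa a lam") auto
    from chi2[OF this ni] have "chi s = Gamma (of_real r - s) * gen_dirichlet_series b mu (of_real r - s)" .
    also have "gen_dirichlet_series b mu (of_real r - s) = cnj (gen_dirichlet_series a lam (cnj (of_real r - s)))"
      by (rule gen_dirichlet_series_cnj[OF lam _ b_eq mu_eq]) (use lt in auto)
    also have "gen_dirichlet_series a lam (cnj (of_real r - s)) = phi (of_real r - cnj s)"
      using lt by (simp add: phi_eq)
    finally have "chi s = cnj (X (of_real r - cnj s))"
      by (simp add: X_def cnj_Gamma)
    then show "X s = cnj (X (of_real r - cnj s))" using X1[OF sg] s by simp
  qed (use sg s opH conH in auto)
  show ?thesis
  proof (rule that[of B chi])
    show "B \<ge> 0" by (simp add: B_def)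
    show "chi s = X s" "X s = cnj (X (of_real r - cnj s))" if "B < \<bar>Im s\<bar>" for s
      using X1[of 1 s] X1[of "-1" s] X2[of 1 s] X2[of "-1" s] that by (auto simp: H_def abs_if split: if_splits)
  qed (use chi3 in auto)
qed

lemma X_small:
  assumes "\<epsilon> > 0"
  obtains T where "T > 0" "\<And>s. \<sigma>\<^sub>1 \<le> Re s \<Longrightarrow> Re s \<le> \<sigma>\<^sub>2 \<Longrightarrow> T \<le> \<bar>Im s\<bar> \<Longrightarrow> norm (X s) \<le> \<epsilon>"
proof -
  obtain chi B where B: "B \<ge> 0" "\<And>s. B < \<bar>Im s\<bar> \<Longrightarrow> chi s = X s"
    "\<exists>T. \<forall>s. \<sigma>\<^sub>1 \<le> Re s \<longrightarrow> Re s \<le> \<sigma>\<^sub>2 \<longrightarrow> T \<le> \<bar>Im s\<bar> \<longrightarrow> norm (chi s) < \<epsilon>"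
    using X_half_plane assms by metis
  then obtain T where T: "\<And>s. \<sigma>\<^sub>1 \<le> Re s \<Longrightarrow> Re s \<le> \<sigma>\<^sub>2 \<Longrightarrow> T \<le> \<bar>Im s\<bar> \<Longrightarrow> norm (chi s) < \<epsilon>"
    by blast
  show ?thesis
  proof (rule that[of "max T (B + 1)"])
    fix s assume "\<sigma>\<^sub>1 \<le> Re s" "Re s \<le> \<sigma>\<^sub>2" "max T (B + 1) \<le> \<bar>Im s\<bar>"
    then show "norm (X s) \<le> \<epsilon>" using T[of s] B(2)[of s] by auto
  qed (use B in auto)
qed

text \<open>All singularities of \<open>X\<close> lie on the real axis, so the identity known at
  large height extends to each open half-plane.\<close>

lemma X_functional_equation_nonreal:
  assumes "Im s \<noteq> 0"
  shows "X s = cnj (X (of_real r - cnj s))"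
proof -
  obtain chi B where B: "B \<ge> 0" "\<And>s. B < \<bar>Im s\<bar> \<Longrightarrow> X s = cnj (X (of_real r - cnj s))"
    using X_half_plane by metis
  define sg :: real where "sg = sgn (Im s)"
  have sg: "sg = 1 \<or> sg = -1" using assms by (auto simp: sg_def sgn_real_def)
  have op: "open {s. sg * Im s > B}" for B
    by (intro open_Collect_less continuous_intros)
  have con: "connected {s. sg * Im s > 0}"
    using sg convex_halfspace_Im_gt[of 0] convex_halfspace_Im_lt[of 0]
    by (auto intro!: convex_connected)
  have hX: "X holomorphic_on {s. sg * Im s > 0}" by (rule X_holomorphic_half_plane) (use sg in auto)
  show ?thesis
  proof (rule analytic_continuation_open[where s = "{s. sg * Im s > B}" and s' = "{s. sg * Im s > 0}" and f = X
        and g = "\<lambda>s. cnj (X (of_real r - cnj s))"])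
    have "Complex 0 (sg * (B + 1)) \<in> {s. B < sg * Im s}" using sg by auto
    then show "{s. B < sg * Im s} \<noteq> {}" by blast
    show "(\<lambda>s. cnj (X (of_real r - cnj s))) holomorphic_on {s. 0 < sg * Im s}"
      by (rule reflected_holomorphic[OF hX op _ op]) auto
    show "s \<in> {s. 0 < sg * Im s}" using assms by (auto simp: sg_def abs_sgn[symmetric] mult.commute)
    fix s assume "s \<in> {s. B < sg * Im s}"
    then have "B < \<bar>Im s\<bar>" using sg by (auto simp: abs_if)
    then show "X s = cnj (X (of_real r - cnj s))" by (rule B(2))
  qed (use op con hX B(1) in auto)
qed

text \<open>The open strip contains neither a pole of \<open>Gamma\<close> nor the point
  \<open>r\<close>, so the identity crosses the real axis. This makes \<open>X\<close> real on the
  whole critical line, including its real point.\<close>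

lemma X_functional_equation_strip:
  assumes "0 < Re s" "Re s < r"
  shows "X s = cnj (X (of_real r - cnj s))"
proof -
  define S where "S = {s. 0 < Re s} \<inter> {s. Re s < r}"
  have S: "open S" "connected S"
    unfolding S_def by (auto intro!: open_Int open_halfspace_Re_gt open_halfspace_Re_lt convex_connected
        convex_Int convex_halfspace_Re_gt convex_halfspace_Re_lt)
  have hX: "X holomorphic_on S"
    by (rule holomorphic_on_subset[OF X_holomorphic_right]) (auto simp: S_def)
  show ?thesis
  proof (rule analytic_continuation_open[where s = "S \<inter> {s. Im s > 0}" and s' = S and f = X
        and g = "\<lambda>s. cnj (X (of_real r - cnj s))"])
    show "open (S \<inter> {s. 0 < Im s})" by (intro open_Int S open_halfspace_Im_gt)
    have "Complex (r / 2) 1 \<in> S \<inter> {s. 0 < Im s}" using r_pos by (auto simp: S_def)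
    then show "S \<inter> {s. 0 < Im s} \<noteq> {}" by blast
    show "(\<lambda>s. cnj (X (of_real r - cnj s))) holomorphic_on S"
      by (rule reflected_holomorphic[OF hX S(1) _ S(1)]) (auto simp: S_def)
  qed (use assms S hX in \<open>auto simp: S_def intro: X_functional_equation_nonreal\<close>)
qed

section \<open>Exponential decay on the critical line and in strips\<close>

definition "F t = Re (X (Complex (r / 2) t))"

text \<open>The critical line is fixed pointwise by \<open>s \<mapsto> r - cnj s\<close>, so
  \<open>X\<close> is real there and taking the real part in \<open>F\<close> loses nothing.\<close>

lemma X_critical_line: "X (Complex (r / 2) t) = of_real (F t)"
proof -
  have "of_real r - cnj (Complex (r / 2) t) = Complex (r / 2) t"
    by (simp add: complex_eq_iff)
  then have "X (Complex (r / 2) t) = cnj (X (Complex (r / 2) t))"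
    using X_functional_equation_strip[of "Complex (r / 2) t"] r_pos by simp
  then show ?thesis by (simp add: F_def complex_eq_iff)
qed

lemma lam_pos: "n \<ge> 1 \<Longrightarrow> 0 < lam n"
  using lam by (simp add: exponent_seq_def)

lemma X_vertical_decay:
  assumes \<sigma>: "abs_conv_abscissa a lam < ereal \<sigma>" "r < \<sigma>" and \<alpha>: "0 \<le> \<alpha>" "\<alpha> < pi / 2"
  obtains D where "D > 0" "\<And>t. norm (X (Complex \<sigma> t)) \<le> D * exp (- \<alpha> * \<bar>t\<bar>)"
proof -
  define M where "M = (\<Sum>n. norm (a (Suc n)) * lam (Suc n) powr (- \<sigma>))"
  obtain C where C: "C > 0" "\<And>t. norm (Gamma (Complex \<sigma> t)) \<le> C * exp (- \<alpha> * \<bar>t\<bar>)"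
    using Gamma_vertical_decay[OF _ \<alpha>, of \<sigma>] r_pos \<sigma>(2) by auto
  have sm: "summable (\<lambda>n. norm (a (Suc n)) * lam (Suc n) powr (- \<sigma>))"
    by (rule summable_above_abscissa[OF lam \<sigma>(1)])
  have M: "M \<ge> 0" unfolding M_def by (rule suminf_nonneg[OF sm]) simp
  have "norm (X (Complex \<sigma> t)) \<le> (C * (M + 1)) * exp (- \<alpha> * \<bar>t\<bar>)" for t
  proof -
    have eq: "norm (a (Suc n) * complex_of_real (lam (Suc n)) powr (- Complex \<sigma> t)) = norm (a (Suc n)) * lam (Suc n) powr (- \<sigma>)" for n
      using norm_dirichlet_term[OF lam_pos[of "Suc n"], of "Complex \<sigma> t"] by (simp add: norm_mult)
    have "norm (phi (Complex \<sigma> t)) \<le> M"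
      unfolding M_def using \<sigma>(1) eq sm
      by (simp only: phi_eq complex.sel gen_dirichlet_series_def flip: eq)
         (rule summable_norm, simp)
    then have "norm (X (Complex \<sigma> t)) \<le> (C * exp (- \<alpha> * \<bar>t\<bar>)) * (M + 1)"
      unfolding X_def norm_mult by (intro mult_mono C(2)) (use C M in auto)
    then show ?thesis by (simp add: mult_ac)
  qed
  then show ?thesis using C M by (intro that[of "C * (M + 1)"]) auto
qed

text \<open>On the right edge the Dirichlet series is bounded and \<open>Gamma\<close> decays; the
  functional equation moves this to the left edge \<open>r - \<sigma>\<close>.
  \<open>X_small\<close> supplies the a priori boundedness that the Phragmen-Lindelof argument
  starts from.\<close>

lemma X_strip_decay:
  assumes \<sigma>: "abs_conv_abscissa a lam < ereal \<sigma>" "r < \<sigma>" and \<alpha>: "0 \<le> \<alpha>" "\<alpha> < pi / 2"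
  obtains D T where "D \<ge> 0" "T > 0"
    "\<And>s. r - \<sigma> \<le> Re s \<Longrightarrow> Re s \<le> \<sigma> \<Longrightarrow> T \<le> \<bar>Im s\<bar> \<Longrightarrow> norm (X s) \<le> D * exp (- \<alpha> * \<bar>Im s\<bar>)"
proof -
  obtain C where C: "C > 0" "\<And>t. norm (X (Complex \<sigma> t)) \<le> C * exp (- \<alpha> * \<bar>t\<bar>)"
    using X_vertical_decay[OF assms] by blast
  obtain T where T: "T > 0" "\<And>s. r - \<sigma> \<le> Re s \<Longrightarrow> Re s \<le> \<sigma> \<Longrightarrow> T \<le> \<bar>Im s\<bar> \<Longrightarrow> norm (X s) \<le> 1"
    using X_small[of 1 "r - \<sigma>" \<sigma>] by auto
  define D where "D = C + 1 * exp (\<alpha> * T)"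
  have edge: "norm (X s) \<le> C * exp (- \<alpha> * \<bar>Im s\<bar>)"
    if "Im s \<noteq> 0" "Re s = r - \<sigma> \<or> Re s = \<sigma>" for s
  proof -
    have "X s = X (Complex \<sigma> (Im s)) \<or> X s = cnj (X (Complex \<sigma> (Im s)))"
    proof (cases "Re s = \<sigma>")
      case True
      then have "s = Complex \<sigma> (Im s)" by (simp add: complex_eq_iff)
      then show ?thesis by metis
    next
      case False
      then have "of_real r - cnj s = Complex \<sigma> (Im s)" using that by (simp add: complex_eq_iff)
      then show ?thesis using X_functional_equation_nonreal[OF that(1)] by simp
    qed
    then show ?thesis using C(2)[of "Im s"] by auto
  qed
  have half: "X holomorphic_on {s. 0 < Im s}"
    using X_holomorphic_half_plane[of 0 1] by simp
  have "X holomorphic_on {s. Im s < 0}"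
    using X_holomorphic_half_plane[of 0 "-1"] by simp
  \<comment> \<open>The map \<open>s \<mapsto> r - s\<close> preserves the strip and exchanges the
    half-planes, which reduces the lower half-strip to the upper one.\<close>
  then have half': "X \<circ> (\<lambda>s. of_real r - s) holomorphic_on {s. 0 < Im s}"
    by (intro holomorphic_on_compose_gen[where t = "{s. Im s < 0}"] holomorphic_intros) auto
  have "norm (X s) \<le> D * exp (- \<alpha> * \<bar>Im s\<bar>)"
    if s: "r - \<sigma> \<le> Re s" "Re s \<le> \<sigma>" "T \<le> \<bar>Im s\<bar>" for s
  proof (cases "Im s > 0")
    case True
    have "norm (X s) \<le> D * exp (- \<alpha> * Im s)"
      unfolding D_def
    proof (rule phragmen_lindelof_half_strip[OF open_halfspace_Im_gt half, of "r - \<sigma>" \<sigma> T])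
      fix w assume w: "w \<in> {s. r - \<sigma> \<le> Re s \<and> Re s \<le> \<sigma> \<and> T \<le> Im s}"
      then show "norm (X w) \<le> 1" using T by auto
      assume "Re w = r - \<sigma> \<or> Re w = \<sigma>"
      then show "norm (X w) \<le> C * exp (- \<alpha> * Im w)"
        using edge[of w] w T(1) by auto
    qed (use T C s \<alpha> True in auto)
    then show ?thesis using True by simp
  next
    case False
    have "norm ((X \<circ> (\<lambda>s. of_real r - s)) (of_real r - s)) \<le> D * exp (- \<alpha> * Im (of_real r - s))"
      unfolding D_def
    proof (rule phragmen_lindelof_half_strip[OF open_halfspace_Im_gt half', of "r - \<sigma>" \<sigma> T])
      fix w assume w: "w \<in> {s. r - \<sigma> \<le> Re s \<and> Re s \<le> \<sigma> \<and> T \<le> Im s}"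
      then show "norm ((X \<circ> (\<lambda>s. of_real r - s)) w) \<le> 1" using T by auto
      assume "Re w = r - \<sigma> \<or> Re w = \<sigma>"
      then show "norm ((X \<circ> (\<lambda>s. of_real r - s)) w) \<le> C * exp (- \<alpha> * Im w)"
        using edge[of "of_real r - w"] w T(1) by auto
    qed (use T C s \<alpha> False in auto)
    then show ?thesis using False by simp
  qed
  moreover have "D \<ge> 0" using C by (auto simp: D_def)
  ultimately show ?thesis using T(1) by (intro that[of D T]) auto
qed

lemma continuous_X_vertical:
  assumes "\<sigma> > 0" "\<sigma> \<noteq> r"
  shows "continuous_on UNIV (\<lambda>t. X (Complex \<sigma> t))"
proof (rule continuous_on_compose2[OF holomorphic_on_imp_continuous_on[OF X_holomorphic_right]])
  show "continuous_on UNIV (Complex \<sigma>)" unfolding Complex_eq by (intro continuous_intros)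
qed (use assms in \<open>auto simp: complex_eq_iff\<close>)

lemma continuous_F: "continuous_on A F"
proof -
  have "continuous_on UNIV F"
    unfolding F_def[abs_def] by (intro continuous_intros continuous_X_vertical) (use r_pos in auto)
  then show ?thesis by (rule continuous_on_subset) simp
qed

lemma F_measurable [measurable]: "F \<in> borel_measurable borel"
  using continuous_F by (rule borel_measurable_continuous_onI)

lemma F_decay:
  assumes \<alpha>: "0 \<le> \<alpha>" "\<alpha> < pi / 2"
  obtains D where "D \<ge> 0" "\<And>t. \<bar>F t\<bar> \<le> D * exp (- \<alpha> * \<bar>t\<bar>)"
proof -
  obtain \<sigma> where \<sigma>: "abs_conv_abscissa a lam < ereal \<sigma>" "r < \<sigma>" by (rule obtain_abscissa)
  obtain D T where D: "D \<ge> 0" "T > 0"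
    "\<And>s. r - \<sigma> \<le> Re s \<Longrightarrow> Re s \<le> \<sigma> \<Longrightarrow> T \<le> \<bar>Im s\<bar> \<Longrightarrow> norm (X s) \<le> D * exp (- \<alpha> * \<bar>Im s\<bar>)"
    using X_strip_decay[OF \<sigma> \<alpha>] by blast
  have "compact (F ` {-T..T})" by (intro compact_continuous_image continuous_F) simp
  then obtain M where M: "\<And>t. t \<in> {-T..T} \<Longrightarrow> \<bar>F t\<bar> \<le> M"
    using compact_imp_bounded bounded_iff by (metis imageI real_norm_def)
  have M0: "M \<ge> 0" using M[of 0] D(2) by auto
  have "\<bar>F t\<bar> \<le> (D + M * exp (\<alpha> * T)) * exp (- \<alpha> * \<bar>t\<bar>)" for t
  proof (cases "\<bar>t\<bar> \<ge> T")
    case True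
    have "\<bar>F t\<bar> = norm (X (Complex (r / 2) t))" by (simp add: X_critical_line)
    also have "\<dots> \<le> D * exp (- \<alpha> * \<bar>t\<bar>)"
      using D(3)[of "Complex (r / 2) t"] True r_pos \<sigma>(2) by simp
    also have "\<dots> \<le> (D + M * exp (\<alpha> * T)) * exp (- \<alpha> * \<bar>t\<bar>)"
      using M0 by (intro mult_right_mono) auto
    finally show ?thesis .
  next
    case False
    have "\<bar>F t\<bar> \<le> M * 1" using M[of t] False by fastforce
    also have "\<dots> \<le> M * exp (\<alpha> * T - \<alpha> * \<bar>t\<bar>)"
    proof -
      have "\<alpha> * \<bar>t\<bar> \<le> \<alpha> * T" using False \<alpha> by (intro mult_left_mono) auto
      then show ?thesis using M0 by (intro mult_left_mono) auto
    qed
    also have "\<dots> = (M * exp (\<alpha> * T)) * exp (- \<alpha> * \<bar>t\<bar>)" by (simp add: exp_diff exp_minus field_simps)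
    also have "\<dots> \<le> (D + M * exp (\<alpha> * T)) * exp (- \<alpha> * \<bar>t\<bar>)"
      using D by (intro mult_right_mono) auto
    finally show ?thesis .
  qed
  then show ?thesis using D M0 by (intro that[of "D + M * exp (\<alpha> * T)"]) auto
qed

lemma F_exp_integrable:
  assumes "\<bar>\<beta>\<bar> < pi / 2"
  shows "integrable lborel (\<lambda>t. F t * exp (\<beta> * t))"
proof -
  define \<alpha> where "\<alpha> = (\<bar>\<beta>\<bar> + pi / 2) / 2"
  have \<alpha>: "0 \<le> \<alpha>" "\<alpha> < pi / 2" "\<bar>\<beta>\<bar> < \<alpha>" using assms by (auto simp: \<alpha>_def)
  obtain D where D: "D \<ge> 0" "\<And>t. \<bar>F t\<bar> \<le> D * exp (- \<alpha> * \<bar>t\<bar>)" using F_decay[OF \<alpha>(1,2)] by blast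
  have i: "integrable lborel (\<lambda>t. D * exp (- (\<alpha> - \<bar>\<beta>\<bar>) * \<bar>t\<bar>))"
    by (intro integrable_mult_right exp_neg_abs_integrable) (use \<alpha> in auto)
  show ?thesis
  proof (rule Bochner_Integration.integrable_bound[OF i], measurable, intro AE_I2)
    fix t
    have "\<beta> * t \<le> \<bar>\<beta>\<bar> * \<bar>t\<bar>" by (metis abs_ge_self abs_mult)
    then have "\<bar>F t\<bar> * exp (\<beta> * t) \<le> (D * exp (- \<alpha> * \<bar>t\<bar>)) * exp (\<bar>\<beta>\<bar> * \<bar>t\<bar>)"
      by (intro mult_mono D(2)) (use D(1) in auto)
    also have "\<dots> = D * exp (- (\<alpha> - \<bar>\<beta>\<bar>) * \<bar>t\<bar>)" by (simp add: algebra_simps flip: exp_add)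
    finally show "norm (F t * exp (\<beta> * t)) \<le> norm (D * exp (- (\<alpha> - \<bar>\<beta>\<bar>) * \<bar>t\<bar>))"
      using D(1) by (simp add: abs_mult)
  qed
qed

section \<open>The exponential series as an integral over the critical line\<close>

text \<open>Mellin inversion of each exponential, summed under the integral. The interchange is
  justified because the norms of the terms are those of the Dirichlet series at \<sigma>, times a
  fixed integrable function.\<close>

lemma exp_series_mellin:
  assumes \<sigma>: "abs_conv_abscissa a lam < ereal \<sigma>" "r < \<sigma>" and z: "Re z > 0"
  shows "integrable lborel (\<lambda>t. X (Complex \<sigma> t) * z powr (- Complex \<sigma> t))"
    and "(CLINT t|lborel. X (Complex \<sigma> t) * z powr (- Complex \<sigma> t)) = 2 * pi * exp_series a lam z"
    and "summable (\<lambda>n. a (Suc n) * exp (- complex_of_real (lam (Suc n)) * z))"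
proof -
  define f where "f n t = a (Suc n) * (Gamma (Complex \<sigma> t) * (of_real (lam (Suc n)) * z) powr (- Complex \<sigma> t))" for n t
  have z0: "z \<noteq> 0" using z by auto
  have \<sigma>0: "\<sigma> > 0" using \<sigma>(2) r_pos by simp
  have lz: "Re (complex_of_real (lam (Suc n)) * z) > 0" for n using lam_pos[of "Suc n"] z by simp
  define g where "g t = Gamma (Complex \<sigma> t) * z powr (- Complex \<sigma> t)" for t
  have f: "f n t = (a (Suc n) * complex_of_real (lam (Suc n)) powr (- Complex \<sigma> t)) * g t" for n t
    using lam_pos[of "Suc n"] z0 by (simp add: f_def g_def powr_of_real_mult)
  have nf: "norm (f n t) = (norm (a (Suc n)) * lam (Suc n) powr (- \<sigma>)) * norm (g t)" for n t
    using norm_dirichlet_term[OF lam_pos[of "Suc n"], of "Complex \<sigma> t"] by (simp add: f norm_mult)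
  have sm: "summable (\<lambda>n. norm (a (Suc n)) * lam (Suc n) powr (- \<sigma>))"
    by (rule summable_above_abscissa[OF lam \<sigma>(1)])
  have i1: "integrable lborel (f n)" for n
    unfolding f_def[abs_def] by (intro integrable_mult_right exp_mellin_inversion(1) \<sigma>0 lz)
  have i2: "(CLINT t|lborel. f n t) = 2 * pi * (a (Suc n) * exp (- complex_of_real (lam (Suc n)) * z))" for n
    unfolding f_def by (simp add: exp_mellin_inversion(2)[OF \<sigma>0 lz])
  have s1: "AE t in lborel. summable (\<lambda>n. norm (f n t))"
    unfolding nf by (intro AE_I2 summable_mult2 sm)
  have s2: "summable (\<lambda>n. LINT t|lborel. norm (f n t))"
    unfolding nf by (simp add: summable_mult2 sm)
  have sum: "(\<Sum>n. f n t) = X (Complex \<sigma> t) * z powr (- Complex \<sigma> t)" for t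
  proof -
    have "(\<lambda>n. f n t) sums (gen_dirichlet_series a lam (Complex \<sigma> t) * g t)"
      unfolding f by (intro sums_mult2 gen_dirichlet_series_sums lam) (use \<sigma>(1) in auto)
    then show ?thesis
      using \<sigma>(1) by (simp add: sums_iff g_def X_def phi_eq mult_ac)
  qed
  show "integrable lborel (\<lambda>t. X (Complex \<sigma> t) * z powr (- Complex \<sigma> t))"
    using integrable_suminf[OF i1 s1 s2] by (simp only: sum)
  have *: "(\<lambda>n. 2 * pi * (a (Suc n) * exp (- complex_of_real (lam (Suc n)) * z))) sums
      (CLINT t|lborel. X (Complex \<sigma> t) * z powr (- Complex \<sigma> t))"
    using sums_integral[OF i1 s1 s2] by (simp only: sum i2)
  have **: "complex_of_real (2 * pi) \<noteq> 0" by simp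
  show sm': "summable (\<lambda>n. a (Suc n) * exp (- complex_of_real (lam (Suc n)) * z))"
    using sums_summable[OF *] ** summable_cmult_iff[of "complex_of_real (2 * pi)" "\<lambda>n. a (Suc n) * exp (- complex_of_real (lam (Suc n)) * z)"]
    by blast
  show "(CLINT t|lborel. X (Complex \<sigma> t) * z powr (- Complex \<sigma> t)) = 2 * pi * exp_series a lam z"
    using sums_unique[OF *] by (simp only: exp_series_def suminf_mult[OF sm'])
qed

text \<open>The residue of \<open>X\<close> at \<open>r\<close>.\<close>

definition "R = Gamma (complex_of_real r) * residue phi (of_real r)"

text \<open>The line of Mellin inversion is moved from \<sigma> to \<open>r / 2\<close>; the only
  possible singularity passed on the way is \<open>r\<close>.\<close>

lemma exp_series_critical_line:
  assumes z: "Re z > 0"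
  shows "2 * pi * exp_series a lam z = 2 * pi * R * z powr (- of_real r) +
      (CLINT t|lborel. F t * z powr (- Complex (r / 2) t))"
proof -
  obtain \<sigma> where \<sigma>: "abs_conv_abscissa a lam < ereal \<sigma>" "r < \<sigma>" by (rule obtain_abscissa)
  have z0: "z \<noteq> 0" using z by auto
  define \<alpha> where "\<alpha> = (\<bar>Im (Ln z)\<bar> + pi / 2) / 2"
  have L: "\<bar>Im (Ln z)\<bar> < pi / 2" using z Re_Ln_pos_lt z0 by blast
  then have \<alpha>: "0 \<le> \<alpha>" "\<alpha> < pi / 2" "\<bar>Im (Ln z)\<bar> < \<alpha>" by (auto simp: \<alpha>_def)
  obtain D T where D: "D \<ge> 0" "T > 0"
    "\<And>s. r - \<sigma> \<le> Re s \<Longrightarrow> Re s \<le> \<sigma> \<Longrightarrow> T \<le> \<bar>Im s\<bar> \<Longrightarrow> norm (X s) \<le> D * exp (- \<alpha> * \<bar>Im s\<bar>)"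
    using X_strip_decay[OF \<sigma> \<alpha>(1,2)] by blast
  define E where "E = max (norm z powr (- (r / 2))) (norm z powr (- \<sigma>))"
  have E: "norm z powr (- x) \<le> E" if "r / 2 \<le> x" "x \<le> \<sigma>" for x
  proof (cases "norm z \<ge> 1")
    case True
    then have "norm z powr (- x) \<le> norm z powr (- (r / 2))" using that by (intro powr_mono) auto
    then show ?thesis by (simp add: E_def)
  next
    case False
    then have "norm z powr (- x) \<le> norm z powr (- \<sigma>)" using that z0 by (intro powr_mono') auto
    then show ?thesis by (simp add: E_def)
  qed
  define f where "f s = X s * z powr (- s)" for s
  have f_eq: "f = (\<lambda>s. (Gamma s * z powr (- s)) * phi s)" by (simp add: f_def X_def fun_eq_iff)
  have fbd: "norm (f s) \<le> D * E * exp (- (\<alpha> - \<bar>Im (Ln z)\<bar>) * \<bar>Im s\<bar>)"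
    if "r / 2 \<le> Re s" "Re s \<le> \<sigma>" "T \<le> \<bar>Im s\<bar>" for s
  proof -
    have "norm (z powr (- s)) = norm z powr (- Re s) * exp (Im s * Im (Ln z))"
      using norm_powr_vertical[OF z0, of "Re s" "Im s"] by simp
    moreover have "Im s * Im (Ln z) \<le> \<bar>Im (Ln z)\<bar> * \<bar>Im s\<bar>" by (metis abs_ge_self abs_mult mult.commute)
    ultimately have "norm (z powr (- s)) \<le> E * exp (\<bar>Im (Ln z)\<bar> * \<bar>Im s\<bar>)"
      using E[of "Re s"] that by (auto intro!: mult_mono order.trans[OF _ E])
    moreover have "norm (X s) \<le> D * exp (- \<alpha> * \<bar>Im s\<bar>)"
      using D(3)[of s] that r_pos \<sigma>(2) by auto
    ultimately have "norm (f s) \<le> (D * exp (- \<alpha> * \<bar>Im s\<bar>)) * (E * exp (\<bar>Im (Ln z)\<bar> * \<bar>Im s\<bar>))"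
      unfolding f_def norm_mult using D(1) by (intro mult_mono) auto
    also have "\<dots> = D * E * exp (- (\<alpha> - \<bar>Im (Ln z)\<bar>) * \<bar>Im s\<bar>)"
      by (simp add: algebra_simps flip: exp_add)
    finally show ?thesis .
  qed
  have zp: "(\<lambda>s. z powr (- s)) holomorphic_on A" for A
    unfolding powr_def using z0 by (auto intro!: holomorphic_intros)
  have hol: "f holomorphic_on {s. Re s > 0} - {of_real r}"
    unfolding f_def[abs_def] by (intro holomorphic_intros X_holomorphic_right zp)
  have F_eq: "f (Complex (r / 2) t) = F t * z powr (- Complex (r / 2) t)" for t
    by (simp add: f_def X_critical_line)
  have "(CLINT t|lborel. f (Complex \<sigma> t)) - (CLINT t|lborel. f (Complex (r / 2) t)) = 2 * pi * residue f (of_real r)"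
  proof (rule vertical_line_shift[OF open_halfspace_Re_gt _ _ hol])
    show "connected {s. 0 < Re s}" by (intro convex_connected convex_halfspace_Re_gt)
    show "{s. r / 2 \<le> Re s \<and> Re s \<le> \<sigma>} \<subseteq> {s. 0 < Re s}" using r_pos by auto
    show "integrable lborel (\<lambda>t. f (Complex \<sigma> t))"
      unfolding f_def by (rule exp_series_mellin(1)[OF \<sigma> z])
    have "integrable lborel (\<lambda>t. norm z powr (- (r / 2)) * (F t * exp (Im (Ln z) * t)))"
      by (intro integrable_mult_right F_exp_integrable L)
    then show "integrable lborel (\<lambda>t. f (Complex (r / 2) t))"
    proof (rule Bochner_Integration.integrable_bound)
      show "(\<lambda>t. f (Complex (r / 2) t)) \<in> borel_measurable lborel"
        using borel_measurable_continuous_onI[OF continuous_on_mult[OF continuous_X_vertical continuous_on_powr_vertical]] r_pos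
        by (simp add: f_def)
      show "AE t in lborel. norm (f (Complex (r / 2) t)) \<le> norm (norm z powr (- (r / 2)) * (F t * exp (Im (Ln z) * t)))"
        unfolding F_eq norm_mult norm_powr_vertical[OF z0] by (intro AE_I2) (simp add: abs_mult mult_ac)
    qed
    fix \<epsilon> :: real assume \<epsilon>: "\<epsilon> > 0"
    have "((\<lambda>y. D * E * exp (- (\<alpha> - \<bar>Im (Ln z)\<bar>) * y)) \<longlongrightarrow> 0) at_top"
      using \<alpha>(3) by real_asymp
    then have "eventually (\<lambda>y. D * E * exp (- (\<alpha> - \<bar>Im (Ln z)\<bar>) * y) < \<epsilon>) at_top"
      using \<epsilon> by (rule order_tendstoD)
    then obtain Y where Y: "\<And>y. y \<ge> Y \<Longrightarrow> D * E * exp (- (\<alpha> - \<bar>Im (Ln z)\<bar>) * y) < \<epsilon>"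
      by (auto simp: eventually_at_top_linorder)
    show "\<exists>T. \<forall>s. r / 2 \<le> Re s \<longrightarrow> Re s \<le> \<sigma> \<longrightarrow> T \<le> \<bar>Im s\<bar> \<longrightarrow> norm (f s) \<le> \<epsilon>"
    proof (intro exI[of _ "max T Y"] allI impI)
      fix s assume "r / 2 \<le> Re s" "Re s \<le> \<sigma>" "max T Y \<le> \<bar>Im s\<bar>"
      then show "norm (f s) \<le> \<epsilon>" using fbd[of s] Y[of "\<bar>Im s\<bar>"] by auto
    qed
  qed (use r_pos \<sigma> in auto)
  moreover have "residue f (of_real r) = R * z powr (- of_real r)"
  proof -
    have "residue f (of_real r) = (Gamma (of_real r) * z powr (- of_real r)) * residue phi (of_real r)"
      unfolding f_eq
    proof (rule residue_mult_upto_simple_pole[OF open_halfspace_Re_gt])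
      show "(\<lambda>s. Gamma s * z powr - s) holomorphic_on {s. 0 < Re s}"
        by (intro holomorphic_intros zp Gamma_holomorphic_right)
      show "analytic_upto_simple_pole phi (of_real r)" using A by (auto simp: class_A_def)
    qed (use r_pos in auto)
    then show ?thesis by (simp add: R_def mult_ac)
  qed
  moreover have "(CLINT t|lborel. f (Complex \<sigma> t)) = 2 * pi * exp_series a lam z"
    unfolding f_def by (rule exp_series_mellin(2)[OF \<sigma> z])
  ultimately show ?thesis by (simp add: F_eq algebra_simps)
qed

text \<open>The Fourier transform of \<open>F\<close> tilted by \<open>exp (\<alpha> * t)\<close>.
  By \<open>J_eq\<close>, \<open>u\<close> and \<alpha> are the logarithm of the modulus and the
  argument of the point at which the exponential series is taken.\<close>

definition J :: "real \<Rightarrow> real \<Rightarrow> complex" where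
  "J \<alpha> u = (CLINT t|lborel. complex_of_real (F t * exp (\<alpha> * t)) * iexp (- (u * t)))"

text \<open>The critical line formula at \<open>z = exp (Complex u \<alpha>)\<close>, multiplied by
  \<open>z powr (r / 2)\<close>. Since \<open>\<bar>\<alpha>\<bar> < pi / 2\<close>, this
  \<open>z\<close> lies in the right half-plane and
  \<open>Ln z = Complex u \<alpha>\<close>.\<close>

lemma J_eq:
  assumes "\<bar>\<alpha>\<bar> < pi / 2"
  shows "J \<alpha> u = 2 * pi * (exp (r / 2 * Complex u \<alpha>) * exp_series a lam (exp (Complex u \<alpha>)) -
      R * exp (- (r / 2) * Complex u \<alpha>))"
proof -
  define z where "z = exp (Complex u \<alpha>)"
  have c: "cos \<alpha> > 0" using assms by (intro cos_gt_zero_pi) auto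
  then have z: "Re z > 0" by (simp add: z_def Re_exp)
  have L: "Ln z = Complex u \<alpha>" unfolding z_def using assms by (intro Ln_exp) auto
  have zp: "z powr s = exp (s * Complex u \<alpha>)" for s
    using z by (auto simp: powr_def L)
  have "z powr (- Complex (r / 2) t) = exp (- (r / 2) * Complex u \<alpha>) * (of_real (exp (\<alpha> * t)) * iexp (- (u * t)))" for t
    unfolding zp exp_of_real [symmetric] exp_add [symmetric] by (rule arg_cong[where f = exp]) (simp add: complex_eq_iff)
  then have "(CLINT t|lborel. F t * z powr (- Complex (r / 2) t)) =
      (CLINT t|lborel. exp (- (r / 2) * Complex u \<alpha>) * (of_real (F t * exp (\<alpha> * t)) * iexp (- (u * t))))"
    by (simp add: mult_ac)
  also have "\<dots> = exp (- (r / 2) * Complex u \<alpha>) * J \<alpha> u"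
    unfolding J_def by (rule integral_mult_right_zero)
  finally have "2 * pi * exp_series a lam z = 2 * pi * R * exp (- of_real r * Complex u \<alpha>) + exp (- (r / 2) * Complex u \<alpha>) * J \<alpha> u"
    using exp_series_critical_line[OF z] by (simp add: zp)
  then have "exp (r / 2 * Complex u \<alpha>) * (2 * pi * exp_series a lam z) =
      exp (r / 2 * Complex u \<alpha>) * (2 * pi * R * exp (- of_real r * Complex u \<alpha>) + exp (- (r / 2) * Complex u \<alpha>) * J \<alpha> u)"
    by simp
  also have "\<dots> = 2 * pi * R * (exp (r / 2 * Complex u \<alpha>) * exp (- of_real r * Complex u \<alpha>)) +
      (exp (r / 2 * Complex u \<alpha>) * exp (- (r / 2) * Complex u \<alpha>)) * J \<alpha> u"
    by (simp only: ring_distribs mult_ac)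
  also have "exp (r / 2 * Complex u \<alpha>) * exp (- of_real r * Complex u \<alpha>) = exp (- (r / 2) * Complex u \<alpha>)"
    unfolding exp_add [symmetric] by (rule arg_cong[where f = exp]) (simp add: complex_eq_iff)
  also have "exp (r / 2 * Complex u \<alpha>) * exp (- (r / 2) * Complex u \<alpha>) = 1"
    unfolding exp_add [symmetric] by simp
  finally show ?thesis by (simp add: z_def algebra_simps)
qed

lemma exp_series_abs_summable:
  assumes "y > 0"
  shows "summable (\<lambda>n. norm (a (Suc n)) * exp (- lam (Suc n) * y))"
proof -
  obtain \<sigma> where \<sigma>: "abs_conv_abscissa a lam < ereal \<sigma>" "r < \<sigma>" by (rule obtain_abscissa)
  then have \<sigma>0: "\<sigma> > 0" using r_pos by simp
  have "summable (\<lambda>n. (\<sigma> / y) powr \<sigma> * (norm (a (Suc n)) * lam (Suc n) powr (- \<sigma>)))"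
    by (intro summable_mult summable_above_abscissa lam \<sigma>)
  then show ?thesis
  proof (rule summable_comparison_test')
    fix n
    have l: "lam (Suc n) > 0" by (rule lam_pos) simp
    have "exp (- (lam (Suc n) * y)) \<le> (\<sigma> / (lam (Suc n) * y)) powr \<sigma>"
      by (rule exp_minus_le_powr) (use l assms \<sigma>0 in auto)
    also have "\<dots> = (\<sigma> / y) powr \<sigma> * lam (Suc n) powr (- \<sigma>)"
      using l assms \<sigma>0 by (simp add: powr_divide powr_mult powr_minus field_simps)
    finally show "norm (norm (a (Suc n)) * exp (- lam (Suc n) * y)) \<le>
        (\<sigma> / y) powr \<sigma> * (norm (a (Suc n)) * lam (Suc n) powr (- \<sigma>))"
      by (simp add: mult.left_commute mult_left_mono)
  qed
qed

lemma F_abs_exp_integrable: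
  assumes "\<bar>\<beta>\<bar> < pi / 2"
  shows "integrable lborel (\<lambda>t. \<bar>F t\<bar> * exp (\<beta> * t))"
  using integrable_abs[OF F_exp_integrable[OF assms]] by (simp add: abs_mult)

lemma F_abs_exp_abs_integrable:
  assumes "\<bar>\<beta>\<bar> < pi / 2"
  shows "integrable lborel (\<lambda>t. \<bar>F t\<bar> * exp (\<beta> * \<bar>t\<bar>))"
proof (rule Bochner_Integration.integrable_bound)
  show "integrable lborel (\<lambda>t. \<bar>F t\<bar> * exp (\<beta> * t) + \<bar>F t\<bar> * exp (- \<beta> * t))"
    using assms by (intro Bochner_Integration.integrable_add F_abs_exp_integrable) auto
  show "AE t in lborel. norm (\<bar>F t\<bar> * exp (\<beta> * \<bar>t\<bar>)) \<le> norm (\<bar>F t\<bar> * exp (\<beta> * t) + \<bar>F t\<bar> * exp (- \<beta> * t))"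
  proof (intro AE_I2)
    fix t
    have "0 \<le> \<bar>F t\<bar> * exp (\<beta> * t) + \<bar>F t\<bar> * exp (- \<beta> * t)" by simp
    then show "norm (\<bar>F t\<bar> * exp (\<beta> * \<bar>t\<bar>)) \<le> norm (\<bar>F t\<bar> * exp (\<beta> * t) + \<bar>F t\<bar> * exp (- \<beta> * t))"
      unfolding real_norm_def abs_of_nonneg[OF \<open>0 \<le> _\<close>] by (cases "t \<ge> 0") (simp_all add: abs_mult)
  qed
qed measurable

lemma F_abs_integrable: "integrable lborel (\<lambda>t. \<bar>F t\<bar>)"
  using F_abs_exp_integrable[of 0] by simp

section \<open>Pairing the kernel with \<open>J\<close>\<close>

text \<open>Parseval's identity: the kernel and the tilted \<open>F\<close> are both integrable, so
  the transform can be moved from \<open>F\<close> to the kernel.\<close>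

lemma kernel_J_fubini:
  assumes \<alpha>: "\<bar>\<alpha>\<bar> < pi / 2" and \<beta>: "Re \<beta> > 0"
  shows "(CLINT u|lborel. kernel \<beta> (1/2) u * J \<alpha> u) =
    (CLINT t|lborel. of_real (F t * exp (\<alpha> * t)) * (CLINT u|lborel. kernel \<beta> (1/2) u * iexp (- (u * t))))"
proof -
  define k where "k = kernel \<beta> (1/2)"
  have k: "integrable lborel k" unfolding k_def by (rule kernel_integral(1)[OF \<beta>]) simp
  have [measurable]: "k \<in> borel_measurable borel" unfolding k_def by measurable
  have Fi: "integrable lborel (\<lambda>t. F t * exp (\<alpha> * t))" by (rule F_exp_integrable[OF \<alpha>])
  define H where "H = (\<lambda>u t. k u * (complex_of_real (F t * exp (\<alpha> * t)) * iexp (- (u * t))))"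
  have "(CLINT u|lborel. k u * J \<alpha> u) = (CLINT u|lborel. CLINT t|lborel. H u t)"
    unfolding J_def H_def by (simp only: integral_mult_right_zero)
  also have "\<dots> = (CLINT t|lborel. CLINT u|lborel. H u t)"
  proof (rule lborel_pair.Fubini_integral [symmetric])
    have "integrable (lborel \<Otimes>\<^sub>M lborel) (\<lambda>(u, t). k u * complex_of_real (F t * exp (\<alpha> * t)))"
    proof (rule lborel_pair.Fubini_integrable)
      show "integrable lborel (\<lambda>u. LINT t|lborel. norm (case (u, t) of (u, t) \<Rightarrow> k u * complex_of_real (F t * exp (\<alpha> * t))))"
        using integrable_norm[OF k] by (simp add: norm_mult)
      show "AE u in lborel. integrable lborel (\<lambda>t. case (u, t) of (u, t) \<Rightarrow> k u * complex_of_real (F t * exp (\<alpha> * t)))"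
        unfolding prod.case by (intro AE_I2 integrable_mult_right integrable_of_real Fi)
    qed measurable
    then show "integrable (lborel \<Otimes>\<^sub>M lborel) (\<lambda>(u, t). H u t)"
      unfolding H_def by (rule Bochner_Integration.integrable_bound) (auto simp: norm_mult split: prod.splits)
  qed
  also have "\<dots> = (CLINT t|lborel. of_real (F t * exp (\<alpha> * t)) * (CLINT u|lborel. k u * iexp (- (u * t))))"
    unfolding H_def by (subst integral_mult_right_zero [symmetric]) (simp only: mult.left_commute)
  finally show ?thesis unfolding k_def .
qed

text \<open>The constant part of the weight leaves the integral of
  \<open>\<bar>F t\<bar> * exp (\<alpha> * t)\<close> with the sharp factor. The decaying part
  leaves an integral that does not depend on \<alpha> and so stays bounded as \<alpha> tends to
  \<open>pi / 2\<close>.\<close>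

lemma kernel_J_upper:
  assumes \<alpha>: "\<bar>\<alpha>\<bar> < pi / 2" and \<beta>: "Re \<beta> > 0" and L: "\<bar>Im \<beta>\<bar> \<le> L"
  shows "norm (CLINT u|lborel. kernel \<beta> (1/2) u * J \<alpha> u) \<le>
    sqrt (2 * pi) * (norm \<beta> powr (- (1/2)) * (LINT t|lborel. \<bar>F t\<bar> * exp (\<alpha> * t)) +
      (LINT t|lborel. \<bar>F t\<bar> * exp (arctan L * \<bar>t\<bar>)))"
proof -
  define g where "g t = sqrt (2 * pi) * (norm \<beta> powr (- (1/2)) * (\<bar>F t\<bar> * exp (\<alpha> * t)) + \<bar>F t\<bar> * exp (arctan L * \<bar>t\<bar>))" for t
  have aL: "\<bar>arctan L\<bar> < pi / 2" using arctan[of L] by linarith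
  have i1: "integrable lborel (\<lambda>t. \<bar>F t\<bar> * exp (\<alpha> * t))" by (rule F_abs_exp_integrable[OF \<alpha>])
  have i2: "integrable lborel (\<lambda>t. \<bar>F t\<bar> * exp (arctan L * \<bar>t\<bar>))" by (rule F_abs_exp_abs_integrable[OF aL])
  have g: "integrable lborel g"
    unfolding g_def[abs_def] by (intro integrable_mult_right Bochner_Integration.integrable_add i1 i2)
  have bd: "norm (of_real (F t * exp (\<alpha> * t)) * (CLINT u|lborel. kernel \<beta> (1/2) u * iexp (- (u * t)))) \<le> g t" for t
  proof -
    have "norm (of_real (F t * exp (\<alpha> * t)) * (CLINT u|lborel. kernel \<beta> (1/2) u * iexp (- (u * t)))) \<le>
        (\<bar>F t\<bar> * exp (\<alpha> * t)) * (sqrt (2 * pi) * (norm \<beta> powr (- (1/2)) + exp (- (pi / 2 - arctan L) * \<bar>t\<bar>)))"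
      unfolding norm_mult norm_of_real abs_mult abs_exp_cancel
      by (intro mult_left_mono norm_kernel_fourier_le \<beta> L) auto
    also have "\<dots> = sqrt (2 * pi) * (norm \<beta> powr (- (1/2)) * (\<bar>F t\<bar> * exp (\<alpha> * t)) +
        \<bar>F t\<bar> * (exp (\<alpha> * t) * exp (- (pi / 2 - arctan L) * \<bar>t\<bar>)))"
      by (simp add: algebra_simps)
    also have "\<dots> \<le> g t"
    proof -
      have "\<alpha> * t \<le> \<bar>\<alpha>\<bar> * \<bar>t\<bar>" by (metis abs_ge_self abs_mult)
      also have "\<dots> \<le> pi / 2 * \<bar>t\<bar>" using \<alpha> by (intro mult_right_mono) auto
      finally have "exp (\<alpha> * t) * exp (- (pi / 2 - arctan L) * \<bar>t\<bar>) \<le> exp (arctan L * \<bar>t\<bar>)"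
        by (simp add: algebra_simps flip: exp_add)
      then show ?thesis
        unfolding g_def by (intro mult_left_mono add_left_mono) auto
    qed
    finally show ?thesis .
  qed
  have "norm (CLINT u|lborel. kernel \<beta> (1/2) u * J \<alpha> u) \<le> (LINT t|lborel. g t)"
    unfolding kernel_J_fubini[OF \<alpha> \<beta>] by (rule norm_integral_le_dominating) (use g bd in auto)
  also have "\<dots> = sqrt (2 * pi) * (norm \<beta> powr (- (1/2)) * (LINT t|lborel. \<bar>F t\<bar> * exp (\<alpha> * t)) +
      (LINT t|lborel. \<bar>F t\<bar> * exp (arctan L * \<bar>t\<bar>)))"
    unfolding g_def using i1 i2 by (simp add: Bochner_Integration.integral_add)
  finally show ?thesis .
qed

text \<open>\<open>J_eq\<close> is inserted and the series expanded. The exponential of each term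
  shifts the kernel parameter from \<beta> to \<open>\<beta> + lam (Suc n) * cis \<alpha>\<close>,
  and \<open>z powr (r / 2)\<close> raises the exponent from \<open>1/2\<close> to \<open>p\<close>,
  so that each term is an explicit kernel integral. The residue term is only estimated.\<close>

lemma kernel_J_value:
  assumes \<alpha>: "\<bar>\<alpha>\<bar> < pi / 2" and \<beta>: "Re \<beta> > 0" and p: "p = (1 + r) / 2" and r: "r \<le> 2"
    and conv: "abs_conv_abscissa a lam < ereal (p + 1)"
  defines "D \<equiv> \<lambda>n. (\<beta> + lam (Suc n) * cis \<alpha>) powr (- of_real p) - (\<beta> + lam (Suc n) * cis \<alpha> + 1) powr (- of_real p)"
  shows "norm (CLINT u|lborel. kernel \<beta> (1/2) u * J \<alpha> u) \<ge>
    2 * pi * (Gamma p * norm (\<Sum>n. a (Suc n) * D n) - norm R * (sqrt pi * Re \<beta> powr (- (1/2))))"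
proof -
  define A where "A n = \<beta> + lam (Suc n) * cis \<alpha>" for n
  \<comment> \<open>The phase of \<open>z powr (r / 2)\<close>; its modulus is 1, so it disappears
    from the final norm.\<close>
  define E where "E = exp (\<i> * of_real (r * \<alpha> / 2))"
  have p0: "p > 0" using p r_pos by simp
  have q: "cos \<alpha> > 0" using \<alpha> by (intro cos_gt_zero_pi) auto
  have l: "lam (Suc n) > 0" for n by (rule lam_pos) simp
  have ReA: "Re (A n) = Re \<beta> + lam (Suc n) * cos \<alpha>" for n by (simp add: A_def)
  have ReA0: "Re (A n) > 0" for n unfolding ReA using \<beta> l[of n] q by (simp add: add_pos_pos)
  define f where "f n u = E * (a (Suc n) * kernel (A n) p u)" for n u
  have i1: "integrable lborel (f n)" for n
    unfolding f_def[abs_def] by (intro integrable_mult_right kernel_integral ReA0 p0)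
  have i2: "(CLINT u|lborel. f n u) = (E * of_real (Gamma p)) * (a (Suc n) * D n)" for n
    unfolding f_def by (simp add: kernel_integral(2)[OF ReA0 p0]) (simp add: D_def A_def)
  have nE: "norm E = 1" by (simp add: E_def)
  \<comment> \<open>The additional zero of the kernel gives the exponent \<open>p + 1\<close> in
    place of \<open>p\<close>, and at \<open>p + 1\<close> the Dirichlet series converges absolutely
    by \<open>conv\<close>.\<close>
  have nk: "norm (kernel (A n) p u) \<le> exp ((p + 1) * u - (lam (Suc n) * cos \<alpha>) * exp u)" for n u
  proof -
    have "(p + 1) * u - Re (A n) * exp u \<le> (p + 1) * u - (lam (Suc n) * cos \<alpha>) * exp u"
      using \<beta> by (simp add: ReA)
    then show ?thesis
      using norm_kernel_le[of 1 "A n" p u] by (metis exp_le_cancel_iff order_trans zero_le_one order_refl)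
  qed
  have nf: "norm (f n u) = norm (a (Suc n)) * norm (kernel (A n) p u)" for n u
    by (simp add: f_def norm_mult nE)
  have s1: "AE u in lborel. summable (\<lambda>n. norm (f n u))"
  proof (intro AE_I2)
    fix u :: real
    have "summable (\<lambda>n. exp ((p + 1) * u) * (norm (a (Suc n)) * exp (- lam (Suc n) * (cos \<alpha> * exp u))))"
      by (intro summable_mult exp_series_abs_summable) (use q in auto)
    then show "summable (\<lambda>n. norm (f n u))"
    proof (rule summable_comparison_test')
      fix n
      have "norm (f n u) \<le> norm (a (Suc n)) * exp ((p + 1) * u - (lam (Suc n) * cos \<alpha>) * exp u)"
        unfolding nf by (intro mult_left_mono nk) auto
      then show "norm (norm (f n u)) \<le> exp ((p + 1) * u) * (norm (a (Suc n)) * exp (- lam (Suc n) * (cos \<alpha> * exp u)))"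
        by (simp add: exp_diff exp_minus field_simps)
    qed
  qed
  have s2: "summable (\<lambda>n. LINT u|lborel. norm (f n u))"
  proof (rule summable_comparison_test')
    show "summable (\<lambda>n. (Gamma (p + 1) * cos \<alpha> powr (- (p + 1))) * (norm (a (Suc n)) * lam (Suc n) powr (- (p + 1))))"
      by (intro summable_mult summable_above_abscissa lam conv)
    fix n
    note G = real_Gamma_exp_integral[of "p + 1" "lam (Suc n) * cos \<alpha>"]
    have "(LINT u|lborel. norm (f n u)) \<le> (LINT u|lborel. norm (a (Suc n)) * exp ((p + 1) * u - (lam (Suc n) * cos \<alpha>) * exp u))"
    proof (rule integral_mono)
      show "integrable lborel (\<lambda>u. norm (f n u))" by (rule integrable_norm[OF i1])
      show "integrable lborel (\<lambda>u. norm (a (Suc n)) * exp ((p + 1) * u - (lam (Suc n) * cos \<alpha>) * exp u))"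
        by (intro integrable_mult_right G(1)) (use p0 l q in auto)
      show "norm (f n u) \<le> norm (a (Suc n)) * exp ((p + 1) * u - (lam (Suc n) * cos \<alpha>) * exp u)" for u
        unfolding nf by (intro mult_left_mono nk) auto
    qed
    also have "\<dots> = norm (a (Suc n)) * (Gamma (p + 1) * (lam (Suc n) * cos \<alpha>) powr (- (p + 1)))"
      using G(2) p0 l[of n] q by simp
    also have "\<dots> = (Gamma (p + 1) * cos \<alpha> powr (- (p + 1))) * (norm (a (Suc n)) * lam (Suc n) powr (- (p + 1)))"
      using l[of n] q by (simp add: powr_mult mult_ac)
    finally show "norm (LINT u|lborel. norm (f n u)) \<le> (Gamma (p + 1) * cos \<alpha> powr (- (p + 1))) * (norm (a (Suc n)) * lam (Suc n) powr (- (p + 1)))"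
      by (simp add: integral_nonneg_AE)
  qed
  define S where "S u = kernel \<beta> (1/2) u * (exp (r / 2 * Complex u \<alpha>) * exp_series a lam (exp (Complex u \<alpha>)))" for u
  have eC: "exp (Complex u \<alpha>) = of_real (exp u) * cis \<alpha>" for u
    by (simp add: complex_eq_iff Re_exp Im_exp)
  have fS: "(\<Sum>n. f n u) = S u" for u
  proof -
    have f_alt: "f n u = (kernel \<beta> (1/2) u * exp (r / 2 * Complex u \<alpha>)) * (a (Suc n) * exp (- complex_of_real (lam (Suc n)) * exp (Complex u \<alpha>)))" for n
    proof -
      have 1: "\<i> * of_real (r * \<alpha> / 2) + (of_real p * of_real u - (A n + x) * of_real (exp u)) =
         of_real (1/2) * of_real u - (\<beta> + x) * of_real (exp u) + (r / 2 * Complex u \<alpha> + (- complex_of_real (lam (Suc n)) * exp (Complex u \<alpha>)))" for x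
        unfolding eC by (simp add: complex_eq_iff A_def p algebra_simps add_divide_distrib)
      have "E * kernel (A n) p u = kernel \<beta> (1/2) u * (exp (r / 2 * Complex u \<alpha>) * exp (- complex_of_real (lam (Suc n)) * exp (Complex u \<alpha>)))"
      proof -
        have 2: "E * exp (of_real p * of_real u - (A n + x) * of_real (exp u)) =
            exp (of_real (1/2) * of_real u - (\<beta> + x) * of_real (exp u)) *
            (exp (r / 2 * Complex u \<alpha>) * exp (- complex_of_real (lam (Suc n)) * exp (Complex u \<alpha>)))" for x
          unfolding E_def exp_add [symmetric] 1 ..
        show ?thesis
          using 2[of 0] 2[of 1] by (simp only: kernel_def right_diff_distrib left_diff_distrib add_0_right)
      qed
      then show ?thesis by (simp add: f_def mult_ac)
    qed
    have "Re (exp (Complex u \<alpha>)) > 0" using q by (simp add: Re_exp)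
    then have "summable (\<lambda>n. a (Suc n) * exp (- complex_of_real (lam (Suc n)) * exp (Complex u \<alpha>)))"
      using exp_series_mellin(3) obtain_abscissa by metis
    then show ?thesis
      unfolding f_alt by (subst suminf_mult) (simp_all add: S_def exp_series_def mult_ac)
  qed
  have iS: "integrable lborel S"
    using integrable_suminf[OF i1 s1 s2] by (simp only: fS)
  have sS: "(\<lambda>n. (E * of_real (Gamma p)) * (a (Suc n) * D n)) sums (CLINT u|lborel. S u)"
    using sums_integral[OF i1 s1 s2] by (simp only: fS i2)
  have Gp: "Gamma p > 0" using p0 by (rule Gamma_real_pos)
  have nz: "E * complex_of_real (Gamma p) \<noteq> 0" using nE Gp by auto
  have "summable (\<lambda>n. a (Suc n) * D n)"
    using sums_summable[OF sS] nz summable_cmult_iff by blast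
  then have "(\<lambda>n. (E * of_real (Gamma p)) * (a (Suc n) * D n)) sums ((E * of_real (Gamma p)) * (\<Sum>n. a (Suc n) * D n))"
    by (intro sums_mult summable_sums)
  then have "(CLINT u|lborel. S u) = (E * of_real (Gamma p)) * (\<Sum>n. a (Suc n) * D n)"
    using sS by (rule sums_unique2[symmetric])
  then have nS: "norm (CLINT u|lborel. S u) = Gamma p * norm (\<Sum>n. a (Suc n) * D n)"
    using Gp by (simp add: norm_mult nE)
  \<comment> \<open>The residue term carries \<open>exp (- (r / 2) * u)\<close>. The zero of the
    kernel, used to the order \<open>r / 2 \<le> 1\<close>, cancels this factor and leaves a Gamma
    integral at \<open>1/2\<close>, hence \<open>sqrt pi\<close>.\<close>
  define P where "P u = R * (kernel \<beta> (1/2) u * exp (- (r / 2) * Complex u \<alpha>))" for u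
  have Pb: "norm (P u) \<le> norm R * exp (1/2 * u - Re \<beta> * exp u)" for u
  proof -
    have "norm (kernel \<beta> (1/2) u) \<le> exp ((1/2 + r/2) * u - Re \<beta> * exp u)"
      by (rule norm_kernel_le) (use r r_pos in auto)
    moreover have "norm (exp (- (r / 2) * Complex u \<alpha>)) = exp (- (r / 2) * u)"
      by (simp add: norm_exp_eq_Re)
    ultimately have "norm (P u) \<le> norm R * (exp ((1/2 + r/2) * u - Re \<beta> * exp u) * exp (- (r / 2) * u))"
      unfolding P_def norm_mult by (intro mult_left_mono mult_mono) auto
    also have "exp ((1/2 + r/2) * u - Re \<beta> * exp u) * exp (- (r / 2) * u) = exp (1/2 * u - Re \<beta> * exp u)"
      unfolding exp_add [symmetric] by (rule arg_cong[where f = exp]) (simp add: algebra_simps)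
    finally show ?thesis .
  qed
  have iG: "integrable lborel (\<lambda>u. norm R * exp (1/2 * u - Re \<beta> * exp u))"
    by (intro integrable_mult_right real_Gamma_exp_integral \<beta>) simp
  have iP: "integrable lborel P"
  proof (rule Bochner_Integration.integrable_bound[OF iG])
    show "P \<in> borel_measurable lborel"
      unfolding P_def[abs_def] Complex_eq by measurable
    show "AE u in lborel. norm (P u) \<le> norm (norm R * exp (1/2 * u - Re \<beta> * exp u))"
      using Pb by (intro AE_I2) simp
  qed
  have "norm (CLINT u|lborel. P u) \<le> (LINT u|lborel. norm R * exp (1/2 * u - Re \<beta> * exp u))"
    by (rule norm_integral_le_dominating) (use iG Pb in auto)
  also have "\<dots> = norm R * (sqrt pi * Re \<beta> powr (- (1/2)))"
    using real_Gamma_exp_integral(2)[of "1/2" "Re \<beta>"] \<beta> by (simp add: Gamma_one_half_real)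
  finally have nP: "norm (CLINT u|lborel. P u) \<le> norm R * (sqrt pi * Re \<beta> powr (- (1/2)))" .
  have "kernel \<beta> (1/2) u * J \<alpha> u = 2 * pi * (S u - P u)" for u
    unfolding J_eq[OF \<alpha>] S_def P_def by (simp add: algebra_simps)
  then have "(CLINT u|lborel. kernel \<beta> (1/2) u * J \<alpha> u) = 2 * pi * ((CLINT u|lborel. S u) - (CLINT u|lborel. P u))"
    using iS iP by simp
  then have "norm (CLINT u|lborel. kernel \<beta> (1/2) u * J \<alpha> u) = 2 * pi * norm ((CLINT u|lborel. S u) - (CLINT u|lborel. P u))"
    by (simp add: norm_mult)
  also have "\<dots> \<ge> 2 * pi * (norm (CLINT u|lborel. S u) - norm (CLINT u|lborel. P u))"
    by (intro mult_left_mono norm_triangle_ineq2) auto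
  finally show ?thesis
    using nS nP by (smt (verit, best) mult_left_mono pi_gt_zero)
qed

section \<open>Consequences of a constant argument and of a constant sign\<close>

text \<open>The modulus of the series is at most the sum of the absolute values, which depends on
  \<open>Re z\<close> only. As the coefficients have constant argument, that sum is attained at the
  real point \<open>Re z\<close>.\<close>

lemma norm_exp_series_le:
  assumes arg: "\<forall>n\<ge>1. a n = of_real (norm (a n)) * exp (\<i> * of_real \<theta>)" and z: "Re z > 0"
  shows "norm (exp_series a lam z) \<le> norm (exp_series a lam (of_real (Re z)))"
proof -
  define b where "b n = norm (a (Suc n)) * exp (- lam (Suc n) * Re z)" for n
  have b: "summable b" unfolding b_def[abs_def] by (rule exp_series_abs_summable[OF z])
  have nb: "norm (a (Suc n) * exp (- complex_of_real (lam (Suc n)) * z)) = b n" for n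
    by (simp add: b_def norm_mult norm_exp_eq_Re)
  have "norm (exp_series a lam z) \<le> (\<Sum>n. norm (a (Suc n) * exp (- complex_of_real (lam (Suc n)) * z)))"
    unfolding exp_series_def by (rule summable_norm) (simp only: nb b)
  then have "norm (exp_series a lam z) \<le> suminf b" by (simp only: nb)
  moreover have "exp_series a lam (of_real (Re z)) = exp (\<i> * of_real \<theta>) * of_real (suminf b)"
  proof -
    have "a (Suc n) * exp (- complex_of_real (lam (Suc n)) * of_real (Re z)) = exp (\<i> * of_real \<theta>) * of_real (b n)" for n
    proof -
      have "a (Suc n) = of_real (norm (a (Suc n))) * exp (\<i> * of_real \<theta>)" using arg by simp
      then show ?thesis by (simp add: b_def exp_of_real [symmetric]) (metis mult.commute)
    qed
    then show ?thesis
      unfolding exp_series_def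
      by (simp only: suminf_mult[OF summable_of_real[OF b]] suminf_of_real[OF b])
  qed
  moreover have "suminf b \<ge> 0" by (rule suminf_nonneg[OF b]) (simp add: b_def)
  ultimately show ?thesis by (simp add: norm_mult)
qed

text \<open>The case \<alpha> = 0, \<open>u = ln q\<close> of \<open>J_eq\<close>, where
  \<open>J\<close> is bounded by the integral of \<open>\<bar>F t\<bar>\<close>.\<close>

lemma norm_exp_series_real_le:
  assumes q: "q > 0"
  shows "norm (exp_series a lam (of_real q)) \<le>
    norm R * q powr (- r) + (LINT t|lborel. \<bar>F t\<bar>) / (2 * pi) * q powr (- (r / 2))"
proof -
  define N where "N = (LINT t|lborel. \<bar>F t\<bar>)"
  have J: "J 0 (ln q) = 2 * pi * (of_real (q powr (r / 2)) * exp_series a lam (of_real q) - R * of_real (q powr (- (r / 2))))"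
  proof -
    have C: "Complex (ln q) 0 = of_real (ln q)" by (simp add: complex_eq_iff)
    have "exp (complex_of_real x * of_real (ln q)) = of_real (q powr x)" for x
      using q by (simp add: powr_def exp_of_real [symmetric])
    from this[of "r / 2"] this[of "- (r / 2)"] show ?thesis
      using J_eq[of 0 "ln q"] q unfolding C by (simp add: exp_of_real)
  qed
  have "norm (J 0 (ln q)) \<le> N"
    unfolding J_def N_def by (rule norm_integral_le_dominating) (use F_abs_integrable in \<open>auto simp: norm_mult\<close>)
  moreover have "2 * pi * (q powr (r / 2) * norm (exp_series a lam (of_real q)) - norm R * q powr (- (r / 2))) \<le> norm (J 0 (ln q))"
  proof -
    have "norm (complex_of_real (2 * pi)) = 2 * pi" by simp
    moreover have "q powr (r / 2) * norm (exp_series a lam (of_real q)) - norm R * q powr (- (r / 2)) \<le>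
        norm (of_real (q powr (r / 2)) * exp_series a lam (of_real q) - R * of_real (q powr (- (r / 2))))"
      using norm_triangle_ineq2[of "of_real (q powr (r / 2)) * exp_series a lam (of_real q)" "R * of_real (q powr (- (r / 2)))"]
      by (simp add: norm_mult)
    ultimately show ?thesis unfolding J norm_mult[of "complex_of_real (2 * pi)"] by (simp add: mult_left_mono)
  qed
  ultimately have "2 * pi * (q powr (r / 2) * norm (exp_series a lam (of_real q)) - norm R * q powr (- (r / 2))) \<le> N"
    by simp
  then have "q powr (r / 2) * norm (exp_series a lam (of_real q)) \<le> N / (2 * pi) + norm R * q powr (- (r / 2))"
    by (simp add: field_simps)
  then have "q powr (- (r / 2)) * (q powr (r / 2) * norm (exp_series a lam (of_real q))) \<le>
      q powr (- (r / 2)) * (N / (2 * pi) + norm R * q powr (- (r / 2)))"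
    by (intro mult_left_mono) auto
  also have "\<dots> = norm R * (q powr (- (r / 2)) * q powr (- (r / 2))) + N / (2 * pi) * q powr (- (r / 2))"
    by (simp add: algebra_simps)
  also have "q powr (- (r / 2)) * q powr (- (r / 2)) = q powr (- r)"
    by (simp flip: powr_add)
  also have "q powr (- (r / 2)) * (q powr (r / 2) * norm (exp_series a lam (of_real q))) = norm (exp_series a lam (of_real q))"
    using q by (simp add: powr_minus)
  finally show ?thesis
    unfolding N_def .
qed

text \<open>Beyond \<open>T\<close> the absolute value of \<open>F\<close> is \<open>s * F\<close>,
  so up to a bounded error the integral is \<open>s * J \<alpha> 0\<close>, which
  \<open>J_eq\<close> expresses by the exponential series at \<open>cis \<alpha>\<close>. As
  \<open>Re (cis \<alpha>) = cos \<alpha>\<close>, the bound on the real axis then applies.\<close>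

lemma F_weighted_norm_le:
  assumes arg: "\<forall>n\<ge>1. a n = of_real (norm (a n)) * exp (\<i> * of_real \<theta>)"
    and sign: "s = 1 \<or> s = -1" "\<And>t. t \<ge> T \<Longrightarrow> s * F t \<ge> 0" and T: "T \<ge> 0"
    and \<alpha>: "0 \<le> \<alpha>" "\<alpha> < pi / 2"
  defines "N \<equiv> LINT t|lborel. \<bar>F t\<bar>"
  shows "(LINT t|lborel. \<bar>F t\<bar> * exp (\<alpha> * t)) \<le>
    2 * pi * norm R * cos \<alpha> powr (- r) + N * cos \<alpha> powr (- (r / 2)) + (2 * pi * norm R + 2 * exp (pi / 2 * T) * N)"
proof -
  have \<alpha>': "\<bar>\<alpha>\<bar> < pi / 2" using \<alpha> by simp
  have q: "cos \<alpha> > 0" using \<alpha>' by (intro cos_gt_zero_pi) auto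
  note i = F_exp_integrable[OF \<alpha>'] F_abs_exp_integrable[OF \<alpha>'] F_abs_integrable
  \<comment> \<open>For \<open>t < T\<close>, including all negative \<open>t\<close>, both
    \<open>\<bar>F t\<bar> * exp (\<alpha> * t)\<close> and
    \<open>- (s * (F t * exp (\<alpha> * t)))\<close> are at most
    \<open>exp (pi / 2 * T) * \<bar>F t\<bar>\<close>; hence the factor 2.\<close>
  have le: "\<bar>F t\<bar> * exp (\<alpha> * t) \<le> s * (F t * exp (\<alpha> * t)) + 2 * exp (pi / 2 * T) * \<bar>F t\<bar>" for t
  proof (cases "t \<ge> T")
    case True
    then have "\<bar>F t\<bar> = s * F t" using sign(1) sign(2)[OF True] by auto
    then have "\<bar>F t\<bar> * exp (\<alpha> * t) = s * (F t * exp (\<alpha> * t))" by simp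
    then show ?thesis by simp
  next
    case False
    have "\<alpha> * t \<le> \<alpha> * T" using False \<alpha> by (intro mult_left_mono) auto
    also have "\<dots> \<le> pi / 2 * T" using \<alpha> T by (intro mult_right_mono) auto
    finally have "\<bar>F t\<bar> * exp (\<alpha> * t) \<le> \<bar>F t\<bar> * exp (pi / 2 * T)" by (intro mult_left_mono) auto
    moreover have "- (s * (F t * exp (\<alpha> * t))) \<le> \<bar>F t\<bar> * exp (\<alpha> * t)"
    proof -
      have "- (s * F t) \<le> \<bar>F t\<bar>" using sign(1) by auto
      then have "- (s * F t) * exp (\<alpha> * t) \<le> \<bar>F t\<bar> * exp (\<alpha> * t)" by (rule mult_right_mono) simp
      then show ?thesis by (simp add: mult.assoc)
    qed
    ultimately show ?thesis by (simp add: mult_ac)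
  qed
  have "(LINT t|lborel. \<bar>F t\<bar> * exp (\<alpha> * t)) \<le>
      (LINT t|lborel. s * (F t * exp (\<alpha> * t)) + 2 * exp (pi / 2 * T) * \<bar>F t\<bar>)"
    by (intro integral_mono le i Bochner_Integration.integrable_add integrable_mult_right)
  also have "\<dots> = s * (LINT t|lborel. F t * exp (\<alpha> * t)) + 2 * exp (pi / 2 * T) * N"
    using i by (simp add: N_def)
  also have "s * (LINT t|lborel. F t * exp (\<alpha> * t)) \<le> norm (J \<alpha> 0)"
  proof -
    have "J \<alpha> 0 = (CLINT t|lborel. complex_of_real (F t * exp (\<alpha> * t)))"
      unfolding J_def by simp
    also have "\<dots> = of_real (LINT t|lborel. F t * exp (\<alpha> * t))" by (rule integral_complex_of_real)
    finally show ?thesis using sign(1) by (auto simp: norm_of_real)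
  qed
  also have "norm (J \<alpha> 0) \<le> 2 * pi * (norm (exp_series a lam (cis \<alpha>)) + norm R)"
  proof -
    have C: "exp (Complex 0 \<alpha>) = cis \<alpha>" by (simp add: complex_eq_iff Re_exp Im_exp)
    have n: "norm (exp (of_real x * Complex 0 \<alpha>)) = 1" for x by (simp add: norm_exp_eq_Re)
    show ?thesis
      unfolding J_eq[OF \<alpha>'] C norm_mult
      using n[of "r / 2"] n[of "- (r / 2)"]
      by (intro mult_mono order.trans[OF norm_triangle_ineq4]) (auto simp: norm_mult)
  qed
  also have "norm (exp_series a lam (cis \<alpha>)) \<le> norm R * cos \<alpha> powr (- r) + N / (2 * pi) * cos \<alpha> powr (- (r / 2))"
    using norm_exp_series_le[OF arg, of "cis \<alpha>"] norm_exp_series_real_le[OF q] q by (simp add: N_def)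
  finally have "(LINT t|lborel. \<bar>F t\<bar> * exp (\<alpha> * t)) \<le>
    2 * pi * (norm R * cos \<alpha> powr (- r) + N / (2 * pi) * cos \<alpha> powr (- (r / 2)) + norm R) + 2 * exp (pi / 2 * T) * N"
    by simp
  then show ?thesis by (simp add: algebra_simps)
qed

section \<open>The resonant term and the limit towards the imaginary axis\<close>

text \<open>For this kernel the parameter of term \<open>m\<close> is the real number
  \<open>\<eta> + lam (Suc m) * cos \<alpha>\<close>, so the term grows like its power
  \<open>- p\<close> when \<eta> and \<open>cos \<alpha>\<close> tend to 0. The other parameters
  keep at least the distance \<open>\<bar>lam (Suc n) - lam (Suc m)\<bar> / 2\<close> from 0, so
  their sum is bounded by a constant \<open>K\<close> free of \<alpha> and \<eta>.\<close>

lemma kernel_J_lower: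
  assumes p: "p = (1 + r) / 2" and r: "r \<le> 2" and conv: "abs_conv_abscissa a lam < ereal (p + 1)"
  obtains K where "\<And>\<alpha> \<eta>. 0 \<le> \<alpha> \<Longrightarrow> \<alpha> < pi / 2 \<Longrightarrow> sin \<alpha> \<ge> 1 / 2 \<Longrightarrow> \<eta> > 0 \<Longrightarrow>
    2 * pi * (Gamma p * (norm (a (Suc m)) * ((\<eta> + lam (Suc m) * cos \<alpha>) powr (- p) - 1) - K) -
      norm R * (sqrt pi * \<eta> powr (- (1/2))))
    \<le> norm (CLINT u|lborel. kernel (Complex \<eta> (- lam (Suc m) * sin \<alpha>)) (1/2) u * J \<alpha> u)"
proof -
  define l where "l = lam (Suc m)"
  have l: "l > 0" unfolding l_def by (rule lam_pos) simp
  have p0: "p > 0" using p r_pos by simp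
  \<comment> \<open>The exponent \<open>- p - 1\<close> is the gain from
    \<open>norm_powr_diff_le\<close>, and the half is the lower bound of
    \<open>sin \<alpha>\<close>. At \<open>n = m\<close> the value is 0, since
    \<open>0 powr x = 0\<close>; that term is treated apart.\<close>
  define v where "v n = p * (norm (a (Suc n)) * (\<bar>lam (Suc n) - l\<bar> / 2) powr (- p - 1))" for n
  have sv: "summable v"
  proof -
    have "filterlim lam at_top sequentially" using lam by (simp add: exponent_seq_def)
    then have "filterlim (\<lambda>n. lam (Suc n)) at_top sequentially" by (rule filterlim_compose[OF _ filterlim_Suc])
    \<comment> \<open>From \<open>lam (Suc n) \<ge> 2 * l\<close> on,
      \<open>\<bar>lam (Suc n) - l\<bar> / 2\<close> is at least a quarter of
      \<open>lam (Suc n)\<close>, which allows comparison with the Dirichlet series at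
      \<open>p + 1\<close>.\<close>
    then have "eventually (\<lambda>n. lam (Suc n) \<ge> 2 * l) sequentially" by (simp add: filterlim_at_top)
    then have ev: "eventually (\<lambda>n. norm (v n) \<le> (p * (1/4) powr (- p - 1)) * (norm (a (Suc n)) * lam (Suc n) powr (- (p + 1)))) sequentially"
    proof eventually_elim
      case (elim n)
      have "(\<bar>lam (Suc n) - l\<bar> / 2) powr (- p - 1) \<le> (1/4 * lam (Suc n)) powr (- p - 1)"
        by (rule powr_mono2') (use elim l p0 in auto)
      also have "\<dots> = (1/4) powr (- p - 1) * lam (Suc n) powr (- (p + 1))"
        using elim l by (subst powr_mult) auto
      finally have "norm (v n) \<le> p * (norm (a (Suc n)) * ((1/4) powr (- p - 1) * lam (Suc n) powr (- (p + 1))))"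
        unfolding v_def using p0 by (simp add: abs_mult mult_left_mono)
      then show ?case by (simp add: mult_ac)
    qed
    show ?thesis
      by (rule summable_comparison_test_ev[OF ev]) (intro summable_mult summable_above_abscissa lam conv)
  qed
  have main: "2 * pi * (Gamma p * (norm (a (Suc m)) * ((\<eta> + l * cos \<alpha>) powr (- p) - 1) - suminf v) -
      norm R * (sqrt pi * \<eta> powr (- (1/2))))
    \<le> norm (CLINT u|lborel. kernel (Complex \<eta> (- l * sin \<alpha>)) (1/2) u * J \<alpha> u)"
    if \<alpha>: "0 \<le> \<alpha>" "\<alpha> < pi / 2" "sin \<alpha> \<ge> 1 / 2" and \<eta>: "\<eta> > 0" for \<alpha> \<eta>
  proof -
    (* The shift is chosen such that \<beta> + \<lambda>\<^sub>n cis \<alpha> is small and positive for n = Suc m. *)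
    define \<beta> where "\<beta> = Complex \<eta> (- l * sin \<alpha>)"
    have \<alpha>': "\<bar>\<alpha>\<bar> < pi / 2" using \<alpha> by simp
    have q: "cos \<alpha> > 0" using \<alpha>' by (intro cos_gt_zero_pi) auto
    have \<beta>: "Re \<beta> > 0" using \<eta> by (simp add: \<beta>_def)
    define A where "A n = \<beta> + lam (Suc n) * cis \<alpha>" for n
    define D where "D n = A n powr (- of_real p) - (A n + 1) powr (- of_real p)" for n
    note K = kernel_J_value[OF \<alpha>' \<beta> p r conv, folded A_def, folded D_def]
    have ReA: "Re (A n) > 0" for n
      using \<eta> q lam_pos[of "Suc n"] by (simp add: A_def \<beta>_def add_pos_pos)
    have ImA: "Im (A n) = (lam (Suc n) - l) * sin \<alpha>" for n
      by (simp add: A_def \<beta>_def algebra_simps)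
    have Dn: "norm (a (Suc n) * D n) \<le> v n" if "n \<noteq> m" for n
    proof -
      have ne: "lam (Suc n) \<noteq> l"
      proof -
        have "inj_on lam {1..}"
          using lam by (auto simp: exponent_seq_def intro: strict_mono_on_imp_inj_on)
        then show ?thesis using that by (auto simp: l_def inj_on_def)
      qed
      have "\<bar>lam (Suc n) - l\<bar> / 2 \<le> \<bar>Im (A n)\<bar>"
        using mult_left_mono[OF \<alpha>(3), of "\<bar>lam (Suc n) - l\<bar>"] \<alpha>(3) by (simp add: ImA abs_mult)
      also have "\<dots> \<le> norm (A n)" by (rule abs_Im_le_cmod)
      finally have "norm (A n) powr (- p - 1) \<le> (\<bar>lam (Suc n) - l\<bar> / 2) powr (- p - 1)"
        using ne p0 by (intro powr_mono2') auto
      then have "norm (D n) \<le> p * (\<bar>lam (Suc n) - l\<bar> / 2) powr (- p - 1)"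
        unfolding D_def using p0 by (intro order.trans[OF norm_powr_diff_le[OF ReA p0]] mult_left_mono) auto
      then have "norm (a (Suc n)) * norm (D n) \<le> norm (a (Suc n)) * (p * (\<bar>lam (Suc n) - l\<bar> / 2) powr (- p - 1))"
        by (intro mult_left_mono) auto
      then show ?thesis by (simp add: v_def norm_mult mult_ac)
    qed
    have v0: "v n \<ge> 0" for n using p0 by (simp add: v_def)
    define w where "w n = (if n = m then 0 else a (Suc n) * D n)" for n
    have wv: "norm (w n) \<le> v n" for n using Dn v0 by (simp add: w_def)
    have sw: "summable (\<lambda>n. norm (w n))"
      by (rule summable_comparison_test'[OF sv]) (use wv in auto)
    have "(\<lambda>n. w n + (if n = m then a (Suc m) * D m else 0)) sums (suminf w + a (Suc m) * D m)"
      by (intro sums_add summable_sums summable_norm_cancel[OF sw]) (rule sums_single[of m "\<lambda>n. a (Suc m) * D m"])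
    moreover have "w n + (if n = m then a (Suc m) * D m else 0) = a (Suc n) * D n" for n by (simp add: w_def)
    ultimately have sum: "(\<Sum>n. a (Suc n) * D n) = suminf w + a (Suc m) * D m"
      by (simp add: sums_iff)
    have "norm (suminf w) \<le> (\<Sum>n. norm (w n))" by (rule summable_norm[OF sw])
    also have "\<dots> \<le> suminf v" by (rule suminf_le[OF wv sw sv])
    finally have nw: "norm (suminf w) \<le> suminf v" .
    define x where "x = \<eta> + l * cos \<alpha>"
    have x: "x > 0" using \<eta> l q by (simp add: x_def add_pos_pos)
    have "A m = of_real x" by (simp add: A_def \<beta>_def x_def l_def complex_eq_iff)
    then have "D m = of_real (x powr (- p) - (x + 1) powr (- p))"
      using x powr_of_real[of x "- p"] powr_of_real[of "x + 1" "- p"] by (simp add: D_def)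
    \<comment> \<open>The subtracted part of the kernel costs at most 1 here, which is the
      \<open>- 1\<close> in the conclusion.\<close>
    moreover have "(x + 1) powr (- p) \<le> 1"
      using powr_mono[of "- p" 0 "x + 1"] x p0 by auto
    ultimately have "norm (D m) \<ge> x powr (- p) - 1" by (simp del: of_real_diff)
    then have "norm (a (Suc m)) * (x powr (- p) - 1) \<le> norm (a (Suc m) * D m)"
      unfolding norm_mult by (intro mult_left_mono) auto
    also have "\<dots> \<le> norm (suminf w + a (Suc m) * D m) + norm (suminf w)"
      by (metis add_diff_cancel_left' norm_triangle_ineq4)
    finally have "norm (a (Suc m)) * (x powr (- p) - 1) - suminf v \<le> norm (\<Sum>n. a (Suc n) * D n)"
      unfolding sum using nw by linarith
    then have "Gamma p * (norm (a (Suc m)) * (x powr (- p) - 1) - suminf v) \<le> Gamma p * norm (\<Sum>n. a (Suc n) * D n)"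
      by (intro mult_left_mono) (use p0 in \<open>auto intro: less_imp_le Gamma_real_pos\<close>)
    then have "2 * pi * (Gamma p * (norm (a (Suc m)) * (x powr (- p) - 1) - suminf v) - norm R * (sqrt pi * \<eta> powr (- (1/2))))
       \<le> 2 * pi * (Gamma p * norm (\<Sum>n. a (Suc n) * D n) - norm R * (sqrt pi * Re \<beta> powr (- (1/2))))"
      by (simp add: \<beta>_def)
    also have "\<dots> \<le> norm (CLINT u|lborel. kernel \<beta> (1/2) u * J \<alpha> u)" by (rule K)
    finally show ?thesis by (simp only: \<beta>_def x_def)
  qed
  show ?thesis by (rule that[of "suminf v"]) (use main in \<open>simp only: l_def\<close>)
qed

text \<open>The two bounds for the pairing are put together with \<open>q = cos \<alpha>\<close>.
  The constants depend on neither \<open>q\<close> nor \<eta>, so both can later tend to 0.\<close>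

lemma sign_change_inequality:
  assumes arg: "\<forall>n\<ge>1. a n = of_real (norm (a n)) * exp (\<i> * of_real \<theta>)"
    and sign: "s = 1 \<or> s = -1" "\<And>t. t \<ge> T \<Longrightarrow> s * F t \<ge> 0" and T: "T \<ge> 0"
    and p: "p = (1 + r) / 2" and r: "r \<le> 2" and conv: "abs_conv_abscissa a lam < ereal (p + 1)"
  obtains K1 K2 K3 K4 where
    "\<And>q \<eta>. 0 < q \<Longrightarrow> q \<le> 1 / 2 \<Longrightarrow> \<eta> > 0 \<Longrightarrow>
      2 * pi * (Gamma p * (norm (a (Suc m)) * ((\<eta> + lam (Suc m) * q) powr (- p) - 1) - K1) -
      norm R * (sqrt pi * \<eta> powr (- (1/2)))) \<le>
      sqrt (2 * pi) * ((lam (Suc m) * sqrt (1 - q\<^sup>2)) powr (- (1/2)) *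
        (2 * pi * norm R * q powr (- r) + K2 * q powr (- (r / 2)) + K3) + K4)"
proof -
  define l where "l = lam (Suc m)"
  have l: "l > 0" unfolding l_def by (rule lam_pos) simp
  obtain K1 where K1: "\<And>\<alpha> \<eta>. 0 \<le> \<alpha> \<Longrightarrow> \<alpha> < pi / 2 \<Longrightarrow> sin \<alpha> \<ge> 1 / 2 \<Longrightarrow> \<eta> > 0 \<Longrightarrow>
    2 * pi * (Gamma p * (norm (a (Suc m)) * ((\<eta> + l * cos \<alpha>) powr (- p) - 1) - K1) -
      norm R * (sqrt pi * \<eta> powr (- (1/2))))
    \<le> norm (CLINT u|lborel. kernel (Complex \<eta> (- l * sin \<alpha>)) (1/2) u * J \<alpha> u)"
    using kernel_J_lower[OF p r conv, of m] unfolding l_def by blast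
  define K2 where "K2 = (LINT t|lborel. \<bar>F t\<bar>)"
  define K3 where "K3 = 2 * pi * norm R + 2 * exp (pi / 2 * T) * K2"
  \<comment> \<open>The choice \<open>L = l\<close> works for every \<alpha>, since
    \<open>\<bar>Im \<beta>\<bar> = l * sin \<alpha> \<le> l\<close>.\<close>
  define K4 where "K4 = (LINT t|lborel. \<bar>F t\<bar> * exp (arctan l * \<bar>t\<bar>))"
  have "2 * pi * (Gamma p * (norm (a (Suc m)) * ((\<eta> + l * q) powr (- p) - 1) - K1) -
      norm R * (sqrt pi * \<eta> powr (- (1/2)))) \<le>
      sqrt (2 * pi) * ((l * sqrt (1 - q\<^sup>2)) powr (- (1/2)) *
        (2 * pi * norm R * q powr (- r) + K2 * q powr (- (r / 2)) + K3) + K4)"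
    if q: "0 < q" "q \<le> 1 / 2" and \<eta>: "\<eta> > 0" for q \<eta>
  proof -
    define \<alpha> where "\<alpha> = arccos q"
    have cos: "cos \<alpha> = q" and sin: "sin \<alpha> = sqrt (1 - q\<^sup>2)"
      using q by (auto simp: \<alpha>_def cos_arccos sin_arccos)
    have \<alpha>: "0 \<le> \<alpha>" "\<alpha> < pi / 2"
    proof -
      show "0 \<le> \<alpha>" unfolding \<alpha>_def using q by (intro arccos_lbound) auto
      have "arccos q < arccos 0" by (rule arccos_less_arccos) (use q in auto)
      then show "\<alpha> < pi / 2" by (simp add: \<alpha>_def)
    qed
    have sin2: "sin \<alpha> \<ge> 1 / 2"
    proof -
      have "q\<^sup>2 \<le> (1/2)\<^sup>2" using q by (intro power_mono) auto
      then show ?thesis unfolding sin by (intro real_le_rsqrt) (simp add: power2_eq_square)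
    qed
    define \<beta> where "\<beta> = Complex \<eta> (- l * sin \<alpha>)"
    have n\<beta>: "l * sin \<alpha> \<le> norm \<beta>"
      using abs_Im_le_cmod[of \<beta>] l sin2 by (simp add: \<beta>_def abs_mult)
    have Im\<beta>: "\<bar>Im \<beta>\<bar> \<le> l"
      using l sin2 sin_le_one[of \<alpha>] by (simp add: \<beta>_def abs_mult)
    have "2 * pi * (Gamma p * (norm (a (Suc m)) * ((\<eta> + l * q) powr (- p) - 1) - K1) -
      norm R * (sqrt pi * \<eta> powr (- (1/2)))) \<le> norm (CLINT u|lborel. kernel \<beta> (1/2) u * J \<alpha> u)"
      using K1[OF \<alpha> sin2 \<eta>] by (simp only: cos \<beta>_def)
    also have "\<dots> \<le> sqrt (2 * pi) * (norm \<beta> powr (- (1/2)) * (LINT t|lborel. \<bar>F t\<bar> * exp (\<alpha> * t)) + K4)"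
      unfolding K4_def by (rule kernel_J_upper) (use \<alpha> \<eta> Im\<beta> in \<open>auto simp: \<beta>_def\<close>)
    also have "\<dots> \<le> sqrt (2 * pi) * ((l * sin \<alpha>) powr (- (1/2)) *
        (2 * pi * norm R * q powr (- r) + K2 * q powr (- (r / 2)) + K3) + K4)"
    proof (intro mult_left_mono add_right_mono mult_mono)
      show "norm \<beta> powr (- (1/2)) \<le> (l * sin \<alpha>) powr (- (1/2))"
        using n\<beta> l sin2 by (intro powr_mono2') auto
      show "(LINT t|lborel. \<bar>F t\<bar> * exp (\<alpha> * t)) \<le> 2 * pi * norm R * q powr (- r) + K2 * q powr (- (r / 2)) + K3"
        using F_weighted_norm_le[OF arg sign T \<alpha>] by (simp only: cos K2_def K3_def)
    qed (auto intro!: integral_nonneg_AE)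
    finally show ?thesis by (simp only: sin)
  qed
  then show ?thesis unfolding l_def by (rule that)
qed

text \<open>Both sides are multiplied by \<open>q powr p\<close>, and \<open>q\<close> tends to 0.
  The resonant term has order \<open>q powr (- p)\<close>, the upper bound at most order
  \<open>q powr (- r)\<close>; as \<open>p > r\<close> for \<open>r < 1\<close> and
  \<open>p = r\<close> for \<open>r = 1\<close>, the residue survives in the limit only if
  \<open>r = 1\<close>.\<close>

lemma coefficient_bound:
  assumes arg: "\<forall>n\<ge>1. a n = of_real (norm (a n)) * exp (\<i> * of_real \<theta>)"
    and sign: "s = 1 \<or> s = -1" "\<And>t. t \<ge> T \<Longrightarrow> s * F t \<ge> 0" and T: "T \<ge> 0"
    and p: "p = (1 + r) / 2" and r: "r \<le> 1" and conv: "abs_conv_abscissa a lam < ereal (p + 1)"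
  shows "Gamma p * norm (a (Suc m)) * lam (Suc m) powr (- p) \<le>
    (if r = 1 then sqrt (2 * pi) * lam (Suc m) powr (- (1/2)) * norm R else 0)"
proof -
  define l where "l = lam (Suc m)"
  have l: "l > 0" unfolding l_def by (rule lam_pos) simp
  have p0: "p > 0" using p r_pos by simp
  have r2: "r \<le> 2" using r by simp
  obtain K1 K2 K3 K4 where K:
    "\<And>q \<eta>. 0 < q \<Longrightarrow> q \<le> 1 / 2 \<Longrightarrow> \<eta> > 0 \<Longrightarrow>
      2 * pi * (Gamma p * (norm (a (Suc m)) * ((\<eta> + l * q) powr (- p) - 1) - K1) -
      norm R * (sqrt pi * \<eta> powr (- (1/2)))) \<le>
      sqrt (2 * pi) * ((l * sqrt (1 - q\<^sup>2)) powr (- (1/2)) *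
        (2 * pi * norm R * q powr (- r) + K2 * q powr (- (r / 2)) + K3) + K4)"
    using sign_change_inequality[OF arg sign T p r2 conv, of m] unfolding l_def by blast
  \<comment> \<open>The limit of \<open>q powr ((1 - r) / 2)\<close>, the factor left from
    \<open>q powr (- r) * q powr p\<close>.\<close>
  define e :: real where "e = (if r = 1 then 1 else 0)"
  \<comment> \<open>\<open>f\<close> and \<open>g\<close> are the two sides of \<open>K\<close>
    times \<open>q powr p\<close>, with \<eta> already replaced by
    \<open>q powr (1 + r / 2)\<close>.\<close>
  define f where "f q = 2 * pi * (Gamma p * (norm (a (Suc m)) * ((q powr (r / 2) + l) powr (- p) - q powr p) - K1 * q powr p) -
      norm R * (sqrt pi * q powr (r / 4)))" for q
  define g where "g q = sqrt (2 * pi) * ((l * sqrt (1 - q\<^sup>2)) powr (- (1/2)) *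
      (2 * pi * norm R * q powr ((1 - r) / 2) + K2 * q powr (1 / 2) + K3 * q powr p) + K4 * q powr p)" for q
  have fg: "f q \<le> g q" if q: "0 < q" "q \<le> 1 / 2" for q
  proof -
    (* \<eta> = o(q), but still \<eta> powr (-1/2) = o(q powr -p) *)
    define \<eta> where "\<eta> = q powr (1 + r / 2)"
    have \<eta>: "\<eta> > 0" using q by (simp add: \<eta>_def)
    have e1: "(\<eta> + l * q) powr (- p) * q powr p = (q powr (r / 2) + l) powr (- p)"
    proof -
      have "\<eta> + l * q = (q powr (r / 2) + l) * q" using q by (simp add: \<eta>_def powr_add algebra_simps)
      then have "(\<eta> + l * q) powr (- p) * q powr p = (q powr (r / 2) + l) powr (- p) * (q powr (- p) * q powr p)"
        using q l by (simp only: powr_mult)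
      also have "q powr (- p) * q powr p = 1" using q by (simp flip: powr_add)
      finally show ?thesis by simp
    qed
    have e2: "\<eta> powr (- (1/2)) * q powr p = q powr (r / 4)"
      using q by (simp add: \<eta>_def powr_powr p flip: powr_add) (simp add: field_simps)
    have e3: "q powr (- r) * q powr p = q powr ((1 - r) / 2)" "q powr (- (r / 2)) * q powr p = q powr (1 / 2)"
      unfolding powr_add [symmetric] p by (simp_all add: field_simps)
    have "2 * pi * (Gamma p * (norm (a (Suc m)) * ((\<eta> + l * q) powr (- p) - 1) - K1) -
        norm R * (sqrt pi * \<eta> powr (- (1/2)))) * q powr p \<le>
      sqrt (2 * pi) * ((l * sqrt (1 - q\<^sup>2)) powr (- (1/2)) *
        (2 * pi * norm R * q powr (- r) + K2 * q powr (- (r / 2)) + K3) + K4) * q powr p"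
      by (intro mult_right_mono K q \<eta>) simp
    moreover have "2 * pi * (Gamma p * (norm (a (Suc m)) * ((\<eta> + l * q) powr (- p) - 1) - K1) -
        norm R * (sqrt pi * \<eta> powr (- (1/2)))) * q powr p = f q"
      unfolding f_def e1 [symmetric] e2 [symmetric] by (simp add: algebra_simps)
    moreover have "sqrt (2 * pi) * ((l * sqrt (1 - q\<^sup>2)) powr (- (1/2)) *
        (2 * pi * norm R * q powr (- r) + K2 * q powr (- (r / 2)) + K3) + K4) * q powr p = g q"
      unfolding g_def e3 [symmetric] by (simp add: algebra_simps)
    ultimately show ?thesis by simp
  qed
  have q0: "((\<lambda>q::real. q) \<longlongrightarrow> 0) (at_right 0)" by (rule tendsto_ident_at)
  note P = powr_tendsto_0_at_right
  have qe: "((\<lambda>q. q powr ((1 - r) / 2)) \<longlongrightarrow> e) (at_right 0)"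
  proof (cases "r = 1")
    case True
    have "eventually (\<lambda>q::real. q powr ((1 - r) / 2) = e) (at_right 0)"
      using True by (intro eventually_at_rightI[of 0 1]) (auto simp: e_def)
    then show ?thesis by (rule tendsto_eventually)
  next
    case False
    then show ?thesis using P[of "(1 - r) / 2"] r by (simp add: e_def)
  qed
  have "(f \<longlongrightarrow> 2 * pi * (Gamma p * (norm (a (Suc m)) * ((0 + l) powr (- p) - 0) - K1 * 0) - norm R * (sqrt pi * 0))) (at_right 0)"
    unfolding f_def[abs_def] by (intro tendsto_intros P) (use r_pos p0 l in auto)
  moreover have "(g \<longlongrightarrow> sqrt (2 * pi) * ((l * sqrt (1 - 0\<^sup>2)) powr (- (1/2)) * (2 * pi * norm R * e + K2 * 0 + K3 * 0) + K4 * 0)) (at_right 0)"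
    unfolding g_def[abs_def] by (intro tendsto_intros P qe q0) (use p0 l in auto)
  moreover have "eventually (\<lambda>q. f q \<le> g q) (at_right 0)"
    by (intro eventually_at_rightI[of 0 "1/2"] fg) auto
  ultimately have "2 * pi * (Gamma p * (norm (a (Suc m)) * ((0 + l) powr (- p) - 0) - K1 * 0) - norm R * (sqrt pi * 0)) \<le>
      sqrt (2 * pi) * ((l * sqrt (1 - 0\<^sup>2)) powr (- (1/2)) * (2 * pi * norm R * e + K2 * 0 + K3 * 0) + K4 * 0)"
    by (intro tendsto_le[of "at_right (0::real)"]) auto
  then have "(2 * pi) * (Gamma p * norm (a (Suc m)) * l powr (- p)) \<le> (2 * pi) * (sqrt (2 * pi) * l powr (- (1/2)) * norm R * e)"
    by (simp add: mult_ac)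
  then have "Gamma p * norm (a (Suc m)) * l powr (- p) \<le> sqrt (2 * pi) * l powr (- (1/2)) * norm R * e"
    by (subst (asm) mult_le_cancel_left_pos) auto
  then show ?thesis by (auto simp: e_def l_def)
qed

section \<open>From finitely many zeros to a contradiction\<close>

text \<open>\<open>Gamma\<close> has no zeros, so above the highest zero of \<open>phi\<close> on
  the critical line \<open>F\<close> does not vanish, and being real and continuous it keeps its
  sign.\<close>

lemma finite_zeros_imp_sign:
  assumes fin: "finite {s. Re s = r / 2 \<and> phi s = 0}"
  obtains T s :: real where "T \<ge> 0" "s = 1 \<or> s = -1" "\<And>t. t \<ge> T \<Longrightarrow> s * F t \<ge> 0"
proof -
  define Z where "Z = {s. Re s = r / 2 \<and> phi s = 0}"
  \<comment> \<open>Inserting 0 makes \<open>Max\<close> defined when there are no zeros and gives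
    \<open>T > 0\<close>; the added 1 puts \<open>T\<close> strictly above all zeros.\<close>
  define T where "T = Max (insert 0 (Im ` Z)) + 1"
  have finI: "finite (insert 0 (Im ` Z))" using fin by (simp add: Z_def)
  have T: "T > 0" "\<And>s. s \<in> Z \<Longrightarrow> Im s < T"
  proof -
    have "0 \<le> Max (insert 0 (Im ` Z))" using finI by (rule Max_ge) simp
    then show "T > 0" by (simp add: T_def)
    fix s assume "s \<in> Z"
    then have "Im s \<le> Max (insert 0 (Im ` Z))" using finI by (intro Max_ge) auto
    then show "Im s < T" by (simp add: T_def)
  qed
  have nz: "F t \<noteq> 0" if "t \<ge> T" for t
  proof
    assume "F t = 0"
    then have "X (Complex (r / 2) t) = 0" by (simp add: X_critical_line)
    moreover have "Gamma (Complex (r / 2) t) \<noteq> 0"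
    proof -
      have "Complex (r / 2) t \<notin> \<int>\<^sub>\<le>\<^sub>0" using r_pos by (auto elim!: nonpos_Ints_cases simp: complex_eq_iff)
      then show ?thesis by (simp add: Gamma_eq_zero_iff)
    qed
    ultimately have "Complex (r / 2) t \<in> Z" by (simp add: X_def Z_def)
    then show False using T(2) that by fastforce
  qed
  define s where "s = sgn (F T)"
  have s: "s = 1 \<or> s = -1" using nz[of T] by (auto simp: s_def sgn_real_def)
  have "s * F t \<ge> 0" if t: "t \<ge> T" for t
  proof (rule ccontr)
    assume "\<not> s * F t \<ge> 0"
    moreover have "s * F T \<ge> 0" by (simp add: s_def sgn_real_def)
    moreover have "continuous_on {T..t} (\<lambda>x. s * F x)" by (intro continuous_intros continuous_F)
    ultimately obtain x where "T \<le> x" "s * F x = 0"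
      using IVT2'[of "\<lambda>x. s * F x" t 0 T] t by auto
    then show False using nz[of x] s by auto
  qed
  then show ?thesis using T(1) s by (intro that[of T s]) auto
qed

end

theorem corollary4p3:
  fixes r :: real
    and a b :: "nat \<Rightarrow> complex"
    and lam mu :: "nat \<Rightarrow> real"
    and phi psi :: "complex \<Rightarrow> complex"
  assumes "class_A r a lam b mu phi psi"
    and "\<forall>n\<ge>1. b n = cnj (a n)"
    and "\<forall>n\<ge>1. lam n = mu n"
    and "abs_conv_abscissa a lam < ereal (min 1 r + max 1 r / 2)"
    and "\<exists>\<theta>::real. \<forall>n\<ge>1. a n = of_real (norm (a n)) * exp (\<i> * of_real \<theta>)"
  shows "(r < 1 \<longrightarrow> infinite {s. Re s = r / 2 \<and> phi s = 0}) \<and>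
         (r = 1 \<longrightarrow>
         (let c = (LEAST n. 1 \<le> n \<and> a n \<noteq> 0); \<rho> = residue phi 1
          in norm (a c) > sqrt (2 * pi * lam c) * norm \<rho>) \<longrightarrow>
         infinite {s. Re s = 1 / 2 \<and> phi s = 0})"
proof -
  interpret self_dual_series r a b lam mu phi psi
    by standard (use assms in auto)
  obtain \<theta> where arg: "\<forall>n\<ge>1. a n = of_real (norm (a n)) * exp (\<i> * of_real \<theta>)"
    using assms(5) by blast
  define p where "p = (1 + r) / 2"
  define c where "c = (LEAST n. 1 \<le> n \<and> a n \<noteq> 0)"
  have "\<exists>n. 1 \<le> n \<and> a n \<noteq> 0" using assms(1) by (auto simp: class_A_def hecke_pair_def)
  then have c: "1 \<le> c" "a c \<noteq> 0" unfolding c_def by (metis (mono_tags, lifting) LeastI_ex)+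
  then obtain m where m: "c = Suc m" by (cases c) auto
  have l: "lam c > 0" by (rule lam_pos[OF c(1)])
  have bound: "Gamma p * norm (a c) * lam c powr (- p) \<le>
      (if r = 1 then sqrt (2 * pi) * lam c powr (- (1/2)) * norm R else 0)"
    if fin: "finite {s. Re s = r / 2 \<and> phi s = 0}" and r: "r \<le> 1"
  proof -
    \<comment> \<open>For \<open>r \<le> 1\<close> the left side is \<open>r + 1 / 2\<close> and the
      right side \<open>(3 + r) / 2\<close>.\<close>
    have "ereal (min 1 r + max 1 r / 2) \<le> ereal (p + 1)" using r by (simp add: p_def field_simps)
    then have conv: "abs_conv_abscissa a lam < ereal (p + 1)" using assms(4) by (rule order_less_le_trans[rotated])
    obtain T s :: real where "T \<ge> 0" "s = 1 \<or> s = -1" "\<And>t. t \<ge> T \<Longrightarrow> s * F t \<ge> 0"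
      using finite_zeros_imp_sign[OF fin] by blast
    then show ?thesis unfolding m by (intro coefficient_bound[OF arg _ _ _ p_def r conv])
  qed
  have "infinite {s. Re s = r / 2 \<and> phi s = 0}" if "r < 1"
  proof
    assume "finite {s. Re s = r / 2 \<and> phi s = 0}"
    \<comment> \<open>For \<open>r < 1\<close> the bound is 0, against
      \<open>a c \<noteq> 0\<close>.\<close>
    then have "Gamma p * norm (a c) * lam c powr (- p) \<le> 0" using bound that by auto
    moreover have "Gamma p > 0" using r_pos by (intro Gamma_real_pos) (simp add: p_def)
    ultimately show False using c l by (simp add: mult_le_0_iff)
  qed
  moreover have "infinite {s. Re s = 1 / 2 \<and> phi s = 0}"
    if r: "r = 1" and gt: "norm (a c) > sqrt (2 * pi * lam c) * norm (residue phi 1)"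
  proof
    \<comment> \<open>The factor \<open>Gamma 1 = 1\<close> drops out of \<open>R\<close>.\<close>
    have normR: "norm R = norm (residue phi 1)"
      unfolding R_def using r by simp
    assume "finite {s. Re s = 1 / 2 \<and> phi s = 0}"
    then have "norm (a c) * lam c powr (- 1) \<le> sqrt (2 * pi) * lam c powr (- (1/2)) * norm (residue phi 1)"
      using bound r unfolding normR by (simp add: p_def)
    \<comment> \<open>Here \<open>p = 1\<close>; multiplying by \<open>lam c\<close> turns the two
      powers of \<open>lam c\<close> into 1 and \<open>sqrt (lam c)\<close>.\<close>
    then have "norm (a c) * lam c powr (- 1) * lam c \<le> sqrt (2 * pi) * lam c powr (- (1/2)) * norm (residue phi 1) * lam c"
      using l by (intro mult_right_mono) auto
    moreover have "norm (a c) * lam c powr (- 1) * lam c = norm (a c)"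
      using l by (simp add: powr_minus_divide)
    moreover have "lam c powr (- (1/2)) * lam c = sqrt (lam c)"
      using l by (simp add: powr_minus powr_half_sqrt field_simps)
    moreover have "sqrt (2 * pi) * lam c powr (- (1/2)) * norm (residue phi 1) * lam c =
        sqrt (2 * pi) * (lam c powr (- (1/2)) * lam c) * norm (residue phi 1)"
      by (simp only: mult_ac)
    ultimately have "norm (a c) \<le> sqrt (2 * pi) * sqrt (lam c) * norm (residue phi 1)"
      by (simp only:)
    then show False using gt by (simp add: real_sqrt_mult)
  qed
  ultimately show ?thesis unfolding Let_def c_def [symmetric] by blast
qed

end
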